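(* Let $q$ be a nonzero complex number which is not a root of unity and $n\ge 1$. Every finite-dimensional irreducible representation $V$ of the twisted $q$-Yangian $\mathrm{Y}'_q(\mathfrak{sp}_{2n})$ is a highest weight representation. Moreover, $V$ contains a unique, up to a constant factor, highest vector.
   Context: $R(u,v)=(u-v)\sum_{i\ne j}E_{ii}\otimes E_{jj}+(q^{-1}u-qv)\sum_i E_{ii}\otimes E_{ii}+(q^{-1}-q)u\sum_{i>j}E_{ij}\otimes E_{ji}+(q^{-1}-q)v\sum_{i<j}E_{ij}\otimes E_{ji}$, indices in $\{1,\dots,2n\}$, $E_{ij}$ matrix units. $\mathrm{U}^{\rm ext}_q(\widehat{\mathfrak{gl}}_{2n})$ is the algebra with generators $t_{ij}^{(r)},\bar t_{ij}^{(r)}$ ($r\ge0$) and $(t_{ii}^{(0)})^{-1},(\bar t_{ii}^{(0)})^{-1}$, with $t_{ij}(u)=\sum_r t_{ij}^{(r)}u^{-r}$, $\bar t_{ij}(u)=\sum_r\bar t_{ij}^{(r)}u^r$, $T(u)=\sum t_{ij}(u)\otimes E_{ij}$, $\overline T(u)=\sum\bar t_{ij}(u)\otimes E_{ij}$, and relations $t_{ij}^{(0)}=\bar t_{ji}^{(0)}=0$ for $i<j$, $t_{ii}^{(0)}\bar t_{ii}^{(0)}=\bar t_{ii}^{(0)}t_{ii}^{(0)}$, the inverses being two-sided inverses, $R(u,v)T_1(u)T_2(v)=T_2(v)T_1(u)R(u,v)$, $R(u,v)\overline T_1(u)\overline T_2(v)=\overline T_2(v)\overline T_1(u)R(u,v)$,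 $R(u,v)\overline T_1(u)T_2(v)=T_2(v)\overline T_1(u)R(u,v)$. Put $s_{ij}(u)=q\sum_{a=1}^n t_{i,2a-1}(u)\bar t_{j,2a}(u^{-1})-\sum_{a=1}^n t_{i,2a}(u)\bar t_{j,2a-1}(u^{-1})=\sum_{r\ge0}s_{ij}^{(r)}u^{-r}$ and $\bar s_{ij}(u)=q\sum_a\bar t_{i,2a-1}(u)t_{j,2a}(u^{-1})-\sum_a\bar t_{i,2a}(u)t_{j,2a-1}(u^{-1})$. $\mathrm{Y}'_q(\mathfrak{sp}_{2n})$ is the subalgebra generated by all $s_{ij}^{(r)}$ and the inverses of $s_{i,i+1}^{(0)}=q\,t^{(0)}_{ii}\bar t^{(0)}_{i+1,i+1}$ for odd $i$; the coefficients of $\bar s_{ij}(u)$ lie in it. Let $\varsigma(i)=i$ for $i$ odd and $\varsigma(i)=-i+1$ for $i$ even. A representation $V$ is a highest weight representation if it is generated by a nonzero vector $\xi$ (a highest vector) such that $s_{kl}(u)\xi=0$ whenever $\varsigma(k)+\varsigma(l)>0$, and $s_{2i,2i-1}(u)\xi=\mu_i(u)\xi$, $\bar s_{2i,2i-1}(u)\xi=\bar\mu_i(u)\xi$ for $i=1,\dots,n$, for some formal series $\mu_i(u)\in\mathbb{C}[[u^{-1}]]$, $\bar\mu_i(u)\in\mathbb{C}[[u]]$. *)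

theory Defs
  imports "HOL-Analysis.Analysis" "HOL-Library.Function_Algebras"
begin

text \<open>Generators: T i j r = t_ij^(r), TB i j r = bar t_ij^(r), TI i = (t_ii^(0))^-1,
  TBI i = (bar t_ii^(0))^-1.  Elements of the free associative algebra are represented
  as coefficient functions on words; the product is the (finite) convolution over splittings.\<close>

datatype gen = T nat nat nat | TB nat nat nat | TI nat | TBI nat

type_synonym fa = "gen list \<Rightarrow> complex"

definition fmul :: "fa \<Rightarrow> fa \<Rightarrow> fa" where
  "fmul f g = (\<lambda>w. \<Sum>k\<le>length w. f (take k w) * g (drop k w))"

definition mono :: "gen list \<Rightarrow> fa" where
  "mono w = (\<lambda>w'. if w' = w then 1 else 0)"

definition fone :: fa where "fone = mono []"

definition gen :: "gen \<Rightarrow> fa" where "gen g = mono [g]"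

definition fscale :: "complex \<Rightarrow> fa \<Rightarrow> fa" where
  "fscale c f = (\<lambda>w. c * f w)"

text \<open>R(u,v) = u A + v B, with A, B constant matrices on C^N \<otimes> C^N (N = 2n),
  indexed by pairs.  Entry (row, column).\<close>

definition Rmat_A :: "complex \<Rightarrow> nat \<times> nat \<Rightarrow> nat \<times> nat \<Rightarrow> complex" where
  "Rmat_A q x y = (case x of (i, k) \<Rightarrow>
      if y = (i, k) then (if i = k then inverse q else 1)
      else if y = (k, i) \<and> i > k then inverse q - q else 0)"

definition Rmat_B :: "complex \<Rightarrow> nat \<times> nat \<Rightarrow> nat \<times> nat \<Rightarrow> complex" where
  "Rmat_B q x y = (case x of (i, k) \<Rightarrow>
      if y = (i, k) then (if i = k then - q else - 1)
      else if y = (k, i) \<and> i < k then inverse q - q else 0)"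

text \<open>Coefficient of u^e in t_ij(u) = \<Sum>_r t_ij^(r) u^-r, resp. in bar t_ij(u) = \<Sum>_r bar t_ij^(r) u^r.\<close>

definition tE :: "nat \<Rightarrow> nat \<Rightarrow> int \<Rightarrow> fa" where
  "tE i j e = (if e \<le> 0 then gen (T i j (nat (- e))) else 0)"

definition tbE :: "nat \<Rightarrow> nat \<Rightarrow> int \<Rightarrow> fa" where
  "tbE i j e = (if e \<ge> 0 then gen (TB i j (nat e)) else 0)"

text \<open>Coefficient of u^\<alpha> v^\<beta> in the ((i,k),(j,l)) matrix entry of
  R(u,v) P_1(u) Q_2(v) - Q_2(v) P_1(u) R(u,v).\<close>

definition rtt :: "nat \<Rightarrow> complex \<Rightarrow> (nat \<Rightarrow> nat \<Rightarrow> int \<Rightarrow> fa) \<Rightarrow> (nat \<Rightarrow> nat \<Rightarrow> int \<Rightarrow> fa)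
                     \<Rightarrow> nat \<Rightarrow> nat \<Rightarrow> nat \<Rightarrow> nat \<Rightarrow> int \<Rightarrow> int \<Rightarrow> fa" where
  "rtt n q P Q i j k l \<alpha> \<beta> =
     (\<Sum>a\<in>{1..2*n}. \<Sum>b\<in>{1..2*n}.
        fscale (Rmat_A q (i, k) (a, b)) (fmul (P a j (\<alpha> - 1)) (Q b l \<beta>))
      + fscale (Rmat_B q (i, k) (a, b)) (fmul (P a j \<alpha>) (Q b l (\<beta> - 1))))
   - (\<Sum>a\<in>{1..2*n}. \<Sum>b\<in>{1..2*n}.
        fscale (Rmat_A q (a, b) (j, l)) (fmul (Q k b \<beta>) (P i a (\<alpha> - 1)))
      + fscale (Rmat_B q (a, b) (j, l)) (fmul (Q k b (\<beta> - 1)) (P i a \<alpha>)))"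

definition Rels :: "nat \<Rightarrow> complex \<Rightarrow> fa set" where
  "Rels n q =
     {rtt n q tE tE i j k l \<alpha> \<beta> | i j k l \<alpha> \<beta>. {i, j, k, l} \<subseteq> {1..2*n}}
   \<union> {rtt n q tbE tbE i j k l \<alpha> \<beta> | i j k l \<alpha> \<beta>. {i, j, k, l} \<subseteq> {1..2*n}}
   \<union> {rtt n q tbE tE i j k l \<alpha> \<beta> | i j k l \<alpha> \<beta>. {i, j, k, l} \<subseteq> {1..2*n}}
   \<union> {gen (T i j 0) | i j. 1 \<le> i \<and> i < j \<and> j \<le> 2*n}
   \<union> {gen (TB j i 0) | i j. 1 \<le> i \<and> i < j \<and> j \<le> 2*n}
   \<union> {fmul (gen (T i i 0)) (gen (TB i i 0)) - fmul (gen (TB i i 0)) (gen (T i i 0)) | i. i \<in> {1..2*n}}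
   \<union> {fmul (gen (TI i)) (gen (T i i 0)) - fone | i. i \<in> {1..2*n}}
   \<union> {fmul (gen (T i i 0)) (gen (TI i)) - fone | i. i \<in> {1..2*n}}
   \<union> {fmul (gen (TBI i)) (gen (TB i i 0)) - fone | i. i \<in> {1..2*n}}
   \<union> {fmul (gen (TB i i 0)) (gen (TBI i)) - fone | i. i \<in> {1..2*n}}"

text \<open>The two-sided ideal generated by the relations; U^ext_q(gl_2n hat) is the quotient
  of the free algebra by it.\<close>

inductive_set Ideal :: "nat \<Rightarrow> complex \<Rightarrow> fa set" for n q where
  rel: "r \<in> Rels n q \<Longrightarrow> fmul (fmul (mono u) r) (mono v) \<in> Ideal n q"
| zero: "0 \<in> Ideal n q"
| add: "x \<in> Ideal n q \<Longrightarrow> y \<in> Ideal n q \<Longrightarrow> x + y \<in> Ideal n q"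
| scale: "x \<in> Ideal n q \<Longrightarrow> fscale c x \<in> Ideal n q"

definition s_lift :: "nat \<Rightarrow> complex \<Rightarrow> nat \<Rightarrow> nat \<Rightarrow> nat \<Rightarrow> fa" where
  "s_lift n q i j r = (\<Sum>p\<le>r.
      fscale q (\<Sum>a\<in>{1..n}. fmul (gen (T i (2*a-1) p)) (gen (TB j (2*a) (r - p))))
    - (\<Sum>a\<in>{1..n}. fmul (gen (T i (2*a) p)) (gen (TB j (2*a-1) (r - p)))))"

definition sbar_lift :: "nat \<Rightarrow> complex \<Rightarrow> nat \<Rightarrow> nat \<Rightarrow> nat \<Rightarrow> fa" where
  "sbar_lift n q i j r = (\<Sum>p\<le>r.
      fscale q (\<Sum>a\<in>{1..n}. fmul (gen (TB i (2*a-1) p)) (gen (T j (2*a) (r - p))))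
    - (\<Sum>a\<in>{1..n}. fmul (gen (TB i (2*a) p)) (gen (T j (2*a-1) (r - p)))))"

text \<open>Lift of the inverse of s_{i,i+1}^(0) = q t_ii^(0) bar t_{i+1,i+1}^(0) (i odd).\<close>
definition sinv :: "complex \<Rightarrow> nat \<Rightarrow> fa" where
  "sinv q i = fscale (inverse q) (mono [TBI (i + 1), TI i])"

text \<open>The subalgebra of the free algebra generated by these lifts; its image in the quotient
  is Y'_q(sp_2n).\<close>
inductive_set Ysub :: "nat \<Rightarrow> complex \<Rightarrow> fa set" for n q where
  one: "fone \<in> Ysub n q"
| s: "i \<in> {1..2*n} \<Longrightarrow> j \<in> {1..2*n} \<Longrightarrow> s_lift n q i j r \<in> Ysub n q"
| inv: "odd i \<Longrightarrow> 1 \<le> i \<Longrightarrow> i < 2*n \<Longrightarrow> sinv q i \<in> Ysub n q"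
| add: "x \<in> Ysub n q \<Longrightarrow> y \<in> Ysub n q \<Longrightarrow> x + y \<in> Ysub n q"
| mul: "x \<in> Ysub n q \<Longrightarrow> y \<in> Ysub n q \<Longrightarrow> fmul x y \<in> Ysub n q"
| scale: "x \<in> Ysub n q \<Longrightarrow> fscale c x \<in> Ysub n q"

text \<open>A finite-dimensional representation of Y'_q(sp_2n) on V = C^'d, given as a unital algebra
  homomorphism from Ysub to matrices that vanishes on Ysub \<inter> Ideal (i.e. factors
  through the image of Ysub in the quotient algebra).\<close>

definition is_rep :: "nat \<Rightarrow> complex \<Rightarrow> (fa \<Rightarrow> complex ^ 'd ^ 'd) \<Rightarrow> bool" where
  "is_rep n q \<rho> \<longleftrightarrow>
     \<rho> fone = mat 1
   \<and> (\<forall>x\<in>Ysub n q. \<forall>y\<in>Ysub n q. \<rho> (x + y) = \<rho> x + \<rho> y)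
   \<and> (\<forall>x\<in>Ysub n q. \<forall>c. \<rho> (fscale c x) = mat c ** \<rho> x)
   \<and> (\<forall>x\<in>Ysub n q. \<forall>y\<in>Ysub n q. \<rho> (fmul x y) = \<rho> x ** \<rho> y)
   \<and> (\<forall>x\<in>Ysub n q. x \<in> Ideal n q \<longrightarrow> \<rho> x = 0)"

definition csubspace :: "(complex ^ 'd) set \<Rightarrow> bool" where
  "csubspace W \<longleftrightarrow> 0 \<in> W \<and> (\<forall>x\<in>W. \<forall>y\<in>W. x + y \<in> W) \<and> (\<forall>c. \<forall>x\<in>W. c *s x \<in> W)"

definition is_irreducible :: "nat \<Rightarrow> complex \<Rightarrow> (fa \<Rightarrow> complex ^ 'd ^ 'd) \<Rightarrow> bool" where
  "is_irreducible n q \<rho> \<longleftrightarrow>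
     (\<forall>W. csubspace W \<and> (\<forall>x\<in>Ysub n q. \<forall>v\<in>W. \<rho> x *v v \<in> W) \<longrightarrow> W = {0} \<or> W = UNIV)"

definition vsig :: "nat \<Rightarrow> int" where
  "vsig i = (if odd i then int i else 1 - int i)"

definition is_highest_vector :: "nat \<Rightarrow> complex \<Rightarrow> (fa \<Rightarrow> complex ^ 'd ^ 'd) \<Rightarrow> complex ^ 'd \<Rightarrow> bool" where
  "is_highest_vector n q \<rho> \<xi> \<longleftrightarrow>
     \<xi> \<noteq> 0
   \<and> {\<rho> x *v \<xi> | x. x \<in> Ysub n q} = UNIV
   \<and> (\<forall>k\<in>{1..2*n}. \<forall>l\<in>{1..2*n}. vsig k + vsig l > 0 \<longrightarrow>
         (\<forall>r. \<rho> (s_lift n q k l r) *v \<xi> = 0))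
   \<and> (\<forall>i\<in>{1..n}. \<exists>\<mu>::nat \<Rightarrow> complex. \<forall>r.
         \<rho> (s_lift n q (2*i) (2*i-1) r) *v \<xi> = \<mu> r *s \<xi>)
   \<and> (\<forall>i\<in>{1..n}. \<exists>\<mu>::nat \<Rightarrow> complex. \<forall>r. \<forall>y\<in>Ysub n q.
         y - sbar_lift n q (2*i) (2*i-1) r \<in> Ideal n q \<longrightarrow> \<rho> y *v \<xi> = \<mu> r *s \<xi>)"

definition is_highest_weight_rep :: "nat \<Rightarrow> complex \<Rightarrow> (fa \<Rightarrow> complex ^ 'd ^ 'd) \<Rightarrow> bool" where
  "is_highest_weight_rep n q \<rho> \<longleftrightarrow> (\<exists>\<xi>. is_highest_vector n q \<rho> \<xi>)"

end

theory Submission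
  imports Defs "HOL-Computational_Algebra.Fundamental_Theorem_Algebra"
begin

text \<open>
  The RTT relations imply the reflection equation for \<open>S(u)\<close>. Linear functionals that vanish on the
  ideal turn it into linear relations between scalar power series, where common factors can be cancelled.

  Put \<open>P = 2n - 1\<close>. The invertible operator \<open>K = s\<^sub>P\<^sub>,\<^sub>P\<^sub>+\<^sub>1\<close> (zeroth coefficient) \<open>q\<close>-commutes with all
  \<open>s\<^sub>k\<^sub>l\<close>, which grades them; as \<open>q\<close> is not a root of unity, a top eigenspace of \<open>K\<close> is killed
  by all generators of positive grade. By the reflection equation a product of a generator of positive
  grade and one of nonpositive grade is a combination of products in which a positive one stands to the
  right or none occurs. Hence in an irreducible module the words of nonpositive generators applied to any
  \<open>K\<close>-eigenvector killed by the positive ones span everything, that vector lies in the top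
  eigenspace, and the top eigenspace is irreducible for the generators of grade zero. There
  \<open>s\<^sub>P\<^sub>,\<^sub>P\<^sub>+\<^sub>1(u)\<close> and \<open>s\<^sub>P\<^sub>+\<^sub>1\<^sub>,\<^sub>P(u)\<close> commute with all of these and are scalars by Schur's lemma, so what is
  left is an irreducible module for rank \<open>n - 1\<close>. After \<open>n\<close> steps a line remains: it is
  spanned by a highest vector and contains every other one.
\<close>

text \<open>Passing from the RTT relations to the reflection equation means moving one factor at a
  time through words in the t's and barred t's. In general these words lie outside
  \<open>Ysub\<close>, where \<open>\<rho>\<close> has no prescribed meaning. So
  \<open>\<psi> (\<rho> x *v w)\<close>, as a functional of \<open>x\<close> in \<open>Ysub\<close>,
  is extended to the whole free algebra so that it vanishes on \<open>Ideal\<close>, and the words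
  are handled there. The extension also turns identities between operator series into identities in
  the integral domain of power series in x and y, where the determinants of the 2 by 2 blocks of R
  can be divided out. Vectors come back because functionals separate a point from a subspace. A
  second obstacle: a highest vector is only required to be an eigenvector for
  \<open>s (2*i) (2*i - 1)\<close> and its barred version, while the descent needs an eigenvalue of
  the zeroth \<open>s (2*i - 1) (2*i)\<close>. The RTT relation between barred and unbarred series
  at v = u links the two: modulo the ideal, the zeroth barred coefficient is -1/q times that
  operator.\<close>

unbundle no vec_syntax
unbundle fps_syntax

section \<open>The reflection equation, entrywise\<close>

text \<open>With \<open>x = 1/u\<close>, \<open>y = 1/v\<close>, \<open>p = 1/q\<close>, the diagonal and off-diagonal entries of \<open>x y R(u,v)\<close> are
  \<open>Rd\<close> and \<open>Ro\<close>, and those of \<open>y R(1/u,v)\<close> are \<open>Td\<close> and \<open>To\<close>; these normalisations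
  avoid negative powers. In \<open>refl_eq\<close>, the value \<open>f i a j b\<close> stands for \<open>s\<^sub>i\<^sub>a(u) s\<^sub>j\<^sub>b(v)\<close> and
  \<open>g j b i a\<close> for \<open>s\<^sub>j\<^sub>b(v) s\<^sub>i\<^sub>a(u)\<close>.\<close>

definition Rd :: "'a::ring_1 \<Rightarrow> 'a \<Rightarrow> 'a \<Rightarrow> 'a \<Rightarrow> nat \<Rightarrow> nat \<Rightarrow> 'a" where
  "Rd q p x y i j = (if i = j then p * y - q * x else y - x)"

definition Ro :: "'a::ring_1 \<Rightarrow> 'a \<Rightarrow> 'a \<Rightarrow> 'a \<Rightarrow> nat \<Rightarrow> nat \<Rightarrow> 'a" where
  "Ro q p x y i j = (if j < i then (p - q) * y else if i < j then (p - q) * x else 0)"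

definition Td :: "'a::ring_1 \<Rightarrow> 'a \<Rightarrow> 'a \<Rightarrow> 'a \<Rightarrow> nat \<Rightarrow> nat \<Rightarrow> 'a" where
  "Td q p x y a j = (if a = j then p * (x * y) - q else x * y - 1)"

definition To :: "'a::ring_1 \<Rightarrow> 'a \<Rightarrow> 'a \<Rightarrow> 'a \<Rightarrow> nat \<Rightarrow> nat \<Rightarrow> 'a" where
  "To q p x y a j = (if j < a then (p - q) * (x * y) else if a < j then p - q else 0)"

definition refl_eq :: "'a::comm_ring_1 \<Rightarrow> 'a \<Rightarrow> 'a \<Rightarrow> 'a \<Rightarrow> (nat \<Rightarrow> nat \<Rightarrow> nat \<Rightarrow> nat \<Rightarrow> 'a)
    \<Rightarrow> (nat \<Rightarrow> nat \<Rightarrow> nat \<Rightarrow> nat \<Rightarrow> 'a) \<Rightarrow> nat \<Rightarrow> nat \<Rightarrow> nat \<Rightarrow> nat \<Rightarrow> bool" where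
  "refl_eq q p x y f g i j a b \<longleftrightarrow>
     Rd q p x y i j * (Td q p x y a j * f i a j b + To q p x y a j * f i j a b)
   + Ro q p x y i j * (Td q p x y a i * f j a i b + To q p x y a i * f j i a b)
   = Rd q p x y a b * (Td q p x y i b * g j b i a + To q p x y b i * g j i b a)
   + Ro q p x y b a * (Td q p x y i a * g j a i b + To q p x y a i * g j i a b)"

text \<open>For \<open>P = 2m - 1\<close>, the grade \<open>gr P k + gr P l\<close> of \<open>s\<^sub>k\<^sub>l\<close> is the exponent of \<open>q\<close> picked up when
  it is moved past \<open>s\<^sub>P\<^sub>,\<^sub>P\<^sub>+\<^sub>1\<close> (zeroth coefficient).\<close>

definition gr :: "nat \<Rightarrow> nat \<Rightarrow> int" where
  "gr P k = (if k = P then 1 else if k = Suc P then -1 else 0)"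

text \<open>The inequalities list what gets cancelled later: diagonal entries, the factors of the
  block determinants of R(u,v) and R(1/u,v), and in \<open>dbl\<close> the determinant that remains
  in \<open>MP_commute\<close>. The list is symmetric in \<open>x\<close> and \<open>y\<close>, so
  every consequence also holds with u and v exchanged.\<close>

locale generic_params =
  fixes q p x y :: "'a::idom"
  assumes qp: "q * p = 1" and xy: "x \<noteq> y" and xy1: "x * y \<noteq> 1"
    and pyqx: "p * y \<noteq> q * x" and pxqy: "p * x \<noteq> q * y"
    and pxyq: "p * (x * y) \<noteq> q" and qxyp: "q * (x * y) \<noteq> p"
    and dbl: "(x - y)\<^sup>2 \<noteq> 2 * (p - q)\<^sup>2 * (x * y)"
begin

lemma swap_params: "generic_params q p y x"
  by unfold_locales (use qp xy xy1 pyqx pxqy pxyq qxyp dbl in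
      \<open>auto simp: mult.commute power2_commute\<close>)

lemma Rd_nz: "Rd q p x y i j \<noteq> 0"
  using xy pyqx by (auto simp: Rd_def)

lemma Td_nz: "Td q p x y i j \<noteq> 0"
  using xy1 pxyq by (auto simp: Td_def)

text \<open>Unitarity of R: this is the determinant of its block on
  \<open>e\<^sub>i \<otimes> e\<^sub>j\<close> and \<open>e\<^sub>j \<otimes> e\<^sub>i\<close>, and
  it factors into two entries of diagonal type. \<open>det_T\<close> is the same for
  R(1/u,v).\<close>

lemma det_R: "(y - x) * (y - x) - (p - q) * (p - q) * (x * y) \<noteq> 0"
proof -
  have "(y - x) * (y - x) - (p - q) * (p - q) * (x * y) = (p * y - q * x) * (q * y - p * x)"
    using qp by algebra
  thus ?thesis using pyqx pxqy by auto
qed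

lemma det_T: "(x * y - 1) * (x * y - 1) - (p - q) * (p - q) * (x * y) \<noteq> 0"
proof -
  have "(x * y - 1) * (x * y - 1) - (p - q) * (p - q) * (x * y) = (p * (x * y) - q) * (q * (x * y) - p)"
    using qp by algebra
  thus ?thesis using pxyq qxyp by auto
qed

text \<open>Cramer's rule for the block with determinant \<open>det_R\<close>. The second premise is
  the first with \<open>i\<close> and \<open>j\<close> exchanged, so in applications both are
  instances of one statement.\<close>

lemma R_cancel:
  assumes "Rd q p x y i j * A + Ro q p x y i j * B = 0"
    and "Rd q p x y j i * B + Ro q p x y j i * A = 0"
  shows "i \<noteq> j \<Longrightarrow> A = 0"
proof -
  assume ij: "i \<noteq> j"
  have "((y - x) * (y - x) - (p - q) * (p - q) * (x * y)) * A = 0"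
  proof (cases "j < i")
    case True
    then have "(y - x) * A + (p - q) * y * B = 0" "(y - x) * B + (p - q) * x * A = 0"
      using assms by (auto simp: Rd_def Ro_def)
    then show ?thesis by algebra
  next
    case False
    then have "(y - x) * A + (p - q) * x * B = 0" "(y - x) * B + (p - q) * y * A = 0"
      using assms ij by (auto simp: Rd_def Ro_def)
    then show ?thesis by algebra
  qed
  with det_R show "A = 0" by simp
qed

lemma T_cancel:
  assumes "Td q p x y a j * A + To q p x y a j * B = 0"
    and "Td q p x y j a * B + To q p x y j a * A = 0"
  shows "a \<noteq> j \<Longrightarrow> A = 0"
proof -
  assume ij: "a \<noteq> j"
  have "((x * y - 1) * (x * y - 1) - (p - q) * (p - q) * (x * y)) * A = 0"
  proof (cases "j < a")
    case True
    then have "(x * y - 1) * A + (p - q) * (x * y) * B = 0" "(x * y - 1) * B + (p - q) * A = 0"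
      using assms by (auto simp: Td_def To_def)
    then show ?thesis by algebra
  next
    case False
    then have "(x * y - 1) * A + (p - q) * B = 0" "(x * y - 1) * B + (p - q) * (x * y) * A = 0"
      using assms ij by (auto simp: Td_def To_def)
    then show ?thesis by algebra
  qed
  with det_T show "A = 0" by simp
qed

end

section \<open>Straightening words of a fixed total grade\<close>

text \<open>\<open>f\<close> and \<open>g\<close> hold the two-letter words modulo a space that
  contains the words whose right letter is positive or whose left letter is nonpositive. The open
  words are those with a positive letter to the left of a nonpositive one. The total grade
  \<open>t\<close> can be fixed because the reflection equation only permutes the four
  indices.\<close>

locale graded_words = generic_params q p x y for q p x y :: "'a::idom" +
  fixes f g :: "nat \<Rightarrow> nat \<Rightarrow> nat \<Rightarrow> nat \<Rightarrow> 'a" and P :: nat and t :: int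
  assumes P1: "1 \<le> P"
    and re: "\<And>i j a b. {i, j, a, b} \<subseteq> {1..Suc P} \<Longrightarrow> refl_eq q p x y f g i j a b"
    and re': "\<And>i j a b. {i, j, a, b} \<subseteq> {1..Suc P} \<Longrightarrow> refl_eq q p y x g f i j a b"
    and known_f: "\<And>i a j b. {i, j, a, b} \<subseteq> {1..Suc P} \<Longrightarrow> gr P i + gr P a + gr P j + gr P b = t \<Longrightarrow>
        0 < gr P j + gr P b \<or> gr P i + gr P a \<le> 0 \<Longrightarrow> f i a j b = 0"
    and known_g: "\<And>i a j b. {i, j, a, b} \<subseteq> {1..Suc P} \<Longrightarrow> gr P i + gr P a + gr P j + gr P b = t \<Longrightarrow>
        0 < gr P j + gr P b \<or> gr P i + gr P a \<le> 0 \<Longrightarrow> g i a j b = 0"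
begin

lemma swap_words: "graded_words q p y x g f P t"
  using swap_params P1 re re' known_f known_g
  by (auto simp: graded_words_def graded_words_axioms_def)

abbreviation I where "I \<equiv> {1..Suc P}"

lemma word_M_first:
  assumes I: "{i, a, b} \<subseteq> I" and t: "gr P i + gr P a - 1 + gr P b = t"
  shows "f i a (Suc P) b = 0"
proof (cases "0 < gr P i + gr P a")
  case pos: True
  let ?M = "Suc P"
  have grM: "gr P ?M = -1" by (simp add: gr_def)
  have le: "gr P k \<le> 1" for k by (simp add: gr_def)
  have z: "f i ?M a b = 0" "f ?M a i b = 0" "f ?M i a b = 0"
    using I t P1 le[of i] le[of a] by (auto intro!: known_f simp: grM)
  have w: "g ?M b i a = 0" "g ?M i b a = 0" "g ?M a i b = 0" "g ?M i a b = 0"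
    using I t P1 le[of i] le[of a] pos by (auto intro!: known_g simp: grM)
  \<comment> \<open>In this instance every other word has the index \<open>?M\<close> in its left
    letter, whose grade is then at most 0.\<close>
  have "refl_eq q p x y f g i ?M a b" using I P1 by (intro re) auto
  then have "Rd q p x y i ?M * (Td q p x y a ?M * f i a ?M b) = 0"
    by (simp add: refl_eq_def z w)
  then show ?thesis using Rd_nz Td_nz by simp
next
  case False
  then show ?thesis using I t P1 by (intro known_f) (auto simp: gr_def)
qed

lemma word_M_last:
  assumes I: "{i, a, j} \<subseteq> I" and t: "gr P i + gr P a + gr P j - 1 = t"
  shows "f i a j (Suc P) = 0"
proof (cases "0 < gr P i + gr P a \<and> j \<noteq> Suc P")
  case True
  let ?M = "Suc P"
  have grM: "gr P ?M = -1" by (simp add: gr_def)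
  have le: "gr P k \<le> 1" for k by (simp add: gr_def)
  have ne: "i \<noteq> ?M" "a \<noteq> ?M" "j \<noteq> ?M"
    using True by (auto simp: gr_def split: if_splits)
  have key: "Rd q p x y i j * (Td q p x y a j * f i a j ?M + To q p x y a j * f i j a ?M)
           + Ro q p x y i j * (Td q p x y a i * f j a i ?M + To q p x y a i * f j i a ?M) = 0"
    if I: "{i, j, a} \<subseteq> I" and t: "gr P i + gr P a + gr P j - 1 = t" and ne: "i \<noteq> ?M" "j \<noteq> ?M" "a \<noteq> ?M"
    for i j a
  proof -
    interpret sw: graded_words q p y x g f P t by (rule swap_words)
    have g0: "g j ?M i a = 0" using I t P1 le[of j] 
      by (intro known_g) (auto simp: grM)
    have gA: "g j i ?M a = 0" using I t by (intro sw.word_M_first) auto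
    have f0: "f i ?M j a = 0" "f j ?M i a = 0" using I t P1 le[of i] le[of j]
      by (auto intro!: known_f simp: grM)
    have fA: "f i j ?M a = 0" "f j i ?M a = 0" using I t by (auto intro!: word_M_first)
    \<comment> \<open>Here the whole left side is known to vanish, hence so does the bracket on the
      right. That bracket reappears with another coefficient once \<open>a\<close> and
      \<open>?M\<close> are exchanged, so the right side of the second instance is zero as
      well.\<close>
    have "refl_eq q p x y f g i j ?M a" using I P1 by (intro re) auto
    then have "Rd q p x y ?M a * (Td q p x y i a * g j a i ?M + To q p x y a i * g j i a ?M) = 0"
      by (simp add: refl_eq_def g0 gA f0 fA)
    then have br: "Td q p x y i a * g j a i ?M + To q p x y a i * g j i a ?M = 0"
      using Rd_nz by simp
    have "refl_eq q p x y f g i j a ?M" using I P1 by (intro re) auto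
    then show ?thesis by (simp add: refl_eq_def br g0 gA)
  qed
  \<comment> \<open>Inverting the block of R in the pair \<open>i\<close>, \<open>j\<close> removes
    the outer coefficients; inverting that of R(1/u,v) in the pair \<open>a\<close>,
    \<open>j\<close> then isolates a single word.\<close>
  have al: "Td q p x y a j * f i a j ?M + To q p x y a j * f i j a ?M = 0"
    if I: "{i, j, a} \<subseteq> I" and t: "gr P i + gr P a + gr P j - 1 = t" and ne: "i \<noteq> ?M" "j \<noteq> ?M" "a \<noteq> ?M"
    for i j a
  proof (cases "i = j")
    case True
    then show ?thesis using key[OF I t ne] Rd_nz by (simp add: Ro_def)
  next
    case False
    show ?thesis
      by (rule R_cancel[OF _ _ False, of _ "Td q p x y a i * f j a i ?M + To q p x y a i * f j i a ?M"])
        (use key[OF I t ne] key[of j i a] I t ne in auto)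
  qed
  show ?thesis
  proof (cases "a = j")
    case True
    then show ?thesis using al[of i j a] I t ne Td_nz by (simp add: To_def)
  next
    case False
    show ?thesis
      by (rule T_cancel[OF _ _ False, of _ "f i j a ?M"]) (use al[of i j a] al[of i a j] I t ne in auto)
  qed
next
  case False
  then show ?thesis using I t P1 word_M_first[of i a "Suc P"]
    by (cases "j = Suc P") (auto intro!: known_f simp: gr_def split: if_splits)
qed

text \<open>Without the index \<open>Suc P\<close> all grades are nonnegative: a word with
  \<open>P\<close> in its right letter is known, and so is one without \<open>P\<close>, whose left
  letter has grade 0. The case of \<open>P\<close> in second place comes from equations with last
  index \<open>P\<close>; with that settled, an equation with first index \<open>P\<close> leaves
  only words with \<open>P\<close> in first place.\<close>

lemma word_no_M:
  assumes I: "{i, a, j, b} \<subseteq> {1..P}" and t: "gr P i + gr P a + gr P j + gr P b = t"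
  shows "f i a j b = 0"
proof -
  have I': "{i, a, j, b} \<subseteq> I" using I by auto
  have ge: "0 \<le> gr P k" if "k \<in> {1..P}" for k using that by (auto simp: gr_def)
  have grP: "gr P P = 1" by (simp add: gr_def)
  have last: "f i a j P = 0" "g i a j P = 0" "f i a P j = 0" "g i a P j = 0"
    if "{i, a, j} \<subseteq> {1..P}" "gr P i + gr P a + gr P j + 1 = t" for i a j
    using that ge[of j] P1 by (auto intro!: known_f known_g simp: grP)
  have gP: "g j P i a = 0" if I: "{i, a, j} \<subseteq> {1..P}" and t: "gr P i + gr P a + gr P j + 1 = t" for i a j
  proof -
    have "refl_eq q p x y f g i j a P" using I P1 by (intro re) auto
    then have "Rd q p x y a P * (Td q p x y i P * g j P i a) = 0"
      using I t by (simp add: refl_eq_def last)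
    then show ?thesis using Rd_nz Td_nz by simp
  qed
  have fP: "f j P i a = 0" if I: "{i, a, j} \<subseteq> {1..P}" and t: "gr P i + gr P a + gr P j + 1 = t" for i a j
  proof -
    interpret sw: generic_params q p y x by (rule swap_params)
    have "refl_eq q p y x g f i j a P" using I P1 by (intro re') auto
    then have "Rd q p y x a P * (Td q p y x i P * f j P i a) = 0"
      using I t by (simp add: refl_eq_def last)
    then show ?thesis using sw.Rd_nz sw.Td_nz by simp
  qed
  show ?thesis
  proof (cases "P = a \<or> P = j \<or> P = b \<or> P \<noteq> i")
    case True
    then show ?thesis
    proof (elim disjE)
      assume "P = a" then show ?thesis using fP[of j b i] I t grP by simp
    next
      assume "P = j" then show ?thesis using last[of i a b] I t grP by simp
    next
      assume "P = b" then show ?thesis using last[of i a j] I t grP by simp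
    next
      assume "P \<noteq> i"
      show ?thesis
      proof (cases "P = a")
        case True
        then show ?thesis using fP[of j b i] I t grP by simp
      next
        case False
        then show ?thesis using \<open>P \<noteq> i\<close> I t by (intro known_f) (auto simp: gr_def)
      qed
    qed
  next
    case False
    then have [simp]: "i = P" and ne: "a \<noteq> P" "j \<noteq> P" "b \<noteq> P" by auto
    have al: "Td q p x y a j * f P a j b + To q p x y a j * f P j a b = 0"
      if I: "{a, j, b} \<subseteq> {1..P}" and t: "1 + gr P a + gr P j + gr P b = t"
      for a j
    proof -
      have "refl_eq q p x y f g P j a b" using I P1 by (intro re) auto
      then have "Rd q p x y P j * (Td q p x y a j * f P a j b + To q p x y a j * f P j a b) = 0"
        using I t by (simp add: refl_eq_def last gP fP)
      then show ?thesis using Rd_nz by simp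
    qed
    show ?thesis
    proof (cases "a = j")
      case True
      then show ?thesis using al[of a j] I t Td_nz by (simp add: To_def grP)
    next
      case False
      have "f P a j b = 0"
        by (rule T_cancel[OF _ _ False, of _ "f P j a b"]) (use al[of a j] al[of j a] I t in \<open>auto simp: grP\<close>)
      then show ?thesis by simp
    qed
  qed
qed

theorem all_words_vanish:
  assumes I: "{i, a, j, b} \<subseteq> I" and t: "gr P i + gr P a + gr P j + gr P b = t"
  shows "f i a j b = 0"
proof -
  have grM: "gr P (Suc P) = -1" by (simp add: gr_def)
  consider "j = Suc P" | "b = Suc P" | "i = Suc P \<or> a = Suc P" | "{i, a, j, b} \<subseteq> {1..P}"
    using I by fastforce
  then show ?thesis
  proof cases
    case 1 then show ?thesis using word_M_first[of i a b] I t by (simp add: grM)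
  next
    case 2 then show ?thesis using word_M_last[of i a j] I t by (simp add: grM)
  next
    case 3 then show ?thesis using I t by (intro known_f) (auto simp: gr_def)
  next
    case 4 then show ?thesis using word_no_M t by blast
  qed
qed

end


section \<open>Commutation of letters of grade zero on a killed vector\<close>

text \<open>The words act on a vector killed by all positive letters, so only a positive right
  letter makes a word vanish. The other words need not vanish; the aim is to compare
  \<open>f\<close> with \<open>g\<close>.\<close>

locale top_words = generic_params q p x y for q p x y :: "'a::idom" +
  fixes f g :: "nat \<Rightarrow> nat \<Rightarrow> nat \<Rightarrow> nat \<Rightarrow> 'a" and P :: nat
  assumes P1: "1 \<le> P"
    and re: "\<And>i j a b. {i, j, a, b} \<subseteq> {1..Suc P} \<Longrightarrow> refl_eq q p x y f g i j a b"
    and re': "\<And>i j a b. {i, j, a, b} \<subseteq> {1..Suc P} \<Longrightarrow> refl_eq q p y x g f i j a b"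
    and known_f: "\<And>i a j b. {i, j, a, b} \<subseteq> {1..Suc P} \<Longrightarrow> 0 < gr P j + gr P b \<Longrightarrow> f i a j b = 0"
    and known_g: "\<And>i a j b. {i, j, a, b} \<subseteq> {1..Suc P} \<Longrightarrow> 0 < gr P j + gr P b \<Longrightarrow> g i a j b = 0"
begin

lemma swap_top: "top_words q p y x g f P"
  using swap_params P1 re re' known_f known_g
  by (auto simp: top_words_def top_words_axioms_def)

lemmas coeffs = refl_eq_def Rd_def Ro_def Td_def To_def

lemma kill:
  assumes "{i, a, c} \<subseteq> {1..Suc P}" "c \<noteq> Suc P"
  shows "f i a c P = 0" "f i a P c = 0" "g i a c P = 0" "g i a P c = 0"
  using assms P1 by (auto intro!: known_f known_g simp: gr_def)

context
  fixes c d :: nat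
  assumes c: "1 \<le> c" "c < P" and d: "1 \<le> d" "d < P"
begin

lemma ord: "c < Suc P" "d < Suc P" "c \<noteq> P" "d \<noteq> P" "c \<noteq> Suc P" "d \<noteq> Suc P" "P \<noteq> c" "P \<noteq> d"
  "Suc P \<noteq> c" "Suc P \<noteq> d" "\<not> P < c" "\<not> P < d" "\<not> Suc P < c" "\<not> Suc P < d"
  using c d by auto

text \<open>Words made of a letter of grade 1 and one of grade -1 also occur and are unknown. Two
  instances express them through words in letters of grade 0, and a third eliminates them.\<close>

lemma MP_aux:
  shows "((x - y)\<^sup>2 - (p - q)\<^sup>2 * (x * y)) * (f (Suc P) P c d - g c d (Suc P) P)
       + (p - q)\<^sup>2 * (x * y) * (g (Suc P) P c d - f c d (Suc P) P) = 0"
    and "(y - x) * f c P (Suc P) d + (p - q) * x * (f (Suc P) P c d - g (Suc P) P c d) = 0"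
    and "(y - x) * g c P (Suc P) d = (p - q) * y * (f c d (Suc P) P - g c d (Suc P) P)"
proof -
  let ?M = "Suc P"
  have in1: "{c, d, P, ?M} \<subseteq> {1..?M}" using c d by auto
  have e1: "(x * y - 1) * ((y - x) * (f ?M P c d - g c d ?M P) + (p - q) * y * f c P ?M d - (p - q) * x * g c P ?M d) = 0"
    using re[of ?M c P d] in1 by (simp add: coeffs kill ord c d algebra_simps)
  have e2: "(x * y - 1) * ((y - x) * f c P ?M d + (p - q) * x * (f ?M P c d - g ?M P c d)) = 0"
    using re[of c ?M P d] in1 by (simp add: coeffs kill ord c d algebra_simps)
  have e3: "(x * y - 1) * ((y - x) * g c P ?M d - (p - q) * y * (f c d ?M P - g c d ?M P)) = 0"
    using re[of ?M c d P] in1 by (simp add: coeffs kill ord c d algebra_simps)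
  show e2': "(y - x) * f c P ?M d + (p - q) * x * (f ?M P c d - g ?M P c d) = 0"
    using e2 xy1 by simp
  show e3': "(y - x) * g c P ?M d = (p - q) * y * (f c d ?M P - g c d ?M P)"
    using e3 xy1 by simp
  have e1': "(y - x) * (f ?M P c d - g c d ?M P) + (p - q) * y * f c P ?M d - (p - q) * x * g c P ?M d = 0"
    using e1 xy1 by simp
  show "((x - y)\<^sup>2 - (p - q)\<^sup>2 * (x * y)) * (f ?M P c d - g c d ?M P)
       + (p - q)\<^sup>2 * (x * y) * (g ?M P c d - f c d ?M P) = 0"
    using e1' e2' e3' by algebra
qed

lemma MP_commute: "f (Suc P) P c d = g c d (Suc P) P"
proof -
  interpret sw: top_words q p y x g f P by (rule swap_top)
  let ?X = "f (Suc P) P c d - g c d (Suc P) P" and ?Z = "g (Suc P) P c d - f c d (Suc P) P"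
  have 1: "((x - y)\<^sup>2 - (p - q)\<^sup>2 * (x * y)) * ?X + (p - q)\<^sup>2 * (x * y) * ?Z = 0"
    by (rule MP_aux)
  have 2: "((x - y)\<^sup>2 - (p - q)\<^sup>2 * (x * y)) * ?Z + (p - q)\<^sup>2 * (x * y) * ?X = 0"
    using sw.MP_aux(1)[OF c d] by (simp add: power2_commute mult.commute)
  \<comment> \<open>The system has equal diagonal and equal off-diagonal entries, so its determinant
    is a difference of squares: \<open>(x - y)\<^sup>2\<close> times the factor excluded by
    \<open>dbl\<close>.\<close>
  from 1 2 have "(x - y)\<^sup>2 * ((x - y)\<^sup>2 - 2 * (p - q)\<^sup>2 * (x * y)) * ?X = 0" by algebra
  then show ?thesis using xy dbl by auto
qed

end

context
  fixes c d :: nat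
  assumes c: "1 \<le> c" "c < P" and d: "1 \<le> d" "d < P"
begin

lemmas ord' = ord[OF c d]

lemma PM_commute: "f P (Suc P) c d = g c d P (Suc P)"
proof -
  interpret sw: top_words q p y x g f P by (rule swap_top)
  let ?M = "Suc P"
  have in1: "{c, d, P, ?M} \<subseteq> {1..?M}" using c d by auto
  have MP: "g c d ?M P = f ?M P c d" "g d c ?M P = f ?M P d c"
     "g ?M P c d = f c d ?M P"  "g ?M P d c = f d c ?M P"
    using MP_commute[OF c d] MP_commute[OF d c] sw.MP_commute[OF c d] sw.MP_commute[OF d c] by auto
  have a1: "(y - x) * f c P ?M d + (p - q) * x * (f ?M P c d - f c d ?M P) = 0"
    and a2: "(y - x) * g c P ?M d = (p - q) * y * (f c d ?M P - f ?M P c d)"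
    using MP_aux[OF c d] MP by auto
  let ?A = "f P ?M c d" and ?B = "g c d P ?M" and ?U = "f c d ?M P" and ?V = "f ?M P c d"
  let ?F = "f P c ?M d" and ?G = "g c P d ?M" and ?f = "f c P ?M d" and ?g = "g c P ?M d"
  let ?h = "p - q" and ?s = "x * y" and ?e = "y - x"
  \<comment> \<open>This combination of words occurs in both \<open>h1\<close> and
    \<open>h3\<close>; comparing the two removes it, and the words ending in \<open>Suc P\<close>,
    \<open>P\<close> disappear with it.\<close>
  let ?Q = "Rd q p x y d c * f d c ?M P + Ro q p x y d c * ?U"
  have Rdc: "Rd q p x y c d = Rd q p x y d c" by (simp add: Rd_def)
  have h1: "?h * ?s * ?Q = ?e * ((?s - 1) * ?G + ?h * ?s * ?B) + ?h * ?h * x * ?s * ?V"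
    using re[of d c ?M P] in1
    by (simp add: refl_eq_def Rd_def[of _ _ _ _ ?M] Ro_def[of _ _ _ _ P] Td_def To_def kill ord' c d MP algebra_simps)
  have h2: "?e * (?s - 1) * (?A - ?B) + ?e * ?h * (?s * ?F - ?G) + ?h * ?h * ?s * (y * ?f - x * ?g) = 0"
    using re[of P c ?M d] in1 by (simp add: coeffs kill ord' c d algebra_simps)
  have h3: "?e * ((?s - 1) * ?F + ?h * ?A) + ?h * ?h * x * ?V = ?h * ?Q"
    using re[of P ?M c d] in1
    by (simp add: refl_eq_def Rd_def[of _ _ _ _ P] Ro_def[of _ _ _ _ P] Td_def To_def kill ord' c d MP Rdc algebra_simps)
  have "?e * ((?s - 1) * (?s * ?F - ?G) + ?h * ?s * (?A - ?B)) = 0"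
    using h1 h3 by algebra
  then have i1: "(?s - 1) * (?s * ?F - ?G) + ?h * ?s * (?A - ?B) = 0" using xy by simp
  have "?e * (y * ?f - x * ?g) = 0" using a1 a2 by algebra
  then have i2: "y * ?f - x * ?g = 0" using xy by simp
  have "?e * (((?s - 1) * (?s - 1) - ?h * ?h * ?s) * (?A - ?B)) = 0"
    using h2 i1 unfolding i2 by algebra
  then show ?thesis using xy det_T by simp
qed

end

lemma MP_MP: "f (Suc P) P (Suc P) P = g (Suc P) P (Suc P) P"
  and PM_MP: "f P (Suc P) (Suc P) P = g (Suc P) P P (Suc P)"
proof -
  let ?M = "Suc P"
  have in1: "{P, ?M} \<subseteq> {1..?M}" using P1 by auto
  have z: "f i a P P = 0" "g i a P P = 0" if "{i, a} \<subseteq> {1..?M}" for i a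
    using kill[of i a P] that P1 by auto
  have "(p * y - q * x) * ((x * y - 1) * (f ?M P ?M P - g ?M P ?M P)) = 0"
    using re[of ?M ?M P P] in1 by (simp add: coeffs z algebra_simps)
  then show MP: "f ?M P ?M P = g ?M P ?M P" using pyqx xy1 by simp
  have "(y - x) * ((p * (x * y) - q) * (f P ?M ?M P - g ?M P P ?M)) = 0"
    using re[of P ?M ?M P] in1 MP by (simp add: coeffs z algebra_simps)
  then show "f P ?M ?M P = g ?M P P ?M" using xy pxyq by simp
qed

lemma PM_PM: "f P (Suc P) P (Suc P) = g P (Suc P) P (Suc P)"
proof -
  interpret sw: top_words q p y x g f P by (rule swap_top)
  let ?M = "Suc P"
  have in1: "{P, ?M} \<subseteq> {1..?M}" using P1 by auto
  have z: "f i a P P = 0" "g i a P P = 0" if "{i, a} \<subseteq> {1..?M}" for i a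
    using kill[of i a P] that P1 by auto
  let ?A = "f P ?M P ?M" and ?B = "g P ?M P ?M" and ?F = "f P P ?M ?M" and ?G = "g P P ?M ?M"
  let ?h = "p - q" and ?s = "x * y" and ?k = "p * (x * y) - q"
  have "(p * y - q * x) * ((?s - 1) * (?A - ?B) + ?h * ?s * (?F - ?G)) = 0"
    using re[of P P ?M ?M] in1 by (simp add: coeffs z algebra_simps)
  then have 1: "(?s - 1) * (?A - ?B) + ?h * ?s * (?F - ?G) = 0" using pyqx by simp
  \<comment> \<open>\<open>2\<close> and \<open>3\<close> are one instance and its mirror image
    under exchange of u and v. Subtracting them gives, together with \<open>1\<close>, a homogeneous
    system for \<open>?A - ?B\<close> and \<open>?F - ?G\<close> with the determinant of
    \<open>det_T\<close>.\<close>
  have 2: "(y - x) * ((?s - 1) * ?F + ?h * ?A) + ?h * x * ?k * f ?M P P ?M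
      = (y - x) * ?h * ?s * g ?M P ?M P + ?h * y * ?k * g ?M P P ?M"
    using re[of P ?M P ?M] in1 by (simp add: coeffs z algebra_simps)
  have 3: "(x - y) * ((?s - 1) * ?G + ?h * ?B) + ?h * y * ?k * g ?M P P ?M
      = (x - y) * ?h * ?s * g ?M P ?M P + ?h * x * ?k * f ?M P P ?M"
    using re'[of P ?M P ?M] in1 by (simp add: coeffs z MP_MP algebra_simps)
  have "(y - x) * ((?s - 1) * (?F - ?G) + ?h * (?A - ?B)) = 0" using 2 3 by algebra
  then have 4: "(?s - 1) * (?F - ?G) + ?h * (?A - ?B) = 0" using xy by simp
  have "((?s - 1) * (?s - 1) - ?h * ?h * ?s) * (?A - ?B) = 0" using 1 4 by algebra
  then show ?thesis using det_T by simp
qed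

lemma zero_letters_commute:
  assumes "(i, a) = (P, Suc P) \<or> (i, a) = (Suc P, P)"
    and "(j, b) = (P, Suc P) \<or> (j, b) = (Suc P, P) \<or> {j, b} \<subseteq> {1..<P}"
  shows "f i a j b = g j b i a"
proof -
  interpret sw: top_words q p y x g f P by (rule swap_top)
  show ?thesis
    using assms MP_MP PM_MP PM_PM sw.PM_MP MP_commute PM_commute by auto
qed

end

section \<open>Linear algebra\<close>

text \<open>A basis of \<open>S\<close> is enlarged by vectors of \<open>Y\<close> to a basis of
  \<open>S + Y\<close>; the functional is 0 on the old vectors and \<open>\<phi>\<close> on the new
  ones. It agrees with \<open>\<phi>\<close> on all of \<open>Y\<close> because the component along
  \<open>S\<close> of a vector of \<open>Y\<close> lies in both spaces, where \<open>\<phi>\<close>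
  is 0.\<close>

lemma linear_functional_extension:
  fixes scale :: "'k::field \<Rightarrow> 'v::ab_group_add \<Rightarrow> 'v" and \<phi> :: "'v \<Rightarrow> 'k"
  assumes vs: "vector_space scale"
    and S: "module.subspace scale S" and Y: "module.subspace scale Y"
    and add: "\<And>x y. x \<in> Y \<Longrightarrow> y \<in> Y \<Longrightarrow> \<phi> (x + y) = \<phi> x + \<phi> y"
    and scl: "\<And>c x. x \<in> Y \<Longrightarrow> \<phi> (scale c x) = c * \<phi> x"
    and zero: "\<And>x. x \<in> S \<Longrightarrow> x \<in> Y \<Longrightarrow> \<phi> x = 0"
  obtains \<Psi> where "Vector_Spaces.linear scale (*) \<Psi>" "\<And>x. x \<in> S \<Longrightarrow> \<Psi> x = 0"
    "\<And>y. y \<in> Y \<Longrightarrow> \<Psi> y = \<phi> y"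
proof -
  interpret vector_space scale by (rule vs)
  interpret pr: vector_space_pair scale "(*) :: 'k \<Rightarrow> 'k \<Rightarrow> 'k"
    by unfold_locales (auto simp: algebra_simps)
  obtain A where A: "A \<subseteq> S" "independent A" "S \<subseteq> span A"
    by (rule maximal_independent_subset_extend[OF empty_subsetI independent_empty])
  have spA: "span A = S" using A S by (meson span_minimal subset_antisym)
  obtain B where B: "A \<subseteq> B" "B \<subseteq> A \<union> Y" "independent B" "A \<union> Y \<subseteq> span B"
    using maximal_independent_subset_extend[of A "A \<union> Y"] A(2) by blast
  obtain \<Psi> where \<Psi>: "Vector_Spaces.linear scale (*) \<Psi>" "\<And>b. b \<in> B \<Longrightarrow> \<Psi> b = (if b \<in> A then 0 else \<phi> b)"
    using pr.linear_independent_extend[OF B(3), of "\<lambda>b. if b \<in> A then 0 else \<phi> b"] by blast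
  interpret L: Vector_Spaces.linear scale "(*)" \<Psi> by (rule \<Psi>(1))
  have z: "\<Psi> x = 0" if "x \<in> S" for x
  proof -
    have "x \<in> span A" using that spA by simp
    then show ?thesis
      by (rule span_induct_alt) (use \<Psi>(2) B(1) in \<open>auto simp: L.add L.scale\<close>)
  qed
  moreover have "\<Psi> y = \<phi> y" if y: "y \<in> Y" for y
  proof -
    have "B = A \<union> (B - A)" using B(1) by auto
    then have "y \<in> span (A \<union> (B - A))" using y B(4) by auto
    then obtain a b where ab: "y = a + b" "a \<in> span A" "b \<in> span (B - A)"
      unfolding span_Un by auto
    have BY: "B - A \<subseteq> Y" using B(2) by auto
    have "b \<in> Y \<and> \<Psi> b = \<phi> b" using ab(3)
    proof (induction rule: span_induct_alt)
      case base
      have "\<phi> (scale 0 0) = 0 * \<phi> 0" using scl[of 0 0] subspace_0[OF Y] by simp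
      then show ?case using subspace_0[OF Y] by (simp add: L.zero)
    next
      case (step c x v)
      then show ?case using BY \<Psi>(2)[of x] subspace_add[OF Y] subspace_scale[OF Y]
        by (auto simp: L.add L.scale add scl)
    qed
    moreover from this have "a \<in> Y" using ab(1) y subspace_diff[OF Y, of y b] by simp
    ultimately show ?thesis using ab spA z[of a] zero[of a] add[of a b] by (simp add: L.add)
  qed
  ultimately show ?thesis using \<Psi>(1) that by blast
qed

lemma csubspace_iff: "csubspace W \<longleftrightarrow> vec.subspace W"
  by (auto simp: csubspace_def vec.subspace_def)

text \<open>If \<open>v\<close> were outside, the coordinate on the line through \<open>v\<close>
  would extend to a functional that vanishes on \<open>W\<close> and takes the value 1 at
  \<open>v\<close>. No finiteness is assumed, so it also serves to prove membership in
  \<open>Ideal\<close>.\<close>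

lemma mem_subspace_if_all_functionals:
  fixes scale :: "'k::field \<Rightarrow> 'v::ab_group_add \<Rightarrow> 'v"
  assumes vs: "vector_space scale" and W: "module.subspace scale W"
    and *: "\<And>\<psi>. Vector_Spaces.linear scale (*) \<psi> \<Longrightarrow> (\<And>w. w \<in> W \<Longrightarrow> \<psi> w = 0) \<Longrightarrow> \<psi> v = 0"
  shows "v \<in> W"
proof (rule ccontr)
  interpret vector_space scale by (rule vs)
  assume v: "v \<notin> W"
  have rep: "\<exists>c. y = scale c v" if "y \<in> span {v}" for y
    using that by (auto simp: span_singleton)
  have v0: "v \<noteq> 0" using v subspace_0[OF W] by auto
  define \<phi> where "\<phi> y = (SOME c. y = scale c v)" for y
  have phi: "\<phi> (scale c v) = c" for c
    unfolding \<phi>_def using v0 by (intro some_equality) auto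
  obtain \<psi> where "Vector_Spaces.linear scale (*) \<psi>" "\<And>x. x \<in> W \<Longrightarrow> \<psi> x = 0"
    "\<And>y. y \<in> span {v} \<Longrightarrow> \<psi> y = \<phi> y"
  proof (rule linear_functional_extension[OF vs W subspace_span, of "{v}" \<phi>])
    fix x y assume "x \<in> span {v}" "y \<in> span {v}"
    then obtain a b where "x = scale a v" "y = scale b v" using rep by metis
    then show "\<phi> (x + y) = \<phi> x + \<phi> y" using phi[of "a + b"]
      by (simp add: phi scale_left_distrib)
  next
    fix c x assume "x \<in> span {v}"
    then obtain a where "x = scale a v" using rep by metis
    then show "\<phi> (scale c x) = c * \<phi> x" using phi[of "c * a"] by (simp add: phi)
  next
    fix x assume x: "x \<in> W" "x \<in> span {v}"
    then obtain a where a: "x = scale a v" using rep by metis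
    have "a = 0"
    proof (rule ccontr)
      assume "a \<noteq> 0"
      then have "v = scale (inverse a) x" using a by simp
      then show False using v x(1) subspace_scale[OF W] by metis
    qed
    then show "\<phi> x = 0" using a phi[of 0] by simp
  qed auto
  then show False using *[of \<psi>] phi[of 1] span_base[of v "{v}"] by auto
qed

lemma mem_subspace_if_functionals:
  fixes W :: "(complex ^ 'd) set"
  assumes "vec.subspace W"
    and "\<And>\<psi>. Vector_Spaces.linear (*s) (*) \<psi> \<Longrightarrow> (\<And>w. w \<in> W \<Longrightarrow> \<psi> w = 0) \<Longrightarrow> \<psi> v = 0"
  shows "v \<in> W"
  by (rule mem_subspace_if_all_functionals[OF vec.vector_space_axioms assms])

section \<open>Polynomials in a matrix, eigenvectors and generalised eigenspaces\<close>

definition pact :: "complex poly \<Rightarrow> complex ^ 'd ^ 'd \<Rightarrow> complex ^ 'd \<Rightarrow> complex ^ 'd" where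
  "pact p k = fold_coeffs (\<lambda>a f v. a *s v + k *v f v) p (\<lambda>_. 0)"

lemma pact_0 [simp]: "pact 0 k v = 0"
  by (simp add: pact_def)

lemma pact_pCons [simp]: "pact (pCons a p) k v = a *s v + k *v pact p k v"
  by (cases "a = 0"; cases "p = 0")
    (simp_all add: pact_def fold_coeffs_pCons_coeff_not_0_eq fold_coeffs_pCons_not_0_0_eq)

lemma mult_vec_scale: "(A :: complex ^ 'd ^ 'd) *v (c *s v) = c *s (A *v v)"
  by (simp add: vec.scale)

lemma pact_lin: "pact p k (v + w) = pact p k v + pact p k w" "pact p k (c *s v) = c *s pact p k v"
  by (induction p) (simp_all add: matrix_vector_right_distrib mult_vec_scale algebra_simps
      vec.scale_right_distrib)

lemma pact_zero [simp]: "pact p k 0 = 0"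
  by (induction p) simp_all

lemma pact_add: "pact (p + r) k v = pact p k v + pact r k v"
proof (induction p r rule: poly_induct2)
  case (pCons a p b q)
  then show ?case by (simp add: matrix_vector_right_distrib vec.scale_left_distrib algebra_simps)
qed simp

lemma pact_smult: "pact (smult c p) k v = c *s pact p k v"
  by (induction p) (simp_all add: mult_vec_scale vec.scale_right_distrib)

lemma pact_mult: "pact (p * r) k v = pact p k (pact r k v)"
  by (induction p) (simp_all add: pact_add pact_smult)

lemma pact_eigen:
  assumes "k *v v = l *s v"
  shows "pact p k v = poly p l *s v"
  using assms by (induction p) (simp_all add: mult_vec_scale vec.scale_left_distrib mult.commute)

lemma pact_mem:
  assumes "vec.subspace W" "\<And>w. w \<in> W \<Longrightarrow> k *v w \<in> W" "v \<in> W"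
  shows "pact p k v \<in> W"
  using assms
  by (induction p) (simp_all add: vec.subspace_0 vec.subspace_add vec.subspace_scale)

lemma exists_annihilator:
  fixes k :: "complex ^ 'd ^ 'd"
  obtains p where "p \<noteq> 0" "\<And>v. pact p k v = 0"
proof -
  define M where "M = rec_nat (mat 1) (\<lambda>_ A. k ** A)"
  have M: "M 0 = mat 1" "M (Suc i) = k ** M i" for i by (simp_all add: M_def)
  have mono: "pact (monom c i) k v = c *s (M i *v v)" for c i v
  proof (induction i)
    case 0
    then show ?case by (simp add: M monom_0)
  next
    case (Suc i)
    then show ?case
      by (simp add: M monom_Suc mult_vec_scale matrix_vector_mul_assoc)
  qed
  have sum: "pact (\<Sum>i\<in>I. F i) k v = (\<Sum>i\<in>I. pact (F i) k v)" if "finite I" for I :: "nat set" and F v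
    using that by (induction I) (simp_all add: pact_add)
  \<comment> \<open>\<open>DIM\<close> is the dimension over the reals, so the dependence among the
    powers of \<open>k\<close> has real coefficients, which are then read as complex ones.
    Coinciding powers are treated apart: they would make the set of powers too small, but yield a
    binomial at once.\<close>
  let ?n = "DIM(complex ^ 'd ^ 'd)"
  show ?thesis
  proof (cases "inj_on M {..?n}")
    case False
    then obtain i j where ij: "i \<noteq> j" "M i = M j" by (auto simp: inj_on_def)
    have "monom 1 i + monom (-1) j \<noteq> (0 :: complex poly)"
      using ij(1) by (auto simp: poly_eq_iff intro!: exI[of _ i])
    moreover have "pact (monom 1 i + monom (-1) j) k v = 0" for v
      by (simp add: pact_add mono ij(2))
    ultimately show ?thesis using that by blast
  next
    case True
    then have "card (M ` {..?n}) = Suc ?n" by (simp add: card_image)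
    then have "dependent (M ` {..?n})" by (intro dependent_biggerset) auto
    then obtain u where u: "\<exists>A\<in>M ` {..?n}. u A \<noteq> 0" "(\<Sum>A\<in>M ` {..?n}. u A *\<^sub>R A) = 0"
      by (auto simp: dependent_finite)
    define p where "p = (\<Sum>i\<le>?n. monom (complex_of_real (u (M i))) i)"
    have "coeff p j = complex_of_real (u (M j))" if "j \<le> ?n" for j
      using that by (simp add: p_def coeff_sum)
    then have "p \<noteq> 0" using u(1) by fastforce
    moreover have "pact p k v = 0" for v
    proof -
      have sR: "complex_of_real r *s (A *v v) = (r *\<^sub>R A) *v v" for r and A :: "complex ^ 'd ^ 'd"
        by (simp add: vec_eq_iff matrix_vector_mult_def sum_distrib_left
            scaleR_conv_of_real[where 'a = complex] mult.assoc)
      have msum: "(\<Sum>i\<le>N. F i) *v v = (\<Sum>i\<le>N. F i *v v)" for N :: nat and F :: "nat \<Rightarrow> complex ^ 'd ^ 'd"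
        by (induction N) (simp_all add: matrix_vector_mult_add_rdistrib)
      have "pact p k v = (\<Sum>i\<le>?n. (u (M i) *\<^sub>R M i) *v v)"
        by (simp add: p_def sum mono sR)
      also have "\<dots> = (\<Sum>i\<le>?n. u (M i) *\<^sub>R M i) *v v"
        by (rule msum[symmetric])
      also have "(\<Sum>i\<le>?n. u (M i) *\<^sub>R M i) = 0"
        using u(2) True by (simp add: sum.reindex)
      finally show ?thesis by simp
    qed
    ultimately show ?thesis using that by blast
  qed
qed

lemma exists_eigenvector:
  fixes k :: "complex ^ 'd ^ 'd"
  assumes W: "vec.subspace W" "\<And>w. w \<in> W \<Longrightarrow> k *v w \<in> W" and v: "v \<in> W" "v \<noteq> 0"
  obtains l w where "w \<in> W" "w \<noteq> 0" "k *v w = l *s w"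
proof -
  obtain p where p: "p \<noteq> 0" "pact p k v = 0" using exists_annihilator[of k] by metis
  have "\<exists>l w. w \<in> W \<and> w \<noteq> 0 \<and> k *v w = l *s w"
    using p
  proof (induction "degree p" arbitrary: p rule: less_induct)
    case less
    show ?case
    proof (cases "degree p = 0")
      case True
      then obtain c where "p = [:c:]" by (meson degree_eq_zeroE)
      then show ?thesis using less.prems v by simp
    next
      case False
      then obtain z where "poly p z = 0"
        using fundamental_theorem_of_algebra[of p] by (auto simp: constant_degree)
      then obtain r where r: "p = [:- z, 1:] * r" by (auto simp: poly_eq_0_iff_dvd dvd_def)
      then have r0: "r \<noteq> 0" using less.prems by auto
      then have deg: "degree r < degree p" unfolding r by (subst degree_mult_eq) auto
      have ev: "k *v pact r k v = z *s pact r k v"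
        using less.prems(2) unfolding r pact_mult by (simp add: vec_eq_iff)
      show ?thesis
      proof (cases "pact r k v = 0")
        case True
        then show ?thesis using less.hyps[OF deg r0] by blast
      next
        case False
        then show ?thesis using ev pact_mem[OF W v(1)] by blast
      qed
    qed
  qed
  then show ?thesis using that by blast
qed

lemma finite_eigenvalues:
  fixes k :: "complex ^ 'd ^ 'd"
  shows "finite {l. \<exists>v. v \<noteq> 0 \<and> k *v v = l *s v}"
proof -
  obtain p where p: "p \<noteq> 0" "\<And>v. pact p k v = 0" using exists_annihilator[of k] by metis
  have "{l. \<exists>v. v \<noteq> 0 \<and> k *v v = l *s v} \<subseteq> {l. poly p l = 0}"
    using p(2) pact_eigen[of k _ _ p] by (force simp: vec.scale_eq_0_iff)
  then show ?thesis using poly_roots_finite[OF p(1)] finite_subset by blast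
qed

text \<open>The sum of the generalised eigenspaces with eigenvalue in \<open>L\<close>. Described by
  annihilating polynomials, it is closed under addition because polynomials can be multiplied, and
  \<open>L\<close> may be infinite.\<close>

definition gen_eigen :: "complex ^ 'd ^ 'd \<Rightarrow> complex set \<Rightarrow> (complex ^ 'd) set" where
  "gen_eigen k L = {v. \<exists>p. p \<noteq> 0 \<and> {l. poly p l = 0} \<subseteq> L \<and> pact p k v = 0}"

lemma subspace_gen_eigen: "vec.subspace (gen_eigen k L)"
proof (rule vec.subspaceI)
  show "0 \<in> gen_eigen k L" by (auto simp: gen_eigen_def intro!: exI[of _ 1])
next
  fix x y assume "x \<in> gen_eigen k L" "y \<in> gen_eigen k L"
  then obtain p r where pr: "p \<noteq> 0" "{l. poly p l = 0} \<subseteq> L" "pact p k x = 0"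
    "r \<noteq> 0" "{l. poly r l = 0} \<subseteq> L" "pact r k y = 0" by (auto simp: gen_eigen_def)
  have "pact (p * r) k (x + y) = pact (r * p) k x + pact (p * r) k y"
    by (simp add: pact_lin mult.commute)
  also have "\<dots> = 0" using pr by (simp add: pact_mult)
  finally show "x + y \<in> gen_eigen k L" using pr by (auto simp: gen_eigen_def intro!: exI[of _ "p * r"])
next
  fix c x assume "x \<in> gen_eigen k L"
  then show "c *s x \<in> gen_eigen k L" by (auto simp: gen_eigen_def pact_lin)
qed

lemma eigen_in_gen_eigen: "k *v v = l *s v \<Longrightarrow> l \<in> L \<Longrightarrow> v \<in> gen_eigen k L"
  using pact_eigen[of k v l "[:- l, 1:]"]
  by (auto simp: gen_eigen_def intro!: exI[of _ "[:- l, 1:]"])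

lemma eigen_gen_eigen_disjoint:
  assumes "k *v v = l *s v" "l \<notin> L" "v \<in> gen_eigen k L"
  shows "v = 0"
proof -
  obtain p where "p \<noteq> 0" "{l. poly p l = 0} \<subseteq> L" "pact p k v = 0"
    using assms(3) by (auto simp: gen_eigen_def)
  then show ?thesis using pact_eigen[OF assms(1), of p] assms(2) by (auto simp: vec.scale_eq_0_iff)
qed

text \<open>In finite dimension an injective map of \<open>W\<close> into itself is onto. Thus
  invariance under the \<open>s\<close> operators already gives invariance under the adjoined
  inverses.\<close>

lemma invertible_preserves_subspace:
  fixes k l :: "complex ^ 'd ^ 'd"
  assumes W: "vec.subspace W" "\<And>w. w \<in> W \<Longrightarrow> k *v w \<in> W" and inv: "l ** k = mat 1" and w: "w \<in> W"
  shows "l *v w \<in> W"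
proof -
  have lin: "Vector_Spaces.linear (*s) (*s) ((*v) k)" by (rule matrix_vector_mul_linear_gen)
  have lk: "l *v (k *v v) = v" for v using inv by (simp add: matrix_vector_mul_assoc)
  have inj: "inj_on ((*v) k) (vec.span W)" by (rule inj_on_inverseI[of _ "(*v) l"]) (rule lk)
  have "vec.dim ((*v) k ` W) = vec.dim W" using vec.dim_image_eq[OF lin inj] .
  then have "(*v) k ` W = W"
    by (intro vec.subspace_dim_equal) (use W vec.subspace_image in auto)
  then obtain v where "v \<in> W" "w = k *v v" using w by auto
  then show ?thesis using lk by simp
qed

section \<open>Operators satisfying the reflection equation\<close>

abbreviation cst :: "complex \<Rightarrow> complex fps fps" where "cst c \<equiv> fps_const (fps_const c)"
abbreviation XU :: "complex fps fps" where "XU \<equiv> fps_const fps_X"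
abbreviation XV :: "complex fps fps" where "XV \<equiv> fps_X"

text \<open>\<open>h r p\<close> is the coefficient of \<open>XU ^ r * XV ^ p\<close>: the outer
  variable stands for 1/v, the inner one for 1/u.\<close>

definition ser2 :: "(nat \<Rightarrow> nat \<Rightarrow> complex) \<Rightarrow> complex fps fps" where
  "ser2 h = Abs_fps (\<lambda>p. Abs_fps (\<lambda>r. h r p))"

lemma ser2_nth [simp]: "ser2 h $ p $ r = h r p"
  by (simp add: ser2_def)

lemma ser2_eq_iff: "ser2 h = ser2 h' \<longleftrightarrow> (\<forall>r p. h r p = h' r p)"
  by (auto simp: fps_eq_iff)

lemma ser2_eq_0_iff: "ser2 h = 0 \<longleftrightarrow> (\<forall>r p. h r p = 0)"
  by (auto simp: fps_eq_iff)

lemma generic_params_fps: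
  assumes "q \<noteq> 0"
  shows "generic_params (cst q) (cst (inverse q)) XU XV"
proof unfold_locales
  show "cst q * cst (inverse q) = 1" using assms by simp
  have nth: "F \<noteq> G" if "F $ i $ j \<noteq> G $ i $ j" for F G :: "complex fps fps" and i j using that by auto
  show "XU \<noteq> XV" by (rule nth[of _ 0 1]) simp
  show "XU * XV \<noteq> 1" by (rule nth[of _ 0 0]) simp
  show "cst (inverse q) * XV \<noteq> cst q * XU" by (rule nth[of _ 0 1]) (use assms in simp)
  show "cst (inverse q) * XU \<noteq> cst q * XV" by (rule nth[of _ 0 1]) (use assms in simp)
  show "cst (inverse q) * (XU * XV) \<noteq> cst q" by (rule nth[of _ 0 0]) (use assms in simp)
  show "cst q * (XU * XV) \<noteq> cst (inverse q)" by (rule nth[of _ 0 0]) (use assms in simp)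
  have "((XU - XV)\<^sup>2) $ 0 $ 2 = 1" by (simp add: power2_eq_square)
  moreover have "(2 * (cst (inverse q) - cst q)\<^sup>2 * (XU * XV)) $ 0 $ 2 = 0" by simp
  ultimately show "(XU - XV)\<^sup>2 \<noteq> 2 * (cst (inverse q) - cst q)\<^sup>2 * (XU * XV)"
    by (metis zero_neq_one)
qed

text \<open>Substitution of 0 for 1/u, which replaces the series in u by its zeroth
  coefficient.\<close>

definition ev0 :: "complex fps fps \<Rightarrow> complex fps" where "ev0 F = Abs_fps (\<lambda>p. F $ p $ 0)"

lemma ev0_simps [simp]:
  "ev0 (F + G) = ev0 F + ev0 G" "ev0 (F - G) = ev0 F - ev0 G" "ev0 (F * G) = ev0 F * ev0 G"
  "ev0 XU = 0" "ev0 XV = fps_X" "ev0 (cst c) = fps_const c" "ev0 1 = 1" "ev0 0 = 0"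
  by (auto simp: ev0_def fps_eq_iff fps_mult_nth fps_sum_nth fps_X_def)

lemma ev0_ser2: "ev0 (ser2 h) = Abs_fps (h 0)"
  by (simp add: ev0_def)

lemma refl_eq_ev0:
  assumes "refl_eq (cst q) (cst p) XU XV f g i j a b"
  shows "refl_eq (fps_const q) (fps_const p) 0 fps_X (\<lambda>i a j b. ev0 (f i a j b)) (\<lambda>i a j b. ev0 (g i a j b)) i j a b"
proof -
  have "ev0 (Rd (cst q) (cst p) XU XV i j) = Rd (fps_const q) (fps_const p) 0 fps_X i j"
    "ev0 (Ro (cst q) (cst p) XU XV i j) = Ro (fps_const q) (fps_const p) 0 fps_X i j"
    "ev0 (Td (cst q) (cst p) XU XV i j) = Td (fps_const q) (fps_const p) 0 fps_X i j"
    "ev0 (To (cst q) (cst p) XU XV i j) = To (fps_const q) (fps_const p) 0 fps_X i j" for i j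
    by (simp_all only: Rd_def Ro_def Td_def To_def if_distrib[of ev0] ev0_simps)
  then show ?thesis
    using assms[unfolded refl_eq_def, THEN arg_cong[of _ _ ev0]] by (simp only: refl_eq_def ev0_simps)
qed

text \<open>The part of a representation that the descent uses. \<open>low\<close> reflects the
  triangularity of the zeroth coefficients of T and of its barred version, \<open>inv\<close> the
  inverses adjoined to the algebra.\<close>

locale refl_ops =
  fixes q :: complex and n :: nat and s :: "nat \<Rightarrow> nat \<Rightarrow> nat \<Rightarrow> complex ^ 'd ^ 'd"
  assumes q0: "q \<noteq> 0" and not_root: "\<And>k::nat. k > 0 \<Longrightarrow> q ^ k \<noteq> 1"
    and refl_uv: "\<And>\<psi> w i j a b. Vector_Spaces.linear (*s) (*) \<psi> \<Longrightarrow> {i, j, a, b} \<subseteq> {1..2*n} \<Longrightarrow>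
      refl_eq (cst q) (cst (inverse q)) XU XV
        (\<lambda>i a j b. ser2 (\<lambda>r p. \<psi> (s i a r *v (s j b p *v w))))
        (\<lambda>i a j b. ser2 (\<lambda>r p. \<psi> (s i a p *v (s j b r *v w)))) i j a b"
    and refl_vu: "\<And>\<psi> w i j a b. Vector_Spaces.linear (*s) (*) \<psi> \<Longrightarrow> {i, j, a, b} \<subseteq> {1..2*n} \<Longrightarrow>
      refl_eq (cst q) (cst (inverse q)) XV XU
        (\<lambda>i a j b. ser2 (\<lambda>r p. \<psi> (s i a p *v (s j b r *v w))))
        (\<lambda>i a j b. ser2 (\<lambda>r p. \<psi> (s i a r *v (s j b p *v w)))) i j a b"
    and low: "\<And>j m. 1 \<le> m \<Longrightarrow> m \<le> n \<Longrightarrow> 1 \<le> j \<Longrightarrow> j < 2*m - 1 \<Longrightarrow> s j (2*m) 0 = 0"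
    and inv: "\<And>m. 1 \<le> m \<Longrightarrow> m \<le> n \<Longrightarrow> \<exists>l. l ** s (2*m - 1) (2*m) 0 = mat 1"
begin

definition inv_level :: "nat \<Rightarrow> (complex ^ 'd) set \<Rightarrow> bool" where
  "inv_level m W \<longleftrightarrow> (\<forall>i\<in>{1..2*m}. \<forall>j\<in>{1..2*m}. \<forall>r. \<forall>w\<in>W. s i j r *v w \<in> W)"

definition irr_level :: "nat \<Rightarrow> (complex ^ 'd) set \<Rightarrow> bool" where
  "irr_level m U \<longleftrightarrow> vec.subspace U \<and> U \<noteq> {0} \<and> inv_level m U \<and>
     (\<forall>W. vec.subspace W \<and> W \<subseteq> U \<and> inv_level m W \<longrightarrow> W = {0} \<or> W = U)"

lemma q_pow_inj: "q ^ a = q ^ b \<Longrightarrow> a = b"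
proof (induction a b rule: linorder_wlog)
  case (le a b)
  then have "q ^ (b - a) = 1" using q0 by (simp add: power_diff)
  then show ?case using not_root[of "b - a"] le by fastforce
qed auto

end

section \<open>One level: grading by \<open>K\<close> and filtration by words\<close>

locale refl_level = refl_ops q n s for q n and s :: "nat \<Rightarrow> nat \<Rightarrow> nat \<Rightarrow> complex ^ 'd ^ 'd" +
  fixes m P :: nat
  assumes m: "1 \<le> m" "m \<le> n" and P: "P = 2 * m - 1"
begin

abbreviation K :: "complex ^ 'd ^ 'd" where "K \<equiv> s P (Suc P) 0"

lemma Suc_P: "Suc P = 2 * m" and P1: "1 \<le> P" using m P by auto

lemma ix: "A \<subseteq> {1..Suc P} \<Longrightarrow> A \<subseteq> {1..2*n}" using Suc_P m by fastforce

lemma ne: "q ^ k \<noteq> 0" using q0 by simp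

lemma K_inj: "K *v v = 0 \<Longrightarrow> v = 0"
proof -
  assume v: "K *v v = 0"
  obtain l where "l ** K = mat 1" using inv[OF m] Suc_P P by auto
  then have "v = l *v (K *v v)" by (simp add: matrix_vector_mul_assoc)
  then show ?thesis using v by simp
qed

text \<open>At 1/u = 0 the off-diagonal entries in the instance with first index \<open>P\<close>
  and third index \<open>Suc P\<close> either vanish or multiply a word containing the zeroth
  \<open>s k (Suc P)\<close> with \<open>k < P\<close>, which is zero by \<open>low\<close>. One
  word remains on each side, and the diagonal entries give the power of \<open>q\<close>.\<close>

lemma K_commute:
  assumes jb: "{j, b} \<subseteq> {1..Suc P}"
  shows "K *v (s j b r *v w) = (q powi (gr P j + gr P b)) *s (s j b r *v (K *v w))"
proof -
  let ?M = "Suc P"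
  let ?u = "K *v (s j b r *v w)" and ?v = "s j b r *v (K *v w)"
  let ?c = "q powi (gr P j + gr P b)"
  have "?u - ?c *s ?v \<in> {0}"
  proof (rule mem_subspace_if_functionals)
    show "vec.subspace {0 :: complex ^ 'd}" by (simp add: vec.subspace_def)
    fix \<psi> :: "complex ^ 'd \<Rightarrow> complex"
    assume lin: "Vector_Spaces.linear (*s) (*) \<psi>"
    interpret L: Vector_Spaces.linear "(*s)" "(*)" \<psi> by (rule lin)
    define f where "f i a j b = Abs_fps (\<lambda>p. \<psi> (s i a 0 *v (s j b p *v w)))" for i a j b
    define g where "g i a j b = Abs_fps (\<lambda>p. \<psi> (s i a p *v (s j b 0 *v w)))" for i a j b
    have low': "s i ?M 0 = 0" if "1 \<le> i" "i < P" for i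
      using low[OF m that(1)] that Suc_P P by auto
    have "{P, j, ?M, b} \<subseteq> {1..2*n}" by (rule ix) (use jb P1 in auto)
    note E = refl_eq_ev0[OF refl_uv[OF lin this, of w], unfolded ev0_ser2, folded f_def g_def]
    have z1: "f j ?M P b = 0" if "j < P" using that jb low'[of j] by (simp add: f_def L.zero fps_eq_iff)
    have z2: "g j P b ?M = 0" if "b < P" using that jb low'[of b] by (simp add: g_def L.zero fps_eq_iff)
    have "fps_X * (fps_const (if P = j then inverse q else 1) * fps_const (if ?M = j then q else 1) * f P ?M j b)
        = fps_X * (fps_const (if ?M = b then inverse q else 1) * fps_const (if P = b then q else 1) * g j b P ?M)"
      using E jb z1 z2
      by (auto simp: refl_eq_def Rd_def Ro_def Td_def To_def mult.assoc mult.left_commute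
          simp del: fps_const_mult fps_const_mult_apply_left fps_const_neg)
    then have "fps_const (if P = j then inverse q else 1) * fps_const (if ?M = j then q else 1) * f P ?M j b
        = fps_const (if ?M = b then inverse q else 1) * fps_const (if P = b then q else 1) * g j b P ?M"
      by simp
    then have "(if P = j then inverse q else 1) * (if ?M = j then q else 1) * \<psi> ?u
        = (if ?M = b then inverse q else 1) * (if P = b then q else 1) * \<psi> ?v"
      by (auto simp: fps_eq_iff f_def g_def split: if_splits dest!: spec[of _ r])
    then have "\<psi> ?u = ?c * \<psi> ?v"
      using q0 by (auto simp: gr_def power_int_minus field_simps power2_eq_square split: if_splits)
    then show "\<psi> (?u - ?c *s ?v) = 0" by (simp add: L.diff L.scale)
  qed
  then show ?thesis by simp
qed

inductive word :: "complex ^ 'd \<Rightarrow> nat \<Rightarrow> complex ^ 'd \<Rightarrow> bool" for v where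
  base: "word v 0 v"
| step: "word v g x \<Longrightarrow> {i, a} \<subseteq> {1..Suc P} \<Longrightarrow> gr P i + gr P a \<le> 0 \<Longrightarrow>
    word v (g + nat (- (gr P i + gr P a))) (s i a r *v x)"

text \<open>The index is an integer so that a positive letter can lower it freely; for negative
  \<open>G\<close> this is the zero space, which is exactly what a killed vector requires.\<close>

definition fil :: "complex ^ 'd \<Rightarrow> int \<Rightarrow> (complex ^ 'd) set" where
  "fil v G = vec.span {x. \<exists>g. word v g x \<and> int g \<le> G}"

definition killed :: "complex ^ 'd \<Rightarrow> bool" where
  "killed v \<longleftrightarrow> (\<forall>i a r. {i, a} \<subseteq> {1..Suc P} \<longrightarrow> 0 < gr P i + gr P a \<longrightarrow> s i a r *v v = 0)"

lemma fil_mono: "G \<le> G' \<Longrightarrow> fil v G \<subseteq> fil v G'"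
  unfolding fil_def by (rule vec.span_mono) auto

lemma fil_map:
  assumes "x \<in> fil v G" and "\<And>g y. word v g y \<Longrightarrow> int g \<le> G \<Longrightarrow> s i a r *v y \<in> fil v (int g - d)"
  shows "s i a r *v x \<in> fil v (G - d)"
  using assms(1) unfolding fil_def[of v G]
proof (induction rule: vec.span_induct_alt)
  case base
  then show ?case by (simp add: fil_def vec.span_zero)
next
  case (step c x y)
  then obtain g where g: "word v g x" "int g \<le> G" by auto
  then have "s i a r *v x \<in> fil v (G - d)" using assms(2)[OF g] fil_mono[of "int g - d" "G - d" v] by auto
  then show ?case using step
    by (simp add: matrix_vector_right_distrib mult_vec_scale fil_def vec.span_add vec.span_scale)
qed

lemma fil_nonpos:
  assumes x: "x \<in> fil v G" and ia: "{i, a} \<subseteq> {1..Suc P}" "gr P i + gr P a \<le> 0"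
  shows "s i a r *v x \<in> fil v (G - (gr P i + gr P a))"
proof (rule fil_map[OF x])
  fix g y assume "word v g y" "int g \<le> G"
  then have "word v (g + nat (- (gr P i + gr P a))) (s i a r *v y)" using ia by (intro word.step)
  then show "s i a r *v y \<in> fil v (int g - (gr P i + gr P a))"
    unfolding fil_def using ia(2) by (intro vec.span_base) (auto intro!: exI)
qed

text \<open>Two nested inductions: a letter of grade 0 lengthens a word without changing its depth
  \<open>g\<close>. The outer one runs over the depth, the inner one over the construction of the
  word, and the straightening in \<open>graded_words\<close> moves the positive letter past the
  leftmost one.\<close>

lemma word_pos:
  assumes v: "killed v"
  shows "word v g x \<Longrightarrow> {i, a} \<subseteq> {1..Suc P} \<Longrightarrow> 0 < gr P i + gr P a \<Longrightarrow>
    s i a r *v x \<in> fil v (int g - (gr P i + gr P a))"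
proof (induction g arbitrary: x i a r rule: less_induct)
  case (less N)
  note outer = less.IH
  have outer': "s i a r *v y \<in> fil v (G - (gr P i + gr P a))"
    if "y \<in> fil v G" "G < int N" "{i, a} \<subseteq> {1..Suc P}" "0 < gr P i + gr P a" for i a r y G
    by (rule fil_map[OF that(1)]) (use that outer in auto)
  have "g \<le> N \<longrightarrow> (\<forall>i a r. {i, a} \<subseteq> {1..Suc P} \<longrightarrow> 0 < gr P i + gr P a \<longrightarrow>
      s i a r *v x \<in> fil v (int g - (gr P i + gr P a)))" if "word v g x" for g x
    using that
  proof (induction rule: word.induct)
    case base
    then show ?case using v by (auto simp: killed_def fil_def vec.span_zero)
  next
    case (step g x j b p)
    let ?g' = "g + nat (- (gr P j + gr P b))"
    show ?case
    proof (intro impI allI)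
      fix i a r
      assume gN: "?g' \<le> N" and ia: "{i, a} \<subseteq> {1..Suc P}" and pos: "0 < gr P i + gr P a"
      have inner: "s i a r *v x \<in> fil v (int g - (gr P i + gr P a))"
        if "{i, a} \<subseteq> {1..Suc P}" "0 < gr P i + gr P a" for i a r
        using step.IH gN that by auto
      have xg: "x \<in> fil v (int g)" using step.hyps unfolding fil_def by (intro vec.span_base) auto
      define t where "t = gr P i + gr P a + gr P j + gr P b"
      have known: "s i a r *v (s j b p *v x) \<in> fil v (int g - t)"
        if ix: "{i, j, a, b} \<subseteq> {1..Suc P}" and t: "gr P i + gr P a + gr P j + gr P b = t"
          and c: "0 < gr P j + gr P b \<or> gr P i + gr P a \<le> 0" for i a j b r p
      proof -
        have t': "int g - t = int g - (gr P j + gr P b) - (gr P i + gr P a)" using t by simp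
        have second: "s j b p *v x \<in> fil v (int g - (gr P j + gr P b))"
        proof (cases "0 < gr P j + gr P b")
          case True
          then show ?thesis using inner[of j b] ix by auto
        next
          case False
          then show ?thesis using fil_nonpos[OF xg, of j b] ix by auto
        qed
        show ?thesis
        proof (cases "gr P i + gr P a \<le> 0")
          case True
          then show ?thesis unfolding t' using fil_nonpos[OF second, of i a] ix by auto
        next
          case False
          \<comment> \<open>Now both letters are positive. The right one has strictly lowered the
            depth, so the outer hypothesis applies to the left one.\<close>
          then have "int g - (gr P j + gr P b) < int N" using c gN by auto
          then show ?thesis unfolding t' using outer'[OF second, of i a] ix False by auto
        qed
      qed
      have "s i a r *v (s j b p *v x) \<in> fil v (int g - t)"
      proof (rule mem_subspace_if_functionals)
        show "vec.subspace (fil v (int g - t))" by (simp add: fil_def)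
        fix \<psi> :: "complex ^ 'd \<Rightarrow> complex"
        assume lin: "Vector_Spaces.linear (*s) (*) \<psi>" and psi: "\<And>w. w \<in> fil v (int g - t) \<Longrightarrow> \<psi> w = 0"
        interpret graded_words "cst q" "cst (inverse q)" XU XV
          "\<lambda>i a j b. ser2 (\<lambda>r p. \<psi> (s i a r *v (s j b p *v x)))"
          "\<lambda>i a j b. ser2 (\<lambda>r p. \<psi> (s i a p *v (s j b r *v x)))" P t
        proof (intro graded_words.intro graded_words_axioms.intro generic_params_fps q0 P1)
          fix i j a b assume "{i, j, a, b} \<subseteq> {1..Suc P}"
          note ix = ix[OF this]
          show "refl_eq (cst q) (cst (inverse q)) XU XV (\<lambda>i a j b. ser2 (\<lambda>r p. \<psi> (s i a r *v (s j b p *v x))))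
            (\<lambda>i a j b. ser2 (\<lambda>r p. \<psi> (s i a p *v (s j b r *v x)))) i j a b"
            by (rule refl_uv[OF lin ix])
          show "refl_eq (cst q) (cst (inverse q)) XV XU (\<lambda>i a j b. ser2 (\<lambda>r p. \<psi> (s i a p *v (s j b r *v x))))
            (\<lambda>i a j b. ser2 (\<lambda>r p. \<psi> (s i a r *v (s j b p *v x)))) i j a b"
            by (rule refl_vu[OF lin ix])
        next
          fix i a j b
          assume *: "{i, j, a, b} \<subseteq> {1..Suc P}" "gr P i + gr P a + gr P j + gr P b = t"
            "0 < gr P j + gr P b \<or> gr P i + gr P a \<le> 0"
          show "ser2 (\<lambda>r p. \<psi> (s i a r *v (s j b p *v x))) = 0" "ser2 (\<lambda>r p. \<psi> (s i a p *v (s j b r *v x))) = 0"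
            using known[OF *] psi by (simp_all add: ser2_eq_0_iff)
        qed
        have "ser2 (\<lambda>r p. \<psi> (s i a r *v (s j b p *v x))) = 0"
          by (rule all_words_vanish) (use ia step.hyps in \<open>auto simp: t_def\<close>)
        then show "\<psi> (s i a r *v (s j b p *v x)) = 0" by (simp add: ser2_eq_0_iff)
      qed
      moreover have "int g - t = int ?g' - (gr P i + gr P a)" using step.hyps by (simp add: t_def)
      ultimately show "s i a r *v (s j b p *v x) \<in> fil v (int ?g' - (gr P i + gr P a))" by simp
    qed
  qed
  then show ?case using less.prems by blast
qed

end

context refl_level
begin

lemma inv_levelD: "inv_level m W \<Longrightarrow> {i, a} \<subseteq> {1..Suc P} \<Longrightarrow> w \<in> W \<Longrightarrow> s i a r *v w \<in> W"
  unfolding inv_level_def Suc_P by auto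

lemma word_mem:
  assumes "word v g x" "inv_level m U" "v \<in> U"
  shows "x \<in> U"
  using assms by (induction rule: word.induct) (auto intro!: inv_levelD)

lemma word_eigen:
  assumes "word v g x" and v: "K *v v = l *s v"
  shows "K *v x = (l / q ^ g) *s x"
  using assms(1)
proof (induction rule: word.induct)
  case base
  then show ?case using v by simp
next
  case (step g x i a r)
  let ?d = "nat (- (gr P i + gr P a))"
  have "gr P i + gr P a = - int ?d" using step.hyps by simp
  then have "q powi (gr P i + gr P a) = inverse (q ^ ?d)"
    by (metis power_int_minus power_int_of_nat)
  then show ?case using step K_commute[of i a r x]
    by (simp add: mult_vec_scale power_add field_simps)
qed

lemma words_span:
  assumes U: "irr_level m U" and v: "v \<in> U" "v \<noteq> 0" "killed v"
  shows "vec.span {x. \<exists>g. word v g x} = U"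
proof -
  let ?W = "vec.span {x. \<exists>g. word v g x}"
  have sU: "vec.subspace U" and iU: "inv_level m U" using U by (auto simp: irr_level_def)
  have "?W \<subseteq> U"
    by (rule vec.span_minimal) (use word_mem iU v(1) sU in auto)
  moreover have fW: "fil v G \<subseteq> ?W" for G
    unfolding fil_def by (rule vec.span_mono) auto
  have "inv_level m ?W"
    unfolding inv_level_def
  proof (intro ballI allI)
    fix i a r w assume ia: "i \<in> {1..2*m}" "a \<in> {1..2*m}" and "w \<in> ?W"
    from this(3) show "s i a r *v w \<in> ?W"
    proof (induction rule: vec.span_induct_alt)
      case base
      then show ?case by (simp add: vec.span_zero)
    next
      case (step c x y)
      then obtain g where g: "word v g x" by auto
      have ia': "{i, a} \<subseteq> {1..Suc P}" using ia Suc_P by auto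
      have "s i a r *v x \<in> ?W"
      proof (cases "0 < gr P i + gr P a")
        case True
        then show ?thesis using word_pos[OF v(3) g ia', of r] fW by blast
      next
        case False
        then have "word v (g + nat (- (gr P i + gr P a))) (s i a r *v x)"
          using g ia' by (intro word.step) auto
        then show ?thesis by (intro vec.span_base) auto
      qed
      then show ?case using step
        by (simp add: matrix_vector_right_distrib mult_vec_scale vec.span_add vec.span_scale)
    qed
  qed
  moreover have "v \<in> ?W" by (intro vec.span_base) (auto intro: word.base)
  then have "?W \<noteq> {0}" using v(2) by auto
  moreover have "vec.subspace ?W" by (rule vec.subspace_span)
  moreover have "\<forall>W. vec.subspace W \<and> W \<subseteq> U \<and> inv_level m W \<longrightarrow> W = {0} \<or> W = U"
    using U by (simp add: irr_level_def)
  ultimately show ?thesis by blast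
qed

text \<open>The words based on \<open>v\<close> span \<open>U\<close>, and each is an eigenvector of
  \<open>K\<close> with eigenvalue \<open>l / q ^ g\<close>. Hence every vector of \<open>U\<close>
  is annihilated by a polynomial in \<open>K\<close> whose roots have this form, and no other
  eigenvalue can occur.\<close>

lemma eigen_below:
  assumes U: "irr_level m U" and v: "v \<in> U" "v \<noteq> 0" "killed v" "K *v v = l *s v"
    and u: "u \<in> U" "u \<noteq> 0" "K *v u = l' *s u"
  shows "\<exists>g. l' = l / q ^ g"
proof (rule ccontr)
  assume no: "\<not> ?thesis"
  have "U \<subseteq> gen_eigen K (range (\<lambda>g. l / q ^ g))"
    unfolding words_span[OF U v(1-3), symmetric]
  proof (rule vec.span_minimal[OF _ subspace_gen_eigen], safe)
    fix x g assume "word v g x"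
    then show "x \<in> gen_eigen K (range (\<lambda>g. l / q ^ g))"
      by (intro eigen_in_gen_eigen[OF word_eigen[OF _ v(4)]]) auto
  qed
  then show False using eigen_gen_eigen_disjoint[OF u(3), of "range (\<lambda>g. l / q ^ g)"] u no by auto
qed

lemma eigen_nz:
  assumes "K *v v = l *s v" "v \<noteq> 0"
  shows "l \<noteq> 0"
  using assms K_inj[of v] by auto

text \<open>Since \<open>q\<close> is not a root of unity, words of positive depth belong to
  eigenvalues different from \<open>l\<close>; an eigenvector for \<open>l\<close> therefore has no
  component in their span.\<close>

lemma top_words_span:
  assumes U: "irr_level m U" and v: "v \<in> U" "v \<noteq> 0" "killed v" "K *v v = l *s v"
    and u: "u \<in> U" "K *v u = l *s u"
  shows "u \<in> vec.span {x. word v 0 x}"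
proof -
  let ?L = "{l / q ^ g | g. g > 0}"
  have l0: "l \<noteq> 0" using eigen_nz v by blast
  have lL: "l \<notin> ?L"
  proof
    assume "l \<in> ?L"
    then obtain g where g: "g > 0" "l = l / q ^ g" by blast
    then have "l * q ^ g = l" using nonzero_eq_divide_eq[OF ne[of g], of l l] by blast
    then have "q ^ g = 1" using l0 by simp
    then show False using not_root g(1) by blast
  qed
  have split: "{x. \<exists>g. word v g x} = {x. word v 0 x} \<union> {x. \<exists>g>0. word v g x}"
  proof -
    have "word v 0 x \<or> (\<exists>g>0. word v g x)" if "word v g x" for g x
      using that by (cases "g = 0") auto
    then show ?thesis by blast
  qed
  have "u \<in> vec.span ({x. word v 0 x} \<union> {x. \<exists>g>0. word v g x})"
    using words_span[OF U v(1-3)] u(1) unfolding split by (simp only:)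
  then obtain z e where ze: "u = z + e" "z \<in> vec.span {x. word v 0 x}" "e \<in> vec.span {x. \<exists>g>0. word v g x}"
    unfolding vec.span_Un by blast
  have "vec.span {x. \<exists>g>0. word v g x} \<subseteq> gen_eigen K ?L"
  proof (rule vec.span_minimal[OF _ subspace_gen_eigen], safe)
    fix x g assume g: "word v g x" "0 < g"
    show "x \<in> gen_eigen K ?L"
      by (rule eigen_in_gen_eigen[OF word_eigen[OF g(1) v(4)]]) (use g(2) in blast)
  qed
  then have e: "e \<in> gen_eigen K ?L" using ze by blast
  have "K *v z = l *s z" using ze(2)
  proof (induction rule: vec.span_induct_alt)
    case base
    then show ?case by simp
  next
    case (step c x y)
    then have "word v 0 x" by simp
    from word_eigen[OF this v(4)] have "K *v x = l *s x" by simp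
    then show ?case using step
      by (simp add: matrix_vector_right_distrib mult_vec_scale vec.scale_right_distrib mult.commute)
  qed
  then have "K *v e = l *s e"
    using u(2) unfolding ze(1) matrix_vector_right_distrib vec.scale_right_distrib by simp
  then have "e = 0" using lL e by (rule eigen_gen_eigen_disjoint)
  then show ?thesis using ze by simp
qed

text \<open>Top is meant along a chain \<open>l0 * q ^ g\<close>, which meets the finite spectrum
  only finitely often as the powers of \<open>q\<close> are distinct. The exponents 1 and 2 are all
  the positive grades there are.\<close>

lemma exists_top_eigenvalue:
  assumes U: "irr_level m U"
  obtains l v where "v \<in> U" "v \<noteq> 0" "K *v v = l *s v"
    "\<And>u d. u \<in> U \<Longrightarrow> 0 < d \<Longrightarrow> d \<le> (2::nat) \<Longrightarrow> K *v u = (l * q ^ d) *s u \<Longrightarrow> u = 0"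
proof -
  have sU: "vec.subspace U" and iU: "inv_level m U" and nU: "U \<noteq> {0}" using U by (auto simp: irr_level_def)
  obtain v0 where v0: "v0 \<in> U" "v0 \<noteq> 0" using nU vec.subspace_0[OF sU] by blast
  have KU: "K *v w \<in> U" if "w \<in> U" for w using inv_levelD[OF iU, of P "Suc P" w] that P1 by auto
  obtain l0 v1 where l0: "v1 \<in> U" "v1 \<noteq> 0" "K *v v1 = l0 *s v1"
    using exists_eigenvector[OF sU KU v0] by metis
  define N where "N = {g. \<exists>u\<in>U. u \<noteq> 0 \<and> K *v u = (l0 * q ^ g) *s u}"
  have "inj_on (\<lambda>g. l0 * q ^ g) N"
    using eigen_nz[OF l0(3,2)] q_pow_inj by (auto simp: inj_on_def)
  moreover have "(\<lambda>g. l0 * q ^ g) ` N \<subseteq> {l. \<exists>v. v \<noteq> 0 \<and> K *v v = l *s v}"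
    by (auto simp: N_def)
  ultimately have fin: "finite N"
    using finite_eigenvalues[of K] by (meson finite_imageD finite_subset)
  have "0 \<in> N" using l0 by (auto simp: N_def)
  then have MN: "Max N \<in> N" using fin Max_in[of N] by blast
  then obtain v where v: "v \<in> U" "v \<noteq> 0" "K *v v = (l0 * q ^ Max N) *s v" by (auto simp: N_def)
  show ?thesis
  proof (rule that[OF v])
    fix u d assume u: "u \<in> U" "0 < d" "d \<le> (2::nat)" "K *v u = (l0 * q ^ Max N * q ^ d) *s u"
    show "u = 0"
    proof (rule ccontr)
      assume "u \<noteq> 0"
      then have "Max N + d \<in> N" using u by (auto simp: N_def power_add mult.assoc)
      then show False using Max_ge[OF fin] u(2) by fastforce
    qed
  qed
qed

lemma zero_letter_cases:
  assumes "{i, a} \<subseteq> {1..Suc P}" "gr P i + gr P a = 0"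
  shows "(i, a) = (P, Suc P) \<or> (i, a) = (Suc P, P) \<or> {i, a} \<subseteq> {1..<P}"
  using assms by (auto simp: gr_def split: if_splits)

lemma killed_commute:
  assumes u: "killed u"
    and ia: "(i, a) = (P, Suc P) \<or> (i, a) = (Suc P, P)"
    and jb: "{j, b} \<subseteq> {1..Suc P}" "gr P j + gr P b = 0"
  shows "s i a r *v (s j b p *v u) = s j b p *v (s i a r *v u)"
proof -
  have "s i a r *v (s j b p *v u) - s j b p *v (s i a r *v u) \<in> {0}"
  proof (rule mem_subspace_if_functionals)
    show "vec.subspace {0 :: complex ^ 'd}" by (simp add: vec.subspace_def)
    fix \<psi> :: "complex ^ 'd \<Rightarrow> complex"
    assume lin: "Vector_Spaces.linear (*s) (*) \<psi>"
    interpret L: Vector_Spaces.linear "(*s)" "(*)" \<psi> by (rule lin)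
    interpret top_words "cst q" "cst (inverse q)" XU XV
      "\<lambda>i a j b. ser2 (\<lambda>r p. \<psi> (s i a r *v (s j b p *v u)))"
      "\<lambda>i a j b. ser2 (\<lambda>r p. \<psi> (s i a p *v (s j b r *v u)))" P
    proof (intro top_words.intro top_words_axioms.intro generic_params_fps q0 P1)
      fix i j a b assume "{i, j, a, b} \<subseteq> {1..Suc P}"
      note ix = ix[OF this]
      show "refl_eq (cst q) (cst (inverse q)) XU XV (\<lambda>i a j b. ser2 (\<lambda>r p. \<psi> (s i a r *v (s j b p *v u))))
        (\<lambda>i a j b. ser2 (\<lambda>r p. \<psi> (s i a p *v (s j b r *v u)))) i j a b"
        by (rule refl_uv[OF lin ix])
      show "refl_eq (cst q) (cst (inverse q)) XV XU (\<lambda>i a j b. ser2 (\<lambda>r p. \<psi> (s i a p *v (s j b r *v u))))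
        (\<lambda>i a j b. ser2 (\<lambda>r p. \<psi> (s i a r *v (s j b p *v u)))) i j a b"
        by (rule refl_vu[OF lin ix])
    next
      fix i a j b
      assume *: "{i, j, a, b} \<subseteq> {1..Suc P}" "0 < gr P j + gr P b"
      then have "s j b p *v u = 0" for p using u by (auto simp: killed_def)
      then show "ser2 (\<lambda>r p. \<psi> (s i a r *v (s j b p *v u))) = 0" "ser2 (\<lambda>r p. \<psi> (s i a p *v (s j b r *v u))) = 0"
        by (simp_all add: ser2_eq_0_iff L.zero)
    qed
    have "ser2 (\<lambda>r p. \<psi> (s i a r *v (s j b p *v u))) = ser2 (\<lambda>r p. \<psi> (s j b p *v (s i a r *v u)))"
      by (rule zero_letters_commute[OF ia zero_letter_cases[OF jb]])
    then show "\<psi> (s i a r *v (s j b p *v u) - s j b p *v (s i a r *v u)) = 0"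
      by (simp add: ser2_eq_iff L.diff)
  qed
  then show ?thesis by simp
qed

theorem peel:
  assumes U: "irr_level m U"
  obtains U' where "irr_level (m - 1) U'" "U' \<subseteq> U" "\<And>u. u \<in> U' \<Longrightarrow> killed u"
    "\<And>r. \<exists>c. \<forall>u\<in>U'. s P (Suc P) r *v u = c *s u" "\<And>r. \<exists>c. \<forall>u\<in>U'. s (Suc P) P r *v u = c *s u"
    "\<And>v l. v \<in> U \<Longrightarrow> v \<noteq> 0 \<Longrightarrow> killed v \<Longrightarrow> K *v v = l *s v \<Longrightarrow> v \<in> U'"
proof -
  have sU: "vec.subspace U" and iU: "inv_level m U" using U by (auto simp: irr_level_def)
  obtain l v0 where v0: "v0 \<in> U" "v0 \<noteq> 0" "K *v v0 = l *s v0"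
    and top: "\<And>u d. u \<in> U \<Longrightarrow> 0 < d \<Longrightarrow> d \<le> (2::nat) \<Longrightarrow> K *v u = (l * q ^ d) *s u \<Longrightarrow> u = 0"
    using exists_top_eigenvalue[OF U] by metis
  define U' where "U' = {u \<in> U. K *v u = l *s u}"
  have sub: "U' \<subseteq> U" by (auto simp: U'_def)
  have sU': "vec.subspace U'"
    using sU by (auto simp: U'_def vec.subspace_def matrix_vector_right_distrib mult_vec_scale
        vec.scale_right_distrib mult.commute)
  have kl: "killed u" if "u \<in> U'" for u
    unfolding killed_def
  proof (intro allI impI)
    fix i a r assume ia: "{i, a} \<subseteq> {1..Suc P}" "0 < gr P i + gr P a"
    have d: "q powi (gr P i + gr P a) = q ^ nat (gr P i + gr P a)"
      using ia(2) by (simp add: power_int_def)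
    have "gr P i + gr P a \<le> 2" by (simp add: gr_def)
    then show "s i a r *v u = 0"
      using that ia K_commute[OF ia(1), of r u] inv_levelD[OF iU ia(1), of u r]
      by (intro top[of _ "nat (gr P i + gr P a)"])
         (auto simp: U'_def mult_vec_scale d mult.commute)
  qed
  have zU': "s i a r *v u \<in> U'" if "{i, a} \<subseteq> {1..Suc P}" "gr P i + gr P a = 0" "u \<in> U'" for i a r u
    using that K_commute[OF that(1), of r u] inv_levelD[OF iU that(1), of u r]
    by (auto simp: U'_def mult_vec_scale)
  \<comment> \<open>A word of depth 0 uses letters of grade 0 only, so \<open>W\<close> contains all
    those based on any of its nonzero vectors, and they span the eigenspace by
    \<open>top_words_span\<close>.\<close>
  have irr0: "W = U'"
    if W: "vec.subspace W" "W \<subseteq> U'" "W \<noteq> {0}"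
      and z: "\<And>i a r w. {i, a} \<subseteq> {1..Suc P} \<Longrightarrow> gr P i + gr P a = 0 \<Longrightarrow> w \<in> W \<Longrightarrow> s i a r *v w \<in> W" for W
  proof -
    obtain v where v: "v \<in> W" "v \<noteq> 0" using W vec.subspace_0 by blast
    then have vU: "v \<in> U" "killed v" "K *v v = l *s v" using W kl by (auto simp: U'_def)
    have w0: "x \<in> W" if "word v g x" "g = 0" for g x
      using that
    proof (induction rule: word.induct)
      case base
      then show ?case using v by simp
    next
      case (step g x i a r)
      then show ?case by (intro z) auto
    qed
    have "vec.span {x. word v 0 x} \<subseteq> W"
      by (rule vec.span_minimal) (use w0 W in auto)
    then have "U' \<subseteq> W"
      using top_words_span[OF U vU(1) v(2) vU(2,3)] by (auto simp: U'_def)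
    then show ?thesis using W by blast
  qed
  have nz: "U' \<noteq> {0}" using v0 by (auto simp: U'_def)
  have scal: "\<exists>c. \<forall>u\<in>U'. s i a r *v u = c *s u"
    if ia: "(i, a) = (P, Suc P) \<or> (i, a) = (Suc P, P)" for i a r
  proof -
    have ia': "{i, a} \<subseteq> {1..Suc P}" "gr P i + gr P a = 0" using ia P1 by (auto simp: gr_def)
    have v0': "v0 \<in> U'" using v0 by (simp add: U'_def)
    obtain c w where w: "w \<in> U'" "w \<noteq> 0" "s i a r *v w = c *s w"
      by (rule exists_eigenvector[OF sU' zU'[OF ia'] v0' v0(2)])
    define W where "W = {u \<in> U'. s i a r *v u = c *s u}"
    have "W = U'"
    proof (rule irr0)
      show "vec.subspace W" using sU'
        by (auto simp: W_def vec.subspace_def matrix_vector_right_distrib mult_vec_scale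
            vec.scale_right_distrib mult.commute)
      show "W \<subseteq> U'" "W \<noteq> {0}" using w by (auto simp: W_def)
      fix j b p u assume jb: "{j, b} \<subseteq> {1..Suc P}" "gr P j + gr P b = 0" and u: "u \<in> W"
      then show "s j b p *v u \<in> W"
        using zU'[OF jb, of u] killed_commute[OF kl ia jb, of u r p]
        by (auto simp: W_def mult_vec_scale)
    qed
    then show ?thesis by (auto simp: W_def)
  qed
  have "irr_level (m - 1) U'"
    unfolding irr_level_def
  proof (intro conjI allI impI)
    have 2: "2 * (m - 1) = P - 1" using P m by simp
    show "inv_level (m - 1) U'"
      unfolding inv_level_def 2 by (auto intro!: zU' simp: gr_def)
    fix W assume W: "vec.subspace W \<and> W \<subseteq> U' \<and> inv_level (m - 1) W"
    show "W = {0} \<or> W = U'"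
    proof (cases "W = {0}")
      case False
      have "W = U'"
      proof (rule irr0)
        show "vec.subspace W" "W \<subseteq> U'" "W \<noteq> {0}" using W False by auto
        fix i a r w assume ia: "{i, a} \<subseteq> {1..Suc P}" "gr P i + gr P a = 0" and w: "w \<in> W"
        from zero_letter_cases[OF ia] show "s i a r *v w \<in> W"
        proof (elim disjE)
          assume "{i, a} \<subseteq> {1..<P}"
          then show ?thesis using W w unfolding inv_level_def 2 by auto
        qed (use scal[of i a r] W w in \<open>auto simp: vec.subspace_scale subset_iff\<close>)
      qed
      then show ?thesis ..
    qed simp
  qed (use sU' nz in auto)
  \<comment> \<open>Both vectors are killed, so \<open>eigen_below\<close> applies in both
    directions: each eigenvalue is the other divided by a power of \<open>q\<close>, which forces
    both exponents to be 0.\<close>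
  moreover have "v \<in> U'" if v: "v \<in> U" "v \<noteq> 0" "killed v" "K *v v = l' *s v" for v l'
  proof -
    obtain g where g: "l = l' / q ^ g" using eigen_below[OF U v v0] by blast
    have v0': "killed v0" using kl v0 by (auto simp: U'_def)
    obtain g' where g': "l' = l / q ^ g'" using eigen_below[OF U v0(1,2) v0' v0(3) v(1,2,4)] by blast
    have "l' \<noteq> 0" using eigen_nz v by blast
    have "l * q ^ g = l'" using nonzero_eq_divide_eq[OF ne[of g], of l l'] g by blast
    moreover have "l' * q ^ g' = l" using nonzero_eq_divide_eq[OF ne[of g'], of l' l] g' by blast
    ultimately have "l' * q ^ (g' + g) = l'" by (simp only: power_add mult.assoc[symmetric])
    with \<open>l' \<noteq> 0\<close> have "q ^ (g' + g) = 1" by simp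
    then have "g' + g = 0" using not_root by (metis gr0I)
    then show ?thesis using v g by (simp add: U'_def)
  qed
  ultimately show ?thesis
    by (intro that[of U']) (use sub kl scal in auto)
qed

end

section \<open>Descent through the ranks\<close>

context refl_ops
begin

text \<open>In absolute value \<open>vsig\<close> at \<open>2*m - 1\<close> and \<open>2*m\<close>
  exceeds \<open>vsig\<close> at all smaller indices. As soon as one of the two occurs, the sign of
  the sum is that of the grade at level \<open>m\<close>; so the levels together exhaust the
  condition defining highest vectors.\<close>

lemma gr_pos_of_vsig:
  assumes "k \<in> {1..2*m}" "l \<in> {1..2*m}" "1 \<le> m" "\<not> (k \<le> 2 * (m - 1) \<and> l \<le> 2 * (m - 1))" "0 < vsig k + vsig l"
  shows "0 < gr (2*m - 1) k + gr (2*m - 1) l"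
proof -
  have P: "int (2*m - 1) = 2 * int m - 1" using assms(3) by simp
  have cases: "k = 2*m - 1 \<or> k = 2*m \<or> k \<le> 2*(m-1)" "l = 2*m - 1 \<or> l = 2*m \<or> l \<le> 2*(m-1)"
    using assms by auto
  have sm: "\<bar>vsig j\<bar> < 2 * int m - 1" "gr (2*m - 1) j = 0" if "1 \<le> j" "j \<le> 2*(m-1)" for j
    using that assms(3) unfolding vsig_def gr_def by auto
  have top: "vsig (2*m - 1) = 2 * int m - 1" "vsig (2*m) = 1 - 2 * int m"
    "gr (2*m - 1) (2*m - 1) = 1" "gr (2*m - 1) (2*m) = -1"
    using P assms(3) unfolding vsig_def gr_def by auto
  show ?thesis
    using cases
  proof (elim disjE)
    assume "k = 2*m - 1" "l \<le> 2*(m-1)" then show ?thesis using assms(2) sm(2)[of l] top(3) by simp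
  next
    assume "l = 2*m - 1" "k \<le> 2*(m-1)" then show ?thesis using assms(1) sm(2)[of k] top(3) by simp
  next
    assume "k = 2*m - 1" "l = 2*m - 1" then show ?thesis using top(3) by simp
  next
    assume "k = 2*m - 1" "l = 2*m" then show ?thesis using assms(5) top by simp
  next
    assume "l = 2*m - 1" "k = 2*m" then show ?thesis using assms(5) top by simp
  next
    assume "l = 2*m" "k = 2*m" then show ?thesis using assms(3,5) top by simp
  next
    assume "k = 2*m" "l \<le> 2*(m-1)" then show ?thesis using assms(2,5) sm(1)[of l] top by simp
  next
    assume "l = 2*m" "k \<le> 2*(m-1)" then show ?thesis using assms(1,5) sm(1)[of k] top by simp
  next
    assume "l \<le> 2*(m-1)" "k \<le> 2*(m-1)" then show ?thesis using assms(4) by simp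
  qed
qed

lemma vsig_of_gr_pos:
  assumes "k \<in> {1..2*m}" "l \<in> {1..2*m}" "1 \<le> m" "0 < gr (2*m - 1) k + gr (2*m - 1) l"
  shows "0 < vsig k + vsig l"
proof -
  have P: "int (2*m - 1) = 2 * int m - 1" using assms(3) by simp
  have sm: "\<bar>vsig j\<bar> < 2 * int m - 1" if "1 \<le> j" "j \<noteq> 2*m - 1" "j \<noteq> 2*m" "j \<le> 2*m" for j
    using that assms(3) unfolding vsig_def by auto
  have top: "vsig (2*m - 1) = 2 * int m - 1"
    using P assms(3) unfolding vsig_def by auto
  have "k = 2*m - 1 \<and> l \<noteq> 2*m \<or> l = 2*m - 1 \<and> k \<noteq> 2*m"
    using assms(3,4) unfolding gr_def by (auto split: if_splits)
  then show ?thesis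
  proof (elim disjE conjE)
    assume k: "k = 2*m - 1" "l \<noteq> 2*m"
    then show ?thesis using sm[of l] top assms(2,3) by (cases "l = 2*m - 1") auto
  next
    assume k: "l = 2*m - 1" "k \<noteq> 2*m"
    then show ?thesis using sm[of k] top assms(1,3) by (cases "k = 2*m - 1") auto
  qed
qed

text \<open>The form of the highest vector condition that survives the descent: at each level
  \<open>peel\<close> asks for a killed eigenvector of the zeroth \<open>s (2*i - 1) (2*i)\<close>.
  Uniqueness is proved for this notion.\<close>

definition singular :: "complex ^ 'd \<Rightarrow> bool" where
  "singular v \<longleftrightarrow> v \<noteq> 0 \<and>
     (\<forall>k\<in>{1..2*n}. \<forall>l\<in>{1..2*n}. 0 < vsig k + vsig l \<longrightarrow> (\<forall>r. s k l r *v v = 0)) \<and>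
     (\<forall>i\<in>{1..n}. \<exists>c. s (2*i - 1) (2*i) 0 *v v = c *s v)"

lemma descend:
  assumes "irr_level n UNIV" "j \<le> n"
  shows "\<exists>U. irr_level (n - j) U \<and>
    (\<forall>u\<in>U. \<forall>k\<in>{1..2*n}. \<forall>l\<in>{1..2*n}. \<not> (k \<le> 2*(n - j) \<and> l \<le> 2*(n - j)) \<longrightarrow>
        0 < vsig k + vsig l \<longrightarrow> (\<forall>r. s k l r *v u = 0)) \<and>
    (\<forall>i\<in>{n - j<..n}. \<forall>r. (\<exists>c. \<forall>u\<in>U. s (2*i - 1) (2*i) r *v u = c *s u) \<and>
        (\<exists>c. \<forall>u\<in>U. s (2*i) (2*i - 1) r *v u = c *s u)) \<and>
    (\<forall>v. singular v \<longrightarrow> v \<in> U)"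
  using assms(2)
proof (induction j)
  case 0
  then show ?case using assms(1) by (intro exI[of _ UNIV]) auto
next
  case (Suc j)
  then obtain U where U: "irr_level (n - j) U"
    and kil: "\<And>u k l r. u \<in> U \<Longrightarrow> k \<in> {1..2*n} \<Longrightarrow> l \<in> {1..2*n} \<Longrightarrow> \<not> (k \<le> 2*(n - j) \<and> l \<le> 2*(n - j)) \<Longrightarrow>
        0 < vsig k + vsig l \<Longrightarrow> s k l r *v u = 0"
    and sc: "\<And>i r. i \<in> {n - j<..n} \<Longrightarrow> (\<exists>c. \<forall>u\<in>U. s (2*i - 1) (2*i) r *v u = c *s u) \<and>
        (\<exists>c. \<forall>u\<in>U. s (2*i) (2*i - 1) r *v u = c *s u)"
    and sing: "\<And>v. singular v \<Longrightarrow> v \<in> U" by auto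
  define m where "m = n - j"
  have mm: "1 \<le> m" "m \<le> n" "n - Suc j = m - 1" using Suc.prems by (auto simp: m_def)
  interpret refl_level q n s m "2 * m - 1" using mm by unfold_locales auto
  have SP: "Suc (2 * m - 1) = 2 * m" using mm by simp
  obtain U' where U': "irr_level (m - 1) U'" "U' \<subseteq> U" "\<And>u. u \<in> U' \<Longrightarrow> killed u"
    "\<And>r. \<exists>c. \<forall>u\<in>U'. s (2*m - 1) (2*m) r *v u = c *s u"
    "\<And>r. \<exists>c. \<forall>u\<in>U'. s (2*m) (2*m - 1) r *v u = c *s u"
    "\<And>v l. v \<in> U \<Longrightarrow> v \<noteq> 0 \<Longrightarrow> killed v \<Longrightarrow> s (2*m - 1) (2*m) 0 *v v = l *s v \<Longrightarrow> v \<in> U'"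
    using peel[of U] U unfolding SP m_def[symmetric] by metis
  show ?case unfolding mm(3)
  proof (intro exI[of _ U'] conjI)
    show "irr_level (m - 1) U'" by fact
    show "\<forall>u\<in>U'. \<forall>k\<in>{1..2*n}. \<forall>l\<in>{1..2*n}. \<not> (k \<le> 2*(m - 1) \<and> l \<le> 2*(m - 1)) \<longrightarrow>
        0 < vsig k + vsig l \<longrightarrow> (\<forall>r. s k l r *v u = 0)"
    proof (intro ballI impI allI)
      fix u k l r assume u: "u \<in> U'" and kl: "k \<in> {1..2*n}" "l \<in> {1..2*n}"
        and no: "\<not> (k \<le> 2*(m - 1) \<and> l \<le> 2*(m - 1))" and pos: "0 < vsig k + vsig l"
      show "s k l r *v u = 0"
      proof (cases "k \<le> 2*m \<and> l \<le> 2*m")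
        case True
        then have "0 < gr (2*m - 1) k + gr (2*m - 1) l" using gr_pos_of_vsig kl no pos mm by auto
        then show ?thesis using U'(3)[OF u] True kl unfolding killed_def SP by auto
      next
        case False
        then show ?thesis using kil[of u k l r] u U'(2) kl pos unfolding m_def by auto
      qed
    qed
    show "\<forall>i\<in>{m - 1<..n}. \<forall>r. (\<exists>c. \<forall>u\<in>U'. s (2*i - 1) (2*i) r *v u = c *s u) \<and>
        (\<exists>c. \<forall>u\<in>U'. s (2*i) (2*i - 1) r *v u = c *s u)"
    proof (intro ballI allI)
      fix i r assume i: "i \<in> {m - 1<..n}"
      show "(\<exists>c. \<forall>u\<in>U'. s (2*i - 1) (2*i) r *v u = c *s u) \<and>
        (\<exists>c. \<forall>u\<in>U'. s (2*i) (2*i - 1) r *v u = c *s u)"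
      proof (cases "i = m")
        case True
        then show ?thesis using U'(4,5) by simp
      next
        case False
        then have "i \<in> {n - j<..n}" using i unfolding m_def by auto
        then show ?thesis using sc[of i r] U'(2) by (meson subsetD)
      qed
    qed
    show "\<forall>v. singular v \<longrightarrow> v \<in> U'"
    proof (intro allI impI)
      fix v assume v: "singular v"
      have "killed v"
        unfolding killed_def SP
        using v vsig_of_gr_pos[of _ m] mm by (auto simp: singular_def)
      moreover have "m \<in> {1..n}" using mm by simp
      then obtain c where "s (2*m - 1) (2*m) 0 *v v = c *s v" using v unfolding singular_def by blast
      ultimately show "v \<in> U'" using U'(6) sing[OF v] v by (auto simp: singular_def)
    qed
  qed
qed

theorem highest_line:
  assumes "irr_level n UNIV"
  obtains \<xi> where "\<xi> \<noteq> 0"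
    "\<And>k l r. k \<in> {1..2*n} \<Longrightarrow> l \<in> {1..2*n} \<Longrightarrow> 0 < vsig k + vsig l \<Longrightarrow> s k l r *v \<xi> = 0"
    "\<And>i r. i \<in> {1..n} \<Longrightarrow> \<exists>c. s (2*i - 1) (2*i) r *v \<xi> = c *s \<xi>"
    "\<And>i r. i \<in> {1..n} \<Longrightarrow> \<exists>c. s (2*i) (2*i - 1) r *v \<xi> = c *s \<xi>"
    "\<And>v. singular v \<Longrightarrow> \<exists>c. v = c *s \<xi>"
proof -
  obtain U where U: "irr_level 0 U"
    and kil: "\<And>u k l r. u \<in> U \<Longrightarrow> k \<in> {1..2*n} \<Longrightarrow> l \<in> {1..2*n} \<Longrightarrow>
        0 < vsig k + vsig l \<Longrightarrow> s k l r *v u = 0"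
    and sc: "\<And>i r. i \<in> {0<..n} \<Longrightarrow> (\<exists>c. \<forall>u\<in>U. s (2*i - 1) (2*i) r *v u = c *s u) \<and>
        (\<exists>c. \<forall>u\<in>U. s (2*i) (2*i - 1) r *v u = c *s u)"
    and sing: "\<And>v. singular v \<Longrightarrow> v \<in> U"
    using descend[OF assms, of n] by (auto simp: Ball_def)
  obtain \<xi> where xi: "\<xi> \<in> U" "\<xi> \<noteq> 0"
    using U vec.subspace_0 unfolding irr_level_def by blast
  have "vec.span {\<xi>} \<subseteq> U" using U xi by (intro vec.span_minimal) (auto simp: irr_level_def)
  \<comment> \<open>At level 0 no generator is left, so every subspace is invariant and
    irreducibility allows only a line.\<close>
  moreover have "inv_level 0 (vec.span {\<xi>})" by (simp add: inv_level_def)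
  moreover have "\<xi> \<in> vec.span {\<xi>}" by (simp add: vec.span_base)
  ultimately have "U = vec.span {\<xi>}"
    using U xi(2) vec.subspace_span unfolding irr_level_def by (metis singletonD)
  then have "\<exists>c. v = c *s \<xi>" if "singular v" for v
    using sing[OF that] by (auto simp: vec.span_singleton)
  moreover have "\<exists>c. s (2*i - 1) (2*i) r *v \<xi> = c *s \<xi>" "\<exists>c. s (2*i) (2*i - 1) r *v \<xi> = c *s \<xi>"
    if "i \<in> {1..n}" for i r
    using sc[of i r] that xi(1) by auto
  ultimately show ?thesis
    by (intro that[OF xi(2)]) (use kil xi(1) in auto)
qed

end

section \<open>From the RTT relations to the reflection equation\<close>

text \<open>The q-version of the symplectic form: S(u) is T(u) times this matrix times the transpose
  of the barred T(1/u).\<close>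

definition Gm :: "'a::ring_1 \<Rightarrow> nat \<Rightarrow> nat \<Rightarrow> 'a" where
  "Gm q i j = (if odd i \<and> j = Suc i then q else if odd j \<and> i = Suc j then -1 else 0)"

lemma Gm_odd_even: "Gm q (Suc (2*k)) j = (if j = Suc (Suc (2*k)) then q else 0)"
  "Gm q (Suc (Suc (2*k))) j = (if j = Suc (2*k) then -1 else 0)"
  by (auto simp: Gm_def)

text \<open>The constant matrix solves the reflection equation, and S(u) inherits the equation from
  it. A product of two entries is nonzero only if the four indices split into two pairs of the form
  2k-1, 2k; the three ways of pairing them are the cases \<open>A\<close>, \<open>B\<close>,
  \<open>C\<close>.\<close>

lemma refl_eq_Gm:
  fixes q p x y :: "'a::idom"
  assumes qp: "q * p = 1"
  shows "refl_eq q p x y (\<lambda>i a j b. Gm q i a * Gm q j b) (\<lambda>i a j b. Gm q i a * Gm q j b) i j a b"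
proof -
  define adj where "adj i a \<longleftrightarrow> (\<exists>k. i = Suc (2*k) \<and> a = Suc (Suc (2*k)) \<or> a = Suc (2*k) \<and> i = Suc (Suc (2*k)))"
    for i a :: nat
  have G0: "Gm q i a = 0" "Gm q a i = 0" if "\<not> adj i a" for i a
    using that by (auto simp: Gm_def adj_def elim!: oddE)
  note * = refl_eq_def Rd_def Ro_def Td_def To_def
  have sc: "Suc (2*k) \<noteq> 2*l" "2*l \<noteq> Suc (2*k)" for k l :: nat by presburger+
  have arith: "Suc (2*k) < 2*l \<longleftrightarrow> k < l" "2*k < Suc (2*l) \<longleftrightarrow> k \<le> l" for k l :: nat by presburger+
  \<comment> \<open>If \<open>i\<close> and \<open>a\<close> are the odd members of pairs
    \<open>i\<close>, \<open>j\<close> and \<open>a\<close>, \<open>b\<close>, the equation becomes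
    one of these three identities: the pair of \<open>a\<close> is higher, equal or lower.\<close>
  have B1: "(y - x) * ((p - q) * (x * y) * (q * q)) - (p - q) * x * ((p - q) * (x * y) * q)
      = (y - x) * ((p - q) * (x * y)) - (p - q) * y * ((p - q) * (x * y) * q)"
    and B2: "(y - x) * ((p - q) * (q * q)) - (p - q) * x * ((p * (x * y) - q) * q)
      = (y - x) * ((p - q) * (x * y)) - (p - q) * y * ((p * (x * y) - q) * q)"
    and B3: "(y - x) * ((p - q) * (q * q)) - (p - q) * x * ((p - q) * q)
      = (y - x) * (p - q) - (p - q) * y * ((p - q) * q)"
    using qp by algebra+
  note S1 = * Gm_odd_even sc arith
  consider (A) "adj i a" "adj j b" | (B) "adj i j" "adj a b" | (C) "adj j a" "adj i b"
    | (D) "\<not> (adj i a \<and> adj j b)" "\<not> (adj i j \<and> adj a b)" "\<not> (adj j a \<and> adj i b)"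
    by blast
  then show ?thesis
  proof cases
    case A
    then obtain k l where "i = Suc (2*k) \<and> a = Suc (Suc (2*k)) \<or> a = Suc (2*k) \<and> i = Suc (Suc (2*k))"
      "j = Suc (2*l) \<and> b = Suc (Suc (2*l)) \<or> b = Suc (2*l) \<and> j = Suc (Suc (2*l))"
      unfolding adj_def by blast
    then show ?thesis
      by (elim disjE conjE; cases k l rule: linorder_cases; simp add: S1 B1 B2 B3)
  next
    case B
    then obtain k l where "i = Suc (2*k) \<and> j = Suc (Suc (2*k)) \<or> j = Suc (2*k) \<and> i = Suc (Suc (2*k))"
      "a = Suc (2*l) \<and> b = Suc (Suc (2*l)) \<or> b = Suc (2*l) \<and> a = Suc (Suc (2*l))"
      unfolding adj_def by blast
    then show ?thesis
      by (elim disjE conjE; cases k l rule: linorder_cases; simp add: S1 B1 B2 B3)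
  next
    case C
    then obtain k l where "j = Suc (2*k) \<and> a = Suc (Suc (2*k)) \<or> a = Suc (2*k) \<and> j = Suc (Suc (2*k))"
      "i = Suc (2*l) \<and> b = Suc (Suc (2*l)) \<or> b = Suc (2*l) \<and> i = Suc (Suc (2*l))"
      unfolding adj_def by blast
    then show ?thesis
      by (elim disjE conjE; cases k l rule: linorder_cases; simp add: S1 B1 B2 B3)
  next
    case D
    have "Gm q i a * Gm q j b = 0" "Gm q j b * Gm q i a = 0"
      using D(1) G0(1)[of i a] G0(1)[of j b] by auto
    moreover have "Gm q i j * Gm q a b = 0" "Gm q j i * Gm q a b = 0" "Gm q j i * Gm q b a = 0"
      using D(2) G0[of i j] G0[of a b] by auto
    moreover have "Gm q j a * Gm q i b = 0"
      using D(3) G0(1)[of j a] G0(1)[of i b] by auto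
    ultimately show ?thesis
      unfolding refl_eq_def by (simp only: mult_zero_right add_0_right)
  qed
qed

context generic_params
begin

text \<open>The relation for the barred series at 1/u and 1/v comes with \<open>x\<close> and
  \<open>y\<close> exchanged. By unitarity those coefficients are inverse, up to the factor
  \<open>det_R\<close>, to the ones with \<open>x\<close> and \<open>y\<close> in order; multiplying
  by them from both sides brings the relation into the form that the reflection equation needs.
  \<open>Z\<close> is the common value of the two sides.\<close>

lemma bb_transpose:
  assumes bb: "\<And>a b d f. a \<in> I \<Longrightarrow> b \<in> I \<Longrightarrow> d \<in> I \<Longrightarrow> f \<in> I \<Longrightarrow>
      Rd q p y x a b * X a d b f + Ro q p y x a b * X b d a f
      = Rd q p y x d f * Y b f a d + Ro q p y x f d * Y b d a f"
    and I: "a \<in> I" "b \<in> I" "d \<in> I" "f \<in> I"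
  shows "Rd q p x y d f * X a d b f + Ro q p x y d f * X a f b d
       = Rd q p x y a b * Y b f a d + Ro q p x y b a * Y a f b d"
proof -
  let ?det = "(y - x) * (y - x) - (p - q) * (p - q) * (x * y)"
  define Z where "Z a b d f = Rd q p y x d f * Y b f a d + Ro q p y x f d * Y b d a f" for a b d f
  have RX: "- ?det * X a d b f = Rd q p x y a b * Z a b d f + Ro q p x y b a * Z b a d f"
    if "d \<in> I" "f \<in> I" for d f
  proof -
    have Z: "Z a b d f = Rd q p y x a b * X a d b f + Ro q p y x a b * X b d a f"
      "Z b a d f = Rd q p y x b a * X b d a f + Ro q p y x b a * X a d b f"
      using bb[OF I(1,2) that] bb[OF I(2,1) that] by (simp_all add: Z_def)
    show ?thesis
    proof (cases "a = b")
      case True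
      then have "Rd q p x y a b = p * y - q * x" "Rd q p y x a b = p * x - q * y" "Ro q p x y b a = 0"
        "Ro q p y x a b = 0" by (simp_all add: Rd_def Ro_def)
      then show ?thesis unfolding Z using qp by algebra
    next
      case False
      then have "Rd q p x y a b = y - x" "Rd q p y x a b = x - y" "Rd q p y x b a = x - y"
        "Ro q p x y b a = Ro q p y x a b" "Ro q p y x a b * Ro q p y x b a = (p - q) * (p - q) * (x * y)"
        by (auto simp: Rd_def Ro_def)
      then show ?thesis unfolding Z by algebra
    qed
  qed
  have ZR: "Rd q p x y d f * Z a b d f + Ro q p x y d f * Z a b f d = - ?det * Y b f a d" for a b
  proof (cases "d = f")
    case True
    then have "Rd q p x y d f = p * y - q * x" "Rd q p y x d f = p * x - q * y" "Ro q p x y d f = 0"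
      "Ro q p y x f d = 0" by (simp_all add: Rd_def Ro_def)
    then show ?thesis unfolding Z_def using qp by algebra
  next
    case False
    then have "Rd q p x y d f = y - x" "Rd q p y x d f = x - y" "Rd q p y x f d = x - y"
      "Ro q p y x f d = Ro q p x y d f" "Ro q p x y d f * Ro q p y x d f = (p - q) * (p - q) * (x * y)"
      by (auto simp: Rd_def Ro_def)
    then show ?thesis unfolding Z_def by algebra
  qed
  have "- ?det * (Rd q p x y d f * X a d b f + Ro q p x y d f * X a f b d)
      = Rd q p x y d f * (- ?det * X a d b f) + Ro q p x y d f * (- ?det * X a f b d)"
    by (simp only: distrib_left mult.left_commute)
  also have "\<dots> = Rd q p x y a b * (Rd q p x y d f * Z a b d f + Ro q p x y d f * Z a b f d)
      + Ro q p x y b a * (Rd q p x y d f * Z b a d f + Ro q p x y d f * Z b a f d)"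
    by (simp only: RX I) (simp only: distrib_left mult.left_commute add_ac)
  also have "\<dots> = - ?det * (Rd q p x y a b * Y b f a d + Ro q p x y b a * Y a f b d)"
    by (simp only: ZR) (simp only: distrib_left mult.left_commute)
  finally show ?thesis using det_R by (simp only: mult_cancel_left neg_equal_0_iff_equal) blast
qed

end

definition sum4 :: "nat set \<Rightarrow> (nat \<Rightarrow> nat \<Rightarrow> nat \<Rightarrow> nat \<Rightarrow> 'a) \<Rightarrow> 'a::comm_ring_1" where
  "sum4 I H = (\<Sum>c\<in>I. \<Sum>d\<in>I. \<Sum>e\<in>I. \<Sum>f\<in>I. H c d e f)"

lemma sum4_swap12: "sum4 I H = sum4 I (\<lambda>c d e f. H d c e f)"
  unfolding sum4_def by (rule sum.swap)

lemma sum4_swap23: "sum4 I H = sum4 I (\<lambda>c d e f. H c e d f)"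
  unfolding sum4_def by (intro sum.cong refl sum.swap)

lemma sum4_swap34: "sum4 I H = sum4 I (\<lambda>c d e f. H c d f e)"
  unfolding sum4_def by (intro sum.cong refl sum.swap)

lemma sum4_swap13: "sum4 I H = sum4 I (\<lambda>c d e f. H e d c f)"
  by (subst sum4_swap12, subst sum4_swap23, subst sum4_swap12) (rule refl)

lemma sum4_swap24: "sum4 I H = sum4 I (\<lambda>c d e f. H c f e d)"
  by (subst sum4_swap23, subst sum4_swap34, subst sum4_swap23) (rule refl)

lemma sum4_swap14: "sum4 I H = sum4 I (\<lambda>c d e f. H f d e c)"
  by (subst sum4_swap12, subst sum4_swap24, subst sum4_swap12) (rule refl)

lemma sum4_add: "sum4 I (\<lambda>c d e f. H c d e f + H' c d e f) = sum4 I H + sum4 I H'"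
  by (simp add: sum4_def sum.distrib)

lemma sum4_mult: "k * sum4 I H = sum4 I (\<lambda>c d e f. k * H c d e f)"
  by (simp add: sum4_def sum_distrib_left)

lemma sum4_cong:
  assumes "\<And>c d e f. c \<in> I \<Longrightarrow> d \<in> I \<Longrightarrow> e \<in> I \<Longrightarrow> f \<in> I \<Longrightarrow> H c d e f = H' c d e f"
  shows "sum4 I H = sum4 I H'"
  unfolding sum4_def using assms by (intro sum.cong refl) auto

text \<open>The words \<open>w1\<close>, \dots, \<open>w5\<close> stand for the products of \<open>t\<^sub>i\<^sub>c(u)\<close>, \<open>t'\<^sub>a\<^sub>d(1/u)\<close>, \<open>t\<^sub>j\<^sub>e(v)\<close>, \<open>t'\<^sub>b\<^sub>f(1/v)\<close>
  (with \<open>t'\<close> for the barred series) in the five orders that occur when \<open>S\<^sub>1(u) R S\<^sub>2(v)\<close> is turned into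
  \<open>S\<^sub>2(v) R S\<^sub>1(u)\<close> by moving one factor at a time.\<close>

lemma (in generic_params) refl_eq_of_words:
  fixes w1 w2 w3 w4 w5 :: "nat \<Rightarrow> nat \<Rightarrow> nat \<Rightarrow> nat \<Rightarrow> nat \<Rightarrow> nat \<Rightarrow> nat \<Rightarrow> nat \<Rightarrow> 'a"
  assumes m1: "\<And>i c a d j e b f. {i, c, a, d, j, e, b, f} \<subseteq> I \<Longrightarrow>
      Td q p x y a j * w1 i c a d j e b f + To q p x y a j * w1 i c j d a e b f
      = Td q p x y d e * w2 i c a d j e b f + To q p x y e d * w2 i c a e j d b f"
    and tt: "\<And>i c a d j e b f. {i, c, a, d, j, e, b, f} \<subseteq> I \<Longrightarrow>
      Rd q p x y i j * w2 i c a d j e b f + Ro q p x y i j * w2 j c a d i e b f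
      = Rd q p x y c e * w3 i c a d j e b f + Ro q p x y e c * w3 i e a d j c b f"
    and bb: "\<And>i c a d j e b f. {i, c, a, d, j, e, b, f} \<subseteq> I \<Longrightarrow>
      Rd q p y x a b * w3 i c a d j e b f + Ro q p y x a b * w3 i c b d j e a f
      = Rd q p y x d f * w4 i c a d j e b f + Ro q p y x f d * w4 i c a f j e b d"
    and m2: "\<And>i c a d j e b f. {i, c, a, d, j, e, b, f} \<subseteq> I \<Longrightarrow>
      Td q p x y b i * w5 i c a d j e b f + To q p x y b i * w5 b c a d j e i f
      = Td q p x y f c * w4 i c a d j e b f + To q p x y c f * w4 i f a d j e b c"
    and I: "{i, j, a, b} \<subseteq> I"
    and F: "\<And>i a j b. {i, j, a, b} \<subseteq> I \<Longrightarrow>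
      F i a j b = sum4 I (\<lambda>c d e f. Gm q c d * Gm q e f * w1 i c a d j e b f)"
    and G: "\<And>i a j b. {i, j, a, b} \<subseteq> I \<Longrightarrow>
      G j b i a = sum4 I (\<lambda>c d e f. Gm q c d * Gm q e f * w5 i c a d j e b f)"
  shows "refl_eq q p x y F G i j a b"
proof -
  define M where "M c e d f = Td q p x y d e * (Gm q c d * Gm q e f) + To q p x y d e * (Gm q c e * Gm q d f)" for c e d f
  define M' where "M' c e d f = Td q p x y c f * (Gm q e f * Gm q c d) + To q p x y f c * (Gm q e c * Gm q f d)" for c e d f
  have alpha: "Td q p x y a j * F i a j b + To q p x y a j * F i j a b
      = sum4 I (\<lambda>c d e f. M c e d f * w2 i c a d j e b f)" if I: "{i, j, a, b} \<subseteq> I" for i j a b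
  proof -
    have "Td q p x y a j * F i a j b + To q p x y a j * F i j a b
        = sum4 I (\<lambda>c d e f. Gm q c d * Gm q e f * (Td q p x y a j * w1 i c a d j e b f + To q p x y a j * w1 i c j d a e b f))"
      using F[of i j a b] F[of i a j b] I by (simp add: sum4_mult sum4_add[symmetric] algebra_simps insert_commute)
    also have "\<dots> = sum4 I (\<lambda>c d e f. Gm q c d * Gm q e f * (Td q p x y d e * w2 i c a d j e b f + To q p x y e d * w2 i c a e j d b f))"
      using I by (intro sum4_cong arg_cong2[of _ _ _ _ "(*)"] refl m1) auto
    also have "\<dots> = sum4 I (\<lambda>c d e f. Gm q c d * Gm q e f * Td q p x y d e * w2 i c a d j e b f)
        + sum4 I (\<lambda>c d e f. Gm q c d * Gm q e f * To q p x y e d * w2 i c a e j d b f)"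
      by (simp add: sum4_add[symmetric] algebra_simps)
    also have "sum4 I (\<lambda>c d e f. Gm q c d * Gm q e f * To q p x y e d * w2 i c a e j d b f)
        = sum4 I (\<lambda>c d e f. Gm q c e * Gm q d f * To q p x y d e * w2 i c a d j e b f)"
      by (rule sum4_swap23)
    finally show ?thesis by (simp add: M_def sum4_add[symmetric] algebra_simps)
  qed
  have beta: "Td q p x y i b * G j b i a + To q p x y b i * G j i b a
      = sum4 I (\<lambda>c d e f. M' c e d f * w4 i c a d j e b f)" if I: "{i, j, a, b} \<subseteq> I" for i j a b
  proof -
    have Td: "Td q p x y i b = Td q p x y b i" "Td q p x y c f = Td q p x y f c" for c f by (auto simp: Td_def)
    have "Td q p x y i b * G j b i a + To q p x y b i * G j i b a
        = sum4 I (\<lambda>c d e f. Gm q c d * Gm q e f * (Td q p x y b i * w5 i c a d j e b f + To q p x y b i * w5 b c a d j e i f))"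
      using G[of i j a b] G[of b j a i] I by (simp add: Td(1) sum4_mult sum4_add[symmetric] algebra_simps insert_commute)
    also have "\<dots> = sum4 I (\<lambda>c d e f. Gm q c d * Gm q e f * (Td q p x y f c * w4 i c a d j e b f + To q p x y c f * w4 i f a d j e b c))"
      using I by (intro sum4_cong arg_cong2[of _ _ _ _ "(*)"] refl m2) auto
    also have "\<dots> = sum4 I (\<lambda>c d e f. Gm q c d * Gm q e f * Td q p x y f c * w4 i c a d j e b f)
        + sum4 I (\<lambda>c d e f. Gm q c d * Gm q e f * To q p x y c f * w4 i f a d j e b c)"
      by (simp add: sum4_add[symmetric] algebra_simps)
    also have "sum4 I (\<lambda>c d e f. Gm q c d * Gm q e f * To q p x y c f * w4 i f a d j e b c)
        = sum4 I (\<lambda>c d e f. Gm q f d * Gm q e c * To q p x y f c * w4 i c a d j e b f)"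
      by (rule sum4_swap14)
    finally show ?thesis by (simp add: M'_def Td(2) sum4_add[symmetric] algebra_simps)
  qed
  \<comment> \<open>This is where the constant solution enters: it carries the coefficients of R
    from the indices \<open>c\<close>, \<open>e\<close> of the unbarred factors to the indices
    \<open>d\<close>, \<open>f\<close> of the barred ones.\<close>
  have const: "Rd q p x y c e * M c e d f + Ro q p x y c e * M e c d f
      = Rd q p x y d f * M' c e d f + Ro q p x y f d * M' c e f d" for c d e f
    using refl_eq_Gm[OF qp, of x y c e d f] by (simp add: refl_eq_def M_def M'_def)
  have "Rd q p x y i j * sum4 I (\<lambda>c d e f. M c e d f * w2 i c a d j e b f)
      + Ro q p x y i j * sum4 I (\<lambda>c d e f. M c e d f * w2 j c a d i e b f)
      = sum4 I (\<lambda>c d e f. M c e d f * (Rd q p x y i j * w2 i c a d j e b f + Ro q p x y i j * w2 j c a d i e b f))"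
    by (simp add: sum4_mult sum4_add[symmetric] algebra_simps)
  also have "\<dots> = sum4 I (\<lambda>c d e f. M c e d f * (Rd q p x y c e * w3 i c a d j e b f + Ro q p x y e c * w3 i e a d j c b f))"
    using I by (intro sum4_cong arg_cong2[of _ _ _ _ "(*)"] refl tt) auto
  also have "\<dots> = sum4 I (\<lambda>c d e f. M c e d f * Rd q p x y c e * w3 i c a d j e b f)
      + sum4 I (\<lambda>c d e f. M c e d f * Ro q p x y e c * w3 i e a d j c b f)"
    by (simp add: sum4_add[symmetric] algebra_simps)
  also have "sum4 I (\<lambda>c d e f. M c e d f * Ro q p x y e c * w3 i e a d j c b f)
      = sum4 I (\<lambda>c d e f. M e c d f * Ro q p x y c e * w3 i c a d j e b f)"
    by (rule sum4_swap13)
  also have "sum4 I (\<lambda>c d e f. M c e d f * Rd q p x y c e * w3 i c a d j e b f) + \<dots>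
      = sum4 I (\<lambda>c d e f. (Rd q p x y c e * M c e d f + Ro q p x y c e * M e c d f) * w3 i c a d j e b f)"
    by (simp add: sum4_add[symmetric] algebra_simps)
  also have "\<dots> = sum4 I (\<lambda>c d e f. Rd q p x y d f * M' c e d f * w3 i c a d j e b f)
      + sum4 I (\<lambda>c d e f. Ro q p x y f d * M' c e f d * w3 i c a d j e b f)"
    unfolding const by (simp add: sum4_add[symmetric] algebra_simps)
  also have "sum4 I (\<lambda>c d e f. Ro q p x y f d * M' c e f d * w3 i c a d j e b f)
      = sum4 I (\<lambda>c d e f. Ro q p x y d f * M' c e d f * w3 i c a f j e b d)"
    by (rule sum4_swap24)
  also have "sum4 I (\<lambda>c d e f. Rd q p x y d f * M' c e d f * w3 i c a d j e b f) + \<dots>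
      = sum4 I (\<lambda>c d e f. M' c e d f * (Rd q p x y d f * w3 i c a d j e b f + Ro q p x y d f * w3 i c a f j e b d))"
    by (simp add: sum4_add[symmetric] algebra_simps)
  also have "\<dots> = sum4 I (\<lambda>c d e f. M' c e d f * (Rd q p x y a b * w4 i c a d j e b f + Ro q p x y b a * w4 i c b d j e a f))"
  proof (intro sum4_cong arg_cong2[of _ _ _ _ "(*)"] refl)
    fix c d e f assume ce: "c \<in> I" "d \<in> I" "e \<in> I" "f \<in> I"
    show "Rd q p x y d f * w3 i c a d j e b f + Ro q p x y d f * w3 i c a f j e b d
        = Rd q p x y a b * w4 i c a d j e b f + Ro q p x y b a * w4 i c b d j e a f"
      by (rule bb_transpose[of I "\<lambda>a d b f. w3 i c a d j e b f" "\<lambda>b f a d. w4 i c a d j e b f"])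
         (use I ce bb in auto)
  qed
  also have "\<dots> = Rd q p x y a b * sum4 I (\<lambda>c d e f. M' c e d f * w4 i c a d j e b f)
      + Ro q p x y b a * sum4 I (\<lambda>c d e f. M' c e d f * w4 i c b d j e a f)"
    by (simp add: sum4_mult sum4_add[symmetric] algebra_simps)
  finally show ?thesis
    unfolding refl_eq_def using I alpha[of i j a b] alpha[of j i a b] beta[of i j a b] beta[of i j b a]
    by (simp add: insert_commute)
qed

subsection \<open>The free algebra as a ring\<close>

lemma fmul_Nil: "fmul f g [] = f [] * g []"
  by (simp add: fmul_def)

text \<open>A Leibniz rule for removing the first letter; it lets the convolution be treated by
  induction on the word instead of by reindexing sums over splittings.\<close>

lemma fmul_Cons: "fmul f g (a # w) = f [] * g (a # w) + fmul (\<lambda>u. f (a # u)) g w"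
  by (simp add: fmul_def sum.atMost_Suc_shift del: sum.atMost_Suc)

lemma fmul_add_left: "fmul (f + f') g = fmul f g + fmul f' g"
  and fmul_add_right: "fmul f (g + g') = fmul f g + fmul f g'"
  by (simp_all add: fmul_def fun_eq_iff algebra_simps sum.distrib)

lemma fmul_scale_left: "fmul (fscale c f) g = fscale c (fmul f g)"
  and fmul_scale_right: "fmul f (fscale c g) = fscale c (fmul f g)"
  by (simp_all add: fmul_def fscale_def fun_eq_iff sum_distrib_left algebra_simps)

lemma fmul_assoc: "fmul (fmul f g) h = fmul f (fmul g h)"
proof
  fix w show "fmul (fmul f g) h w = fmul f (fmul g h) w"
  proof (induction w arbitrary: f)
    case Nil
    then show ?case by (simp add: fmul_Nil)
  next
    case (Cons a w)
    let ?g = "\<lambda>u. g (a # u)" and ?f = "\<lambda>u. f (a # u)"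
    have eq: "(\<lambda>u. fmul f g (a # u)) = fscale (f []) ?g + fmul ?f g"
      by (simp add: fmul_Cons fscale_def fun_eq_iff)
    have ap: "fscale c k w = c * k w" for c k by (simp add: fscale_def)
    have "fmul (fmul f g) h (a # w)
        = f [] * (g [] * h (a # w) + fmul ?g h w) + fmul (fmul ?f g) h w"
      by (simp only: fmul_Cons[of "fmul f g"] eq)
         (simp only: fmul_Nil fmul_add_left fmul_scale_left plus_fun_apply ap distrib_left mult.assoc add.assoc)
    also have "fmul (fmul ?f g) h w = fmul ?f (fmul g h) w" by (rule Cons.IH)
    finally show ?case by (simp add: fmul_Cons[of f] fmul_Cons[of g])
  qed
qed

lemma mono_Cons: "mono v (a # u) = (case v of [] \<Rightarrow> 0 | b # v' \<Rightarrow> if a = b then mono v' u else 0)"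
  by (auto simp: mono_def split: list.splits)

lemma fmul_mono: "fmul (mono u) (mono v) = mono (u @ v)"
proof
  fix w show "fmul (mono u) (mono v) w = mono (u @ v) w"
  proof (induction w arbitrary: u)
    case Nil
    then show ?case by (auto simp: fmul_Nil mono_def)
  next
    case (Cons a w)
    have z: "fmul (\<lambda>u. 0) g w = 0" for g by (simp add: fmul_def)
    have m0: "mono (b # u') [] = 0" for b u' by (simp add: mono_def)
    show ?case
    proof (cases u)
      case Nil
      then show ?thesis by (simp add: fmul_Cons mono_Cons z) (simp add: mono_def)
    next
      case (Cons b u')
      then show ?thesis using Cons.IH[of u']
        by (cases "a = b") (simp_all add: fmul_Cons mono_Cons z m0)
    qed
  qed
qed

lemma fmul_one_left: "fmul fone f = f"
proof
  fix w show "fmul fone f w = f w"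
    by (cases w) (simp_all add: fmul_Nil fmul_Cons fone_def mono_Cons, simp_all add: fmul_def mono_def)
qed

lemma fmul_one_right: "fmul f fone = f"
proof
  fix w show "fmul f fone w = f w"
  proof (induction w arbitrary: f)
    case Nil
    then show ?case by (simp add: fmul_Nil fone_def mono_def)
  next
    case (Cons a w)
    then show ?case by (simp add: fmul_Cons fone_def mono_Cons)
  qed
qed

text \<open>A copy of the function type, since that type already carries pointwise multiplication.\<close>

typedef falg = "UNIV :: fa set" morphisms fa_of Falg ..

setup_lifting type_definition_falg

instantiation falg :: ring_1
begin
lift_definition zero_falg :: falg is 0 .
lift_definition one_falg :: falg is fone .
lift_definition plus_falg :: "falg \<Rightarrow> falg \<Rightarrow> falg" is "(+)" .
lift_definition minus_falg :: "falg \<Rightarrow> falg \<Rightarrow> falg" is "(-)" .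
lift_definition uminus_falg :: "falg \<Rightarrow> falg" is "uminus" .
lift_definition times_falg :: "falg \<Rightarrow> falg \<Rightarrow> falg" is fmul .
instance
proof
  show "(0::falg) \<noteq> 1" by transfer (auto simp: fone_def mono_def fun_eq_iff)
qed (transfer; simp add: fmul_assoc fmul_one_left fmul_one_right fmul_add_left fmul_add_right)+
end

lift_definition scl :: "complex \<Rightarrow> falg \<Rightarrow> falg" is fscale .

lemma fa_of_simps [simp]:
  "fa_of (x + y) = fa_of x + fa_of y" "fa_of (x - y) = fa_of x - fa_of y" "fa_of 0 = 0"
  "fa_of (x * y) = fmul (fa_of x) (fa_of y)" "fa_of 1 = fone" "fa_of (scl c x) = fscale c (fa_of x)"
  "fa_of (Falg f) = f"
  by (simp_all add: plus_falg.rep_eq minus_falg.rep_eq zero_falg.rep_eq times_falg.rep_eq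
      one_falg.rep_eq scl.rep_eq Falg_inverse)

lemma fa_of_sum: "fa_of (\<Sum>i\<in>A. f i) = (\<Sum>i\<in>A. fa_of (f i))"
  by (induction A rule: infinite_finite_induct) simp_all

lemma fscale_simps: "fscale c (f + g) = fscale c f + fscale c g" "fscale (c + d) f = fscale c f + fscale d f"
  "fscale c (f - g) = fscale c f - fscale c g" "fscale (c - d) f = fscale c f - fscale d f"
  "fscale c 0 = 0" "fscale 0 f = 0" "fscale 1 f = f" "fscale c (fscale d f) = fscale (c * d) f"
  "fscale (- c) f = - fscale c f"
  by (simp_all add: fscale_def fun_eq_iff algebra_simps)

lemma fscale_sum: "fscale c (\<Sum>i\<in>A. f i) = (\<Sum>i\<in>A. fscale c (f i))"
  by (induction A rule: infinite_finite_induct) (simp_all add: fscale_def fun_eq_iff algebra_simps)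

lemma vector_space_fscale: "vector_space fscale"
  by unfold_locales (simp_all add: fscale_def fun_eq_iff algebra_simps)

text \<open>The type \<open>fa\<close> also contains infinite combinations of words, whereas
  \<open>Ideal\<close> is built from finite ones. Multiplication inside the ideal is therefore
  restricted to finite sums of words, and the coefficients of products of generating series are of
  this kind.\<close>

inductive_set fins :: "falg set" where
  zero: "0 \<in> fins"
| mono: "Falg (mono w) \<in> fins"
| add: "x \<in> fins \<Longrightarrow> y \<in> fins \<Longrightarrow> x + y \<in> fins"

lemma fins_mult_mono: "x \<in> fins \<Longrightarrow> x * Falg (mono w) \<in> fins"
proof (induction rule: fins.induct)
  case (mono v)
  have "Falg (mono v) * Falg (mono w) = Falg (Defs.mono (v @ w))"
    by (simp flip: fa_of_inject add: fmul_mono)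
  then show ?case by (simp add: fins.mono)
qed (auto simp: distrib_right intro: fins.intros)

lemma fins_mult: "y \<in> fins \<Longrightarrow> x \<in> fins \<Longrightarrow> x * y \<in> fins"
  by (induction rule: fins.induct) (auto simp: distrib_left intro: fins.intros fins_mult_mono)

lemma fins_sum: "(\<And>i. i \<in> A \<Longrightarrow> f i \<in> fins) \<Longrightarrow> (\<Sum>i\<in>A. f i) \<in> fins"
  by (induction A rule: infinite_finite_induct) (auto intro: fins.intros)

lemma Ideal_mono_left: "x \<in> Ideal n q \<Longrightarrow> fmul (mono w) x \<in> Ideal n q"
proof (induction rule: Ideal.induct)
  case (rel r u v)
  have "fmul (mono w) (fmul (fmul (mono u) r) (mono v)) = fmul (fmul (mono (w @ u)) r) (mono v)"
    by (simp add: fmul_assoc flip: fmul_mono)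
  then show ?case using Ideal.rel[OF rel] by simp
next
  case zero
  have "fmul (mono w) 0 = 0" by (simp add: fmul_def fun_eq_iff)
  then show ?case using Ideal.zero[of n q] by (simp only:)
qed (simp_all only: fmul_add_right fmul_scale_right Ideal.add Ideal.scale)

lemma Ideal_mono_right: "x \<in> Ideal n q \<Longrightarrow> fmul x (mono w) \<in> Ideal n q"
proof (induction rule: Ideal.induct)
  case (rel r u v)
  have "fmul (fmul (fmul (mono u) r) (mono v)) (mono w) = fmul (fmul (mono u) r) (mono (v @ w))"
    by (simp add: fmul_assoc flip: fmul_mono)
  then show ?case using Ideal.rel[OF rel] by simp
next
  case zero
  have "fmul 0 (mono w) = 0" by (simp add: fmul_def fun_eq_iff)
  then show ?case using Ideal.zero[of n q] by (simp only:)
qed (simp_all only: fmul_add_left fmul_scale_left Ideal.add Ideal.scale)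

lemma Ideal_rel: "r \<in> Rels n q \<Longrightarrow> r \<in> Ideal n q"
  using Ideal.rel[of r n q "[]" "[]"] by (simp add: fmul_one_left fmul_one_right flip: fone_def)

lemma Ideal_minus: "x \<in> Ideal n q \<Longrightarrow> - x \<in> Ideal n q"
  using Ideal.scale[of x n q "-1"] by (simp add: fscale_def fun_Compl_def)

lemma Ideal_diff: "x \<in> Ideal n q \<Longrightarrow> y \<in> Ideal n q \<Longrightarrow> x - y \<in> Ideal n q"
  using Ideal.add[of x n q "- y"] Ideal_minus[of y n q] by simp

lemma Ideal_sum: "(\<And>i. i \<in> A \<Longrightarrow> f i \<in> Ideal n q) \<Longrightarrow> (\<Sum>i\<in>A. f i) \<in> Ideal n q"
  by (induction A rule: infinite_finite_induct) (auto intro: Ideal.zero Ideal.add)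

lemma Ideal_fins_left: "a \<in> fins \<Longrightarrow> x \<in> Ideal n q \<Longrightarrow> fmul (fa_of a) x \<in> Ideal n q"
proof (induction rule: fins.induct)
  case zero
  have "fmul 0 x = 0" by (simp add: fmul_def fun_eq_iff)
  then show ?case using Ideal.zero[of n q] by (simp only: fa_of_simps)
qed (simp_all only: fa_of_simps fmul_add_left Ideal_mono_left Ideal.add)

lemma Ideal_fins_right: "a \<in> fins \<Longrightarrow> x \<in> Ideal n q \<Longrightarrow> fmul x (fa_of a) \<in> Ideal n q"
proof (induction rule: fins.induct)
  case zero
  have "fmul x 0 = 0" by (simp add: fmul_def fun_eq_iff)
  then show ?case using Ideal.zero[of n q] by (simp only: fa_of_simps)
qed (simp_all only: fa_of_simps fmul_add_right Ideal_mono_right Ideal.add)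

subsection \<open>Generating series\<close>

type_synonym ser = "falg fps fps"

definition emU :: "(nat \<Rightarrow> falg) \<Rightarrow> ser" where "emU c = fps_const (Abs_fps c)"
definition emV :: "(nat \<Rightarrow> falg) \<Rightarrow> ser" where "emV c = Abs_fps (\<lambda>p. fps_const (c p))"

lemma em_nth: "(emU c * emV d) $ p $ r = c r * d p" "(emV d * emU c) $ p $ r = d p * c r"
  by (simp_all add: emU_def emV_def)

definition fser :: "ser \<Rightarrow> bool" where "fser X \<longleftrightarrow> (\<forall>p r. X $ p $ r \<in> fins)"

lemma ser_mult_nth: "(A * B :: ser) $ p $ r = (\<Sum>i=0..p. \<Sum>k=0..r. A $ i $ k * B $ (p - i) $ (r - k))"
  by (simp add: fps_mult_nth fps_sum_nth)

lemma fser_mult: "fser A \<Longrightarrow> fser B \<Longrightarrow> fser (A * B)"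
  unfolding fser_def ser_mult_nth by (auto intro!: fins_sum fins_mult)

lemma fser_em: "(\<And>r. c r \<in> fins) \<Longrightarrow> fser (emU c)" "(\<And>r. c r \<in> fins) \<Longrightarrow> fser (emV c)"
  unfolding fser_def emU_def emV_def by (auto simp: fps_const_def fins.zero)

lemma fser_1: "fser 1"
proof -
  have "(1::falg) = Falg (mono [])" by (simp flip: fa_of_inject add: fone_def)
  then have "(1::falg) \<in> fins" using fins.mono by metis
  then show ?thesis by (auto simp: fser_def fps_one_nth fins.zero)
qed

abbreviation cstE :: "complex \<Rightarrow> ser" where "cstE c \<equiv> fps_const (fps_const (scl c 1))"
abbreviation XUE :: ser where "XUE \<equiv> fps_const fps_X"
abbreviation XVE :: ser where "XVE \<equiv> fps_X"

lemma scl_mult: "scl c 1 * a = scl c a" "a * scl c 1 = scl c a"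
  by (simp_all flip: fa_of_inject add: fmul_scale_left fmul_scale_right fmul_one_left fmul_one_right)

lemma ser_scalar_nth:
  "(cstE c * X) $ p $ r = scl c (X $ p $ r)"
  "(XUE * X) $ p $ r = (if r = 0 then 0 else X $ p $ (r - 1))"
  "(XVE * X) $ p $ r = (if p = 0 then 0 else X $ (p - 1) $ r)"
  by (simp_all add: scl_mult)

lemma ser_central: "cstE c * X = X * cstE c" "XUE * X = X * XUE" "XVE * X = X * XVE"
  by (auto simp: fps_eq_iff scl_mult)

definition PS :: "(fa \<Rightarrow> complex) \<Rightarrow> ser \<Rightarrow> complex fps fps" where
  "PS \<Psi> X = ser2 (\<lambda>r p. \<Psi> (fa_of (X $ p $ r)))"

lemma PS_nth [simp]: "PS \<Psi> X $ p $ r = \<Psi> (fa_of (X $ p $ r))"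
  by (simp add: PS_def)

locale ideal_functional =
  fixes n :: nat and q :: complex and \<Psi> :: "fa \<Rightarrow> complex"
  assumes lin: "Vector_Spaces.linear fscale (*) \<Psi>" and van: "\<And>x. x \<in> Ideal n q \<Longrightarrow> \<Psi> x = 0"
begin

sublocale L: Vector_Spaces.linear fscale "(*)" \<Psi> by (rule lin)

lemma PS_add: "PS \<Psi> (X + Y) = PS \<Psi> X + PS \<Psi> Y" and PS_diff: "PS \<Psi> (X - Y) = PS \<Psi> X - PS \<Psi> Y"
  by (simp_all add: fps_eq_iff L.add L.diff)

lemma PS_sum: "PS \<Psi> (\<Sum>i\<in>A. F i) = (\<Sum>i\<in>A. PS \<Psi> (F i))"
  by (induction A rule: infinite_finite_induct) (simp_all add: PS_add, simp_all add: fps_eq_iff L.zero)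

text \<open>A central coefficient inside a product leaves \<open>PS \<Psi>\<close> as a scalar
  series. In this way the entries of R pass from the noncommutative ring to a commutative domain,
  where they can be cancelled.\<close>

definition acts :: "ser \<Rightarrow> complex fps fps \<Rightarrow> bool" where
  "acts z \<zeta> \<longleftrightarrow> (\<forall>A X B. PS \<Psi> (A * (z * X) * B) = \<zeta> * PS \<Psi> (A * X * B))"

lemma acts_basic: "acts (cstE c) (cst c)" "acts XUE XU" "acts XVE XV" "acts 0 0" "acts 1 1"
proof -
  have pull: "A * (z * X) * B = z * (A * X * B)" if "\<And>Y. z * Y = Y * z" for z A X B :: ser
    using that[of A] by (simp add: mult.assoc[symmetric])
  have "PS \<Psi> (cstE c * Y) = cst c * PS \<Psi> Y" for Y
    by (simp add: fps_eq_iff scl_mult L.scale)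
  then show "acts (cstE c) (cst c)" unfolding acts_def using pull ser_central(1) by metis
  have "PS \<Psi> (XUE * Y) = XU * PS \<Psi> Y" for Y
    by (simp add: fps_eq_iff L.zero)
  then show "acts XUE XU" unfolding acts_def using pull ser_central(2) by metis
  have "PS \<Psi> (XVE * Y) = XV * PS \<Psi> Y" for Y
    by (simp add: fps_eq_iff L.zero)
  then show "acts XVE XV" unfolding acts_def using pull ser_central(3) by metis
  show "acts 0 0" by (simp add: acts_def fps_eq_iff L.zero)
  show "acts 1 1" by (simp add: acts_def)
qed

lemma acts_closed:
  assumes "acts z \<zeta>" "acts z' \<zeta>'"
  shows "acts (z - z') (\<zeta> - \<zeta>')" "acts (z * z') (\<zeta> * \<zeta>')"
  using assms unfolding acts_def
  by (simp_all add: left_diff_distrib right_diff_distrib PS_diff mult.assoc)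

lemma acts_coeffs:
  "acts (Rd (cstE c) (cstE d) XUE XVE i j) (Rd (cst c) (cst d) XU XV i j)"
  "acts (Rd (cstE c) (cstE d) XVE XUE i j) (Rd (cst c) (cst d) XV XU i j)"
  "acts (Ro (cstE c) (cstE d) XUE XVE i j) (Ro (cst c) (cst d) XU XV i j)"
  "acts (Ro (cstE c) (cstE d) XVE XUE i j) (Ro (cst c) (cst d) XV XU i j)"
  "acts (Td (cstE c) (cstE d) XUE XVE i j) (Td (cst c) (cst d) XU XV i j)"
  "acts (To (cstE c) (cstE d) XUE XVE i j) (To (cst c) (cst d) XU XV i j)"
  unfolding Rd_def Ro_def Td_def To_def
  by (auto intro!: acts_closed acts_basic simp del: fps_const_mult fps_const_sub)

lemma PS_rel:
  assumes "fser A" "fser B" and X: "\<And>p r. fa_of (X $ p $ r) \<in> Ideal n q"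
  shows "PS \<Psi> (A * X * B) = 0"
proof -
  have AX: "fa_of ((A * X) $ p $ r) \<in> Ideal n q" for p r
    unfolding ser_mult_nth fa_of_sum fa_of_simps
    using assms by (intro Ideal_sum Ideal_fins_left) (auto simp: fser_def)
  have "fa_of ((A * X * B) $ p $ r) \<in> Ideal n q" for p r
    unfolding ser_mult_nth[of "A * X" B] fa_of_sum fa_of_simps
    using assms AX by (intro Ideal_sum Ideal_fins_right) (auto simp: fser_def)
  then show ?thesis by (simp add: fps_eq_iff van)
qed

lemma PS_relation:
  assumes "fser A" "fser B"
    and act: "acts z1 \<zeta>1" "acts z2 \<zeta>2" "acts z3 \<zeta>3" "acts z4 \<zeta>4"
    and X: "\<And>p r. fa_of ((z1 * X1 + z2 * X2 - (z3 * X3 + z4 * X4)) $ p $ r) \<in> Ideal n q"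
  shows "\<zeta>1 * PS \<Psi> (A * X1 * B) + \<zeta>2 * PS \<Psi> (A * X2 * B)
       = \<zeta>3 * PS \<Psi> (A * X3 * B) + \<zeta>4 * PS \<Psi> (A * X4 * B)"
proof -
  have "PS \<Psi> (A * (z1 * X1 + z2 * X2 - (z3 * X3 + z4 * X4)) * B) = 0"
    by (rule PS_rel[OF assms(1,2) X])
  then show ?thesis
    using act unfolding acts_def
    by (simp add: distrib_left distrib_right left_diff_distrib right_diff_distrib PS_add PS_diff)
qed

end

section \<open>The RTT relations as identities between generating series\<close>

lemma sum_delta2:
  fixes F :: "nat \<Rightarrow> nat \<Rightarrow> 'a::comm_monoid_add"
  assumes "i \<in> I" "k \<in> I" "finite I"
  shows "(\<Sum>a\<in>I. \<Sum>b\<in>I. if a = i \<and> b = k then F a b else 0) = F i k"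
proof -
  have "(\<Sum>b\<in>I. if a = i \<and> b = k then F a b else 0) = (if a = i then F i k else 0)" for a
    using assms by (cases "a = i") (simp_all add: sum.delta)
  then show ?thesis using assms by (simp add: sum.delta)
qed

definition dA :: "complex \<Rightarrow> nat \<Rightarrow> nat \<Rightarrow> complex" where "dA q i k = (if i = k then inverse q else 1)"
definition dB :: "complex \<Rightarrow> nat \<Rightarrow> nat \<Rightarrow> complex" where "dB q i k = (if i = k then q else 1)"
definition oA :: "complex \<Rightarrow> nat \<Rightarrow> nat \<Rightarrow> complex" where "oA q i k = (if k < i then inverse q - q else 0)"

lemma Rmat_row:
  assumes I: "i \<in> I" "k \<in> I" "finite I"
  shows "(\<Sum>a\<in>I. \<Sum>b\<in>I. fscale (Rmat_A q (i, k) (a, b)) (Z a b)) = fscale (dA q i k) (Z i k) + fscale (oA q i k) (Z k i)"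
    and "(\<Sum>a\<in>I. \<Sum>b\<in>I. fscale (Rmat_B q (i, k) (a, b)) (Z a b)) = fscale (oA q k i) (Z k i) - fscale (dB q i k) (Z i k)"
    and "(\<Sum>a\<in>I. \<Sum>b\<in>I. fscale (Rmat_A q (a, b) (i, k)) (Z a b)) = fscale (dA q i k) (Z i k) + fscale (oA q k i) (Z k i)"
    and "(\<Sum>a\<in>I. \<Sum>b\<in>I. fscale (Rmat_B q (a, b) (i, k)) (Z a b)) = fscale (oA q i k) (Z k i) - fscale (dB q i k) (Z i k)"
proof -
  have fif: "fscale (if B then c else 0) f = (if B then fscale c f else 0)" for B c f
    by (cases B) (simp_all only: if_True if_False fscale_simps(6))
  have two: "(\<Sum>a\<in>I. \<Sum>b\<in>I. fscale (M a b) (Z a b)) = fscale c (Z i k) + fscale d (Z k i)"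
    if "\<And>a b. M a b = (if a = i \<and> b = k then c else 0) + (if a = k \<and> b = i then d else 0)" for M c d
  proof -
    have "fscale (M a b) (Z a b) = (if a = i \<and> b = k then fscale c (Z a b) else 0)
        + (if a = k \<and> b = i then fscale d (Z a b) else 0)" for a b
      by (simp only: that fscale_simps(2) fif)
    then show ?thesis
      by (simp only: sum.distrib sum_delta2[OF I(1,2,3), of "\<lambda>a b. fscale c (Z a b)"]
          sum_delta2[OF I(2,1,3), of "\<lambda>a b. fscale d (Z a b)"])
  qed
  have m: "fscale d (Z k i) - fscale (dB q i k) (Z i k) = fscale (- dB q i k) (Z i k) + fscale d (Z k i)" for d
    by (simp only: fscale_simps(9) uminus_add_conv_diff)
  have A1: "Rmat_A q (i, k) (a, b) = (if a = i \<and> b = k then dA q i k else 0) + (if a = k \<and> b = i then oA q i k else 0)" for a b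
    unfolding Rmat_A_def dA_def oA_def prod.case prod.inject
    by (cases "a = i"; cases "b = k"; cases "a = k"; cases "b = i"; simp)
  have B1: "Rmat_B q (i, k) (a, b) = (if a = i \<and> b = k then - dB q i k else 0) + (if a = k \<and> b = i then oA q k i else 0)" for a b
    unfolding Rmat_B_def dB_def oA_def prod.case prod.inject
    by (cases "a = i"; cases "b = k"; cases "a = k"; cases "b = i"; simp)
  have A2: "Rmat_A q (a, b) (i, k) = (if a = i \<and> b = k then dA q i k else 0) + (if a = k \<and> b = i then oA q k i else 0)" for a b
    unfolding Rmat_A_def dA_def oA_def prod.case prod.inject
    by (cases "a = i"; cases "b = k"; cases "a = k"; cases "b = i"; simp)
  have B2: "Rmat_B q (a, b) (i, k) = (if a = i \<and> b = k then - dB q i k else 0) + (if a = k \<and> b = i then oA q i k else 0)" for a b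
    unfolding Rmat_B_def dB_def oA_def prod.case prod.inject
    by (cases "a = i"; cases "b = k"; cases "a = k"; cases "b = i"; simp)
  show "(\<Sum>a\<in>I. \<Sum>b\<in>I. fscale (Rmat_A q (i, k) (a, b)) (Z a b)) = fscale (dA q i k) (Z i k) + fscale (oA q i k) (Z k i)"
    by (rule two[OF A1])
  show "(\<Sum>a\<in>I. \<Sum>b\<in>I. fscale (Rmat_B q (i, k) (a, b)) (Z a b)) = fscale (oA q k i) (Z k i) - fscale (dB q i k) (Z i k)"
    unfolding m by (rule two[OF B1])
  show "(\<Sum>a\<in>I. \<Sum>b\<in>I. fscale (Rmat_A q (a, b) (i, k)) (Z a b)) = fscale (dA q i k) (Z i k) + fscale (oA q k i) (Z k i)"
    by (rule two[OF A2])
  show "(\<Sum>a\<in>I. \<Sum>b\<in>I. fscale (Rmat_B q (a, b) (i, k)) (Z a b)) = fscale (oA q i k) (Z k i) - fscale (dB q i k) (Z i k)"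
    unfolding m by (rule two[OF B2])
qed

lemma rtt_sparse:
  assumes "{i, j, k, l} \<subseteq> {1..2*n}"
  shows "rtt n q P Q i j k l \<alpha> \<beta> =
    (fscale (dA q i k) (fmul (P i j (\<alpha> - 1)) (Q k l \<beta>)) + fscale (oA q i k) (fmul (P k j (\<alpha> - 1)) (Q i l \<beta>))
     + (fscale (oA q k i) (fmul (P k j \<alpha>) (Q i l (\<beta> - 1))) - fscale (dB q i k) (fmul (P i j \<alpha>) (Q k l (\<beta> - 1)))))
  - (fscale (dA q j l) (fmul (Q k l \<beta>) (P i j (\<alpha> - 1))) + fscale (oA q l j) (fmul (Q k j \<beta>) (P i l (\<alpha> - 1)))
     + (fscale (oA q j l) (fmul (Q k j (\<beta> - 1)) (P i l \<alpha>)) - fscale (dB q j l) (fmul (Q k l (\<beta> - 1)) (P i j \<alpha>))))"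
proof -
  have I: "i \<in> {1..2*n}" "k \<in> {1..2*n}" "j \<in> {1..2*n}" "l \<in> {1..2*n}" "finite {1..2*n}" using assms by auto
  note R = Rmat_row[OF I(1,2,5), of q] Rmat_row[OF I(3,4,5), of q]
  show ?thesis
    unfolding rtt_def sum.distrib
    by (simp only: R(1)[of "\<lambda>a b. fmul (P a j (\<alpha> - 1)) (Q b l \<beta>)"] R(2)[of "\<lambda>a b. fmul (P a j \<alpha>) (Q b l (\<beta> - 1))"]
       R(7)[of "\<lambda>a b. fmul (Q k b \<beta>) (P i a (\<alpha> - 1))"] R(8)[of "\<lambda>a b. fmul (Q k b (\<beta> - 1)) (P i a \<alpha>)"])
qed

lemma coeff_nth:
  "fa_of ((Rd (cstE q) (cstE (inverse q)) XUE XVE i k * W) $ p $ r)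
     = fscale (dA q i k) (if p = 0 then 0 else fa_of (W $ (p - 1) $ r)) - fscale (dB q i k) (if r = 0 then 0 else fa_of (W $ p $ (r - 1)))"
  "fa_of ((Rd (cstE q) (cstE (inverse q)) XVE XUE i k * W) $ p $ r)
     = fscale (dA q i k) (if r = 0 then 0 else fa_of (W $ p $ (r - 1))) - fscale (dB q i k) (if p = 0 then 0 else fa_of (W $ (p - 1) $ r))"
  "fa_of ((Td (cstE q) (cstE (inverse q)) XUE XVE i k * W) $ p $ r)
     = fscale (dA q i k) (if r = 0 then 0 else if p = 0 then 0 else fa_of (W $ (p - 1) $ (r - 1))) - fscale (dB q i k) (fa_of (W $ p $ r))"
  "fa_of ((Ro (cstE q) (cstE (inverse q)) XUE XVE i k * W) $ p $ r)
     = fscale (oA q i k) (if p = 0 then 0 else fa_of (W $ (p - 1) $ r)) + fscale (oA q k i) (if r = 0 then 0 else fa_of (W $ p $ (r - 1)))"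
  "fa_of ((Ro (cstE q) (cstE (inverse q)) XVE XUE i k * W) $ p $ r)
     = fscale (oA q i k) (if r = 0 then 0 else fa_of (W $ p $ (r - 1))) + fscale (oA q k i) (if p = 0 then 0 else fa_of (W $ (p - 1) $ r))"
  "fa_of ((To (cstE q) (cstE (inverse q)) XUE XVE i k * W) $ p $ r)
     = fscale (oA q i k) (if r = 0 then 0 else if p = 0 then 0 else fa_of (W $ (p - 1) $ (r - 1))) + fscale (oA q k i) (fa_of (W $ p $ r))"
proof -
  have c: "fa_of ((cstE c * X) $ p $ r) = fscale c (fa_of (X $ p $ r))" for c X p r
    by (simp only: ser_scalar_nth fa_of_simps)
  have u: "fa_of ((XUE * X) $ p $ r) = (if r = 0 then 0 else fa_of (X $ p $ (r - 1)))" for X p r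
    by (simp only: ser_scalar_nth fa_of_simps if_distrib[of fa_of])
  have v: "fa_of ((XVE * X) $ p $ r) = (if p = 0 then 0 else fa_of (X $ (p - 1) $ r))" for X p r
    by (simp only: ser_scalar_nth fa_of_simps if_distrib[of fa_of])
  have d: "fa_of ((X - Y) $ p $ r) = fa_of (X $ p $ r) - fa_of (Y $ p $ r)" for X Y :: ser and p r
    by (simp only: fps_sub_nth fa_of_simps)
  have z: "fa_of ((0 * X :: ser) $ p $ r) = 0" for X p r by simp
  note E = c u v d z mult.assoc left_diff_distrib mult_1_left fscale_simps(4,6,7) if_True if_False
    add_0_left add_0_right diff_zero simp_thms
  show "fa_of ((Rd (cstE q) (cstE (inverse q)) XUE XVE i k * W) $ p $ r)
     = fscale (dA q i k) (if p = 0 then 0 else fa_of (W $ (p - 1) $ r)) - fscale (dB q i k) (if r = 0 then 0 else fa_of (W $ p $ (r - 1)))"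
    by (cases "i = k") (simp_all only: Rd_def dA_def dB_def E)
  show "fa_of ((Rd (cstE q) (cstE (inverse q)) XVE XUE i k * W) $ p $ r)
     = fscale (dA q i k) (if r = 0 then 0 else fa_of (W $ p $ (r - 1))) - fscale (dB q i k) (if p = 0 then 0 else fa_of (W $ (p - 1) $ r))"
    by (cases "i = k") (simp_all only: Rd_def dA_def dB_def E)
  show "fa_of ((Td (cstE q) (cstE (inverse q)) XUE XVE i k * W) $ p $ r)
     = fscale (dA q i k) (if r = 0 then 0 else if p = 0 then 0 else fa_of (W $ (p - 1) $ (r - 1))) - fscale (dB q i k) (fa_of (W $ p $ r))"
    by (cases "i = k") (simp_all only: Td_def dA_def dB_def E)
  have cas: thesis if "k < i \<Longrightarrow> \<not> i < k \<Longrightarrow> thesis" "i < k \<Longrightarrow> \<not> k < i \<Longrightarrow> thesis"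
    "\<not> k < i \<Longrightarrow> \<not> i < k \<Longrightarrow> thesis" for thesis
    using that by (meson order.asym)
  show "fa_of ((Ro (cstE q) (cstE (inverse q)) XUE XVE i k * W) $ p $ r)
     = fscale (oA q i k) (if p = 0 then 0 else fa_of (W $ (p - 1) $ r)) + fscale (oA q k i) (if r = 0 then 0 else fa_of (W $ p $ (r - 1)))"
    by (rule cas) (simp_all only: Ro_def oA_def E)
  show "fa_of ((Ro (cstE q) (cstE (inverse q)) XVE XUE i k * W) $ p $ r)
     = fscale (oA q i k) (if r = 0 then 0 else fa_of (W $ p $ (r - 1))) + fscale (oA q k i) (if p = 0 then 0 else fa_of (W $ (p - 1) $ r))"
    by (rule cas) (simp_all only: Ro_def oA_def E)
  show "fa_of ((To (cstE q) (cstE (inverse q)) XUE XVE i k * W) $ p $ r)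
     = fscale (oA q i k) (if r = 0 then 0 else if p = 0 then 0 else fa_of (W $ (p - 1) $ (r - 1))) + fscale (oA q k i) (fa_of (W $ p $ r))"
    by (rule cas) (simp_all only: To_def oA_def E)
qed

text \<open>In the variables 1/u and 1/v: \<open>tu\<close> and \<open>tv\<close> are the unbarred
  series at u and v, \<open>bu\<close> and \<open>bv\<close> the barred series at 1/u and
  1/v.\<close>

definition tu :: "nat \<Rightarrow> nat \<Rightarrow> ser" where "tu i j = emU (\<lambda>r. Falg (gen (T i j r)))"
definition tv :: "nat \<Rightarrow> nat \<Rightarrow> ser" where "tv i j = emV (\<lambda>r. Falg (gen (T i j r)))"
definition bu :: "nat \<Rightarrow> nat \<Rightarrow> ser" where "bu i j = emU (\<lambda>r. Falg (gen (TB i j r)))"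
definition bv :: "nat \<Rightarrow> nat \<Rightarrow> ser" where "bv i j = emV (\<lambda>r. Falg (gen (TB i j r)))"

lemma fser_gens: "fser (tu i j)" "fser (tv i j)" "fser (bu i j)" "fser (bv i j)"
  unfolding tu_def tv_def bu_def bv_def gen_def by (intro fser_em fins.mono)+

lemma Rels_I:
  assumes "{i, j, k, l} \<subseteq> {1..2*n}"
  shows "rtt n q tE tE i j k l \<alpha> \<beta> \<in> Rels n q" "rtt n q tbE tbE i j k l \<alpha> \<beta> \<in> Rels n q"
    "rtt n q tbE tE i j k l \<alpha> \<beta> \<in> Rels n q"
proof -
  have "rtt n q P Q i j k l \<alpha> \<beta> \<in> {rtt n q P Q i j k l \<alpha> \<beta> | i j k l \<alpha> \<beta>. {i, j, k, l} \<subseteq> {1..2*n}}" for P Q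
    using assms by blast
  note * = this[of tE tE] this[of tbE tbE] this[of tbE tE]
  show "rtt n q tE tE i j k l \<alpha> \<beta> \<in> Rels n q" "rtt n q tbE tbE i j k l \<alpha> \<beta> \<in> Rels n q"
    "rtt n q tbE tE i j k l \<alpha> \<beta> \<in> Rels n q"
    unfolding Rels_def Un_iff using * by (simp_all only: simp_thms)
qed

text \<open>The exponent one step outside the range of a series gives 0, matching the missing
  coefficient when a series is multiplied by 1/u or 1/v. The unsimplified exponents are those that
  \<open>rtt\<close> produces.\<close>

lemma tE_nth: "tE i j (1 - int r - 1) = gen (T i j r)" "tE i j (1 - int r) = (if r = 0 then 0 else gen (T i j (r - 1)))"
  "tbE i j (int r) = gen (TB i j r)" "tbE i j (int r - 1) = (if r = 0 then 0 else gen (TB i j (r - 1)))"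
  by (simp_all add: tE_def tbE_def nat_diff_distrib' of_nat_diff)

lemma fmul_0: "fmul 0 x = 0" "fmul x 0 = 0"
  by (simp_all add: fmul_def fun_eq_iff)

lemma rel_tt:
  assumes I: "{i, j, k, l} \<subseteq> {1..2*n}"
  shows "fa_of ((Rd (cstE q) (cstE (inverse q)) XUE XVE i k * (tu i j * tv k l) + Ro (cstE q) (cstE (inverse q)) XUE XVE i k * (tu k j * tv i l)
      - (Rd (cstE q) (cstE (inverse q)) XUE XVE j l * (tv k l * tu i j) + Ro (cstE q) (cstE (inverse q)) XUE XVE l j * (tv k j * tu i l))) $ p $ r) \<in> Ideal n q"
proof -
  \<comment> \<open>The normalisation by \<open>x y\<close> shifts both exponents by one: the
    coefficient with indices \<open>r\<close>, \<open>p\<close> is that of \<open>u\<close> to the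
    power 1 - r and \<open>v\<close> to the power 1 - p.\<close>
  have "rtt n q tE tE i j k l (1 - int r) (1 - int p) \<in> Ideal n q"
    by (rule Ideal_rel[OF Rels_I(1)[OF I]])
  then show ?thesis
    unfolding rtt_sparse[OF I] fps_add_nth fps_sub_nth fa_of_simps coeff_nth tu_def tv_def bu_def bv_def em_nth tE_nth
    by (cases "r = 0"; cases "p = 0";
        simp only: if_True if_False fmul_0 fscale_simps(5) simp_thms algebra_simps)
qed

lemma rel_bb:
  assumes I: "{i, j, k, l} \<subseteq> {1..2*n}"
  shows "fa_of ((Rd (cstE q) (cstE (inverse q)) XVE XUE i k * (bu i j * bv k l) + Ro (cstE q) (cstE (inverse q)) XVE XUE i k * (bu k j * bv i l)
      - (Rd (cstE q) (cstE (inverse q)) XVE XUE j l * (bv k l * bu i j) + Ro (cstE q) (cstE (inverse q)) XVE XUE l j * (bv k j * bu i l))) $ p $ r) \<in> Ideal n q"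
proof -
  \<comment> \<open>The arguments are 1/u and 1/v themselves, so nothing is shifted; the entries of
    R are polynomial in them, with \<open>x\<close> and \<open>y\<close> in exchanged
    positions.\<close>
  have "rtt n q tbE tbE i j k l (int r) (int p) \<in> Ideal n q"
    by (rule Ideal_rel[OF Rels_I(2)[OF I]])
  then show ?thesis
    unfolding rtt_sparse[OF I] fps_add_nth fps_sub_nth fa_of_simps coeff_nth tu_def tv_def bu_def bv_def em_nth tE_nth
    by (cases "r = 0"; cases "p = 0";
        simp only: if_True if_False fmul_0 fscale_simps(5) simp_thms algebra_simps)
qed

lemma rel_bt:
  assumes I: "{i, j, k, l} \<subseteq> {1..2*n}"
  shows "fa_of ((Td (cstE q) (cstE (inverse q)) XUE XVE i k * (bu i j * tv k l) + To (cstE q) (cstE (inverse q)) XUE XVE i k * (bu k j * tv i l)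
      - (Td (cstE q) (cstE (inverse q)) XUE XVE j l * (tv k l * bu i j) + To (cstE q) (cstE (inverse q)) XUE XVE l j * (tv k j * bu i l))) $ p $ r) \<in> Ideal n q"
proof -
  have "rtt n q tbE tE i j k l (int r) (1 - int p) \<in> Ideal n q"
    by (rule Ideal_rel[OF Rels_I(3)[OF I]])
  then show ?thesis
    unfolding rtt_sparse[OF I] fps_add_nth fps_sub_nth fa_of_simps coeff_nth tu_def tv_def bu_def bv_def em_nth tE_nth
    by (cases "r = 0"; cases "p = 0";
        simp only: if_True if_False fmul_0 fscale_simps(5) simp_thms algebra_simps)
qed

text \<open>The previous relation with u and v exchanged; the coefficients stay the same since
  \<open>Td\<close> and \<open>To\<close> depend on the product of the variables only.\<close>

lemma rel_bt2:
  assumes I: "{i, j, k, l} \<subseteq> {1..2*n}"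
  shows "fa_of ((Td (cstE q) (cstE (inverse q)) XUE XVE i k * (bv i j * tu k l) + To (cstE q) (cstE (inverse q)) XUE XVE i k * (bv k j * tu i l)
      - (Td (cstE q) (cstE (inverse q)) XUE XVE j l * (tu k l * bv i j) + To (cstE q) (cstE (inverse q)) XUE XVE l j * (tu k j * bv i l))) $ p $ r) \<in> Ideal n q"
proof -
  have "rtt n q tbE tE i j k l (int p) (1 - int r) \<in> Ideal n q"
    by (rule Ideal_rel[OF Rels_I(3)[OF I]])
  then show ?thesis
    unfolding rtt_sparse[OF I] fps_add_nth fps_sub_nth fa_of_simps coeff_nth tu_def tv_def bu_def bv_def em_nth tE_nth
    by (cases "r = 0"; cases "p = 0";
        simp only: if_True if_False fmul_0 fscale_simps(5) simp_thms algebra_simps)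
qed

lemma Gm_sum:
  fixes Z :: "nat \<Rightarrow> nat \<Rightarrow> fa"
  shows "(\<Sum>c\<in>{1..2*n}. \<Sum>d\<in>{1..2*n}. fscale (Gm q c d) (Z c d))
    = fscale q (\<Sum>a\<in>{1..n}. Z (2*a - 1) (2*a)) - (\<Sum>a\<in>{1..n}. Z (2*a) (2*a - 1))"
proof -
  have one: "(\<Sum>a\<in>{1..n}. if c = 2*a - 1 \<and> d = 2*a then k else 0) = (if odd c \<and> d = Suc c then k else 0)"
    if "d \<in> {1..2*n}" for c d and k :: complex
  proof -
    have "(c = 2*a - 1 \<and> d = 2*a) \<longleftrightarrow> (a = d div 2 \<and> odd c \<and> d = Suc c)" if "a \<in> {1..n}" for a
      using that by (auto elim!: oddE)
    then have "(\<Sum>a\<in>{1..n}. if c = 2*a - 1 \<and> d = 2*a then k else 0)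
        = (\<Sum>a\<in>{1..n}. if a = d div 2 then (if odd c \<and> d = Suc c then k else 0) else 0)"
      by (intro sum.cong) auto
    also have "\<dots> = (if d div 2 \<in> {1..n} then (if odd c \<and> d = Suc c then k else 0) else 0)"
      by (simp add: sum.delta)
    also have "\<dots> = (if odd c \<and> d = Suc c then k else 0)" using that by (auto elim!: oddE)
    finally show ?thesis .
  qed
  have G: "Gm q c d = (\<Sum>a\<in>{1..n}. (if c = 2*a - 1 \<and> d = 2*a then q else 0))
      + (\<Sum>a\<in>{1..n}. (if d = 2*a - 1 \<and> c = 2*a then -1 else 0))"
    if "c \<in> {1..2*n}" "d \<in> {1..2*n}" for c d
    unfolding one[OF that(2)] one[OF that(1)] Gm_def by auto
  have fs: "fscale (\<Sum>a\<in>A. k a) f = (\<Sum>a\<in>A. fscale (k a) f)" for A :: "nat set" and k f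
    by (induction A rule: infinite_finite_induct) (simp_all add: fscale_def fun_eq_iff algebra_simps)
  have fif: "fscale (if B then c else 0) f = (if B then fscale c f else 0)" for B c f
    by (cases B) (simp_all only: if_True if_False fscale_simps(6))
  have sw: "(\<Sum>c\<in>I. \<Sum>d\<in>I. \<Sum>a\<in>J. H a c d) = (\<Sum>a\<in>J. \<Sum>c\<in>I. \<Sum>d\<in>I. H a c d)"
    for I J :: "nat set" and H :: "nat \<Rightarrow> nat \<Rightarrow> nat \<Rightarrow> fa"
    by (simp only: sum.swap[of _ J])
  have "(\<Sum>c\<in>{1..2*n}. \<Sum>d\<in>{1..2*n}. fscale (Gm q c d) (Z c d))
      = (\<Sum>c\<in>{1..2*n}. \<Sum>d\<in>{1..2*n}. \<Sum>a\<in>{1..n}. if c = 2*a - 1 \<and> d = 2*a then fscale q (Z c d) else 0)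
      + (\<Sum>c\<in>{1..2*n}. \<Sum>d\<in>{1..2*n}. \<Sum>a\<in>{1..n}. if c = 2*a \<and> d = 2*a - 1 then fscale (-1) (Z c d) else 0)"
    unfolding sum.distrib[symmetric]
  proof (intro sum.cong refl)
    fix c d assume "c \<in> {1..2*n}" "d \<in> {1..2*n}"
    then show "fscale (Gm q c d) (Z c d) = (\<Sum>a\<in>{1..n}. (if c = 2*a - 1 \<and> d = 2*a then fscale q (Z c d) else 0)
        + (if c = 2*a \<and> d = 2*a - 1 then fscale (-1) (Z c d) else 0))"
      by (simp only: G fscale_simps(2) fs fif sum.distrib conj_commute[of "c = 2 * _"])
  qed
  also have "\<dots> = (\<Sum>a\<in>{1..n}. fscale q (Z (2*a - 1) (2*a))) + (\<Sum>a\<in>{1..n}. fscale (-1) (Z (2*a) (2*a - 1)))"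
    unfolding sw
    by (intro arg_cong2[of _ _ _ _ "(+)"] sum.cong refl sum_delta2) auto
  also have "\<dots> = fscale q (\<Sum>a\<in>{1..n}. Z (2*a - 1) (2*a)) + fscale (-1) (\<Sum>a\<in>{1..n}. Z (2*a) (2*a - 1))"
    by (simp only: fscale_sum)
  finally show ?thesis by (simp only: fscale_simps(7,9) diff_conv_add_uminus)
qed

lemma s_lift_Gm:
  "s_lift n q i j r = (\<Sum>c\<in>{1..2*n}. \<Sum>d\<in>{1..2*n}. fscale (Gm q c d) (\<Sum>k\<le>r. fmul (gen (T i c k)) (gen (TB j d (r - k)))))"
  "sbar_lift n q i j r = (\<Sum>c\<in>{1..2*n}. \<Sum>d\<in>{1..2*n}. fscale (Gm q c d) (\<Sum>k\<le>r. fmul (gen (TB i c k)) (gen (T j d (r - k)))))"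
proof -
  have sw: "(\<Sum>k\<in>J. \<Sum>c\<in>I. \<Sum>d\<in>I. H k c d) = (\<Sum>c\<in>I. \<Sum>d\<in>I. \<Sum>k\<in>J. H k c d)"
    for I J :: "nat set" and H :: "nat \<Rightarrow> nat \<Rightarrow> nat \<Rightarrow> fa"
    by (simp only: sum.swap[of _ I J])
  show "s_lift n q i j r = (\<Sum>c\<in>{1..2*n}. \<Sum>d\<in>{1..2*n}. fscale (Gm q c d) (\<Sum>k\<le>r. fmul (gen (T i c k)) (gen (TB j d (r - k)))))"
    unfolding s_lift_def Gm_sum[where Z = "\<lambda>c d. fmul (gen (T i c k)) (gen (TB j d (r - k)))" for k, symmetric]
    unfolding fscale_sum sw ..
  show "sbar_lift n q i j r = (\<Sum>c\<in>{1..2*n}. \<Sum>d\<in>{1..2*n}. fscale (Gm q c d) (\<Sum>k\<le>r. fmul (gen (TB i c k)) (gen (T j d (r - k)))))"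
    unfolding sbar_lift_def Gm_sum[where Z = "\<lambda>c d. fmul (gen (TB i c k)) (gen (T j d (r - k)))" for k, symmetric]
    unfolding fscale_sum sw ..
qed

lemma em_mult: "emU c * emU d = emU (\<lambda>r. \<Sum>k\<le>r. c k * d (r - k))"
  "emV c * emV d = emV (\<lambda>r. \<Sum>k\<le>r. c k * d (r - k))"
proof -
  show "emU c * emU d = emU (\<lambda>r. \<Sum>k\<le>r. c k * d (r - k))"
    by (simp add: emU_def fps_eq_iff fps_mult_nth atLeast0AtMost)
  have "(\<Sum>i\<in>A. fps_const (F i)) = fps_const (\<Sum>i\<in>A. F i)" for A :: "nat set" and F :: "nat \<Rightarrow> falg"
    by (induction A rule: infinite_finite_induct) simp_all
  then show "emV c * emV d = emV (\<lambda>r. \<Sum>k\<le>r. c k * d (r - k))"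
    by (simp add: emV_def fps_eq_iff[where 'a = "falg fps"] fps_mult_nth atLeast0AtMost)
qed

lemma s_series:
  "emU (\<lambda>r. Falg (s_lift n q i j r)) = (\<Sum>c\<in>{1..2*n}. \<Sum>d\<in>{1..2*n}. cstE (Gm q c d) * (tu i c * bu j d))"
  "emV (\<lambda>r. Falg (s_lift n q i j r)) = (\<Sum>c\<in>{1..2*n}. \<Sum>d\<in>{1..2*n}. cstE (Gm q c d) * (tv i c * bv j d))"
proof -
  have sumU: "(\<Sum>i\<in>A. emU (F i)) = emU (\<lambda>r. \<Sum>i\<in>A. F i r)" "(\<Sum>i\<in>A. emV (F i)) = emV (\<lambda>r. \<Sum>i\<in>A. F i r)"
    for A :: "nat set" and F
    by (induction A rule: infinite_finite_induct) (simp_all add: emU_def emV_def fps_eq_iff fps_const_def)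
  have sc: "cstE z * emU c = emU (\<lambda>r. scl z (c r))" "cstE z * emV c = emV (\<lambda>r. scl z (c r))" for z c
    by (simp_all add: emU_def emV_def fps_eq_iff scl_mult)
  have e: "Falg (s_lift n q i j r) = (\<Sum>c\<in>{1..2*n}. \<Sum>d\<in>{1..2*n}. scl (Gm q c d) (\<Sum>k\<le>r. Falg (gen (T i c k)) * Falg (gen (TB j d (r - k)))))" for r
    unfolding fa_of_inject[symmetric] s_lift_Gm fa_of_sum fa_of_simps ..
  show "emU (\<lambda>r. Falg (s_lift n q i j r)) = (\<Sum>c\<in>{1..2*n}. \<Sum>d\<in>{1..2*n}. cstE (Gm q c d) * (tu i c * bu j d))"
    unfolding tu_def bu_def em_mult sc sumU e ..
  show "emV (\<lambda>r. Falg (s_lift n q i j r)) = (\<Sum>c\<in>{1..2*n}. \<Sum>d\<in>{1..2*n}. cstE (Gm q c d) * (tv i c * bv j d))"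
    unfolding tv_def bv_def em_mult sc sumU e ..
qed

lemma Gm_cst: "Gm (cst q) c d = cst (Gm q c d)"
  by (simp add: Gm_def)

context ideal_functional
begin

lemma PS_Gm_sum:
  "PS \<Psi> (A * (\<Sum>c\<in>I. \<Sum>d\<in>I. cstE (Gm q c d) * X c d) * B) = (\<Sum>c\<in>I. \<Sum>d\<in>I. cst (Gm q c d) * PS \<Psi> (A * X c d * B))"
  using acts_basic(1) by (simp add: sum_distrib_left sum_distrib_right PS_sum acts_def del: fps_const_mult)

theorem refl_eq_lifts:
  assumes q0: "q \<noteq> 0" and I: "{i, j, a, b} \<subseteq> {1..2*n}"
  shows "refl_eq (cst q) (cst (inverse q)) XU XV
    (\<lambda>i a j b. ser2 (\<lambda>r p. \<Psi> (fmul (s_lift n q i a r) (s_lift n q j b p))))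
    (\<lambda>i a j b. ser2 (\<lambda>r p. \<Psi> (fmul (s_lift n q i a p) (s_lift n q j b r)))) i j a b"
proof -
  interpret generic_params "cst q" "cst (inverse q)" XU XV by (rule generic_params_fps[OF q0])
  let ?I = "{1..2*n}"
  let ?w1 = "\<lambda>i c a d j e b f. PS \<Psi> (tu i c * (bu a d * tv j e) * bv b f)"
  let ?w2 = "\<lambda>i c a d j e b f. PS \<Psi> (tu i c * (tv j e * bu a d) * bv b f)"
  let ?w3 = "\<lambda>i c a d j e b f. PS \<Psi> ((tv j e * tu i c) * (bu a d * bv b f) * 1)"
  let ?w4 = "\<lambda>i c a d j e b f. PS \<Psi> ((tv j e * tu i c) * (bv b f * bu a d) * 1)"
  let ?w5 = "\<lambda>i c a d j e b f. PS \<Psi> (tv j e * (bv b f * tu i c) * bu a d)"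
  show ?thesis
  proof (rule refl_eq_of_words[of ?I ?w1 ?w2 ?w3 ?w4 ?w5])
    fix i c a d j e b f assume "{i, c, a, d, j, e, b, f} \<subseteq> ?I"
    then have J: "{a, d, j, e} \<subseteq> ?I" "{i, c, j, e} \<subseteq> ?I" "{a, d, b, f} \<subseteq> ?I" "{b, f, i, c} \<subseteq> ?I" by auto
    show "Td (cst q) (cst (inverse q)) XU XV a j * ?w1 i c a d j e b f + To (cst q) (cst (inverse q)) XU XV a j * ?w1 i c j d a e b f
      = Td (cst q) (cst (inverse q)) XU XV d e * ?w2 i c a d j e b f + To (cst q) (cst (inverse q)) XU XV e d * ?w2 i c a e j d b f"
      by (rule PS_relation[OF _ _ acts_coeffs(5) acts_coeffs(6) acts_coeffs(5) acts_coeffs(6) rel_bt[OF J(1)]])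
         (intro fser_gens)+
    have "Rd (cst q) (cst (inverse q)) XU XV i j * PS \<Psi> (1 * (tu i c * tv j e) * (bu a d * bv b f))
        + Ro (cst q) (cst (inverse q)) XU XV i j * PS \<Psi> (1 * (tu j c * tv i e) * (bu a d * bv b f))
      = Rd (cst q) (cst (inverse q)) XU XV c e * PS \<Psi> (1 * (tv j e * tu i c) * (bu a d * bv b f))
        + Ro (cst q) (cst (inverse q)) XU XV e c * PS \<Psi> (1 * (tv j c * tu i e) * (bu a d * bv b f))"
      by (rule PS_relation[OF _ _ acts_coeffs(1) acts_coeffs(3) acts_coeffs(1) acts_coeffs(3) rel_tt[OF J(2)]])
         (intro fser_1 fser_mult fser_gens)+
    then show "Rd (cst q) (cst (inverse q)) XU XV i j * ?w2 i c a d j e b f + Ro (cst q) (cst (inverse q)) XU XV i j * ?w2 j c a d i e b f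
      = Rd (cst q) (cst (inverse q)) XU XV c e * ?w3 i c a d j e b f + Ro (cst q) (cst (inverse q)) XU XV e c * ?w3 i e a d j c b f"
      by (simp only: mult.assoc mult_1_left mult_1_right)
    show "Rd (cst q) (cst (inverse q)) XV XU a b * ?w3 i c a d j e b f + Ro (cst q) (cst (inverse q)) XV XU a b * ?w3 i c b d j e a f
      = Rd (cst q) (cst (inverse q)) XV XU d f * ?w4 i c a d j e b f + Ro (cst q) (cst (inverse q)) XV XU f d * ?w4 i c a f j e b d"
      by (rule PS_relation[OF _ _ acts_coeffs(2) acts_coeffs(4) acts_coeffs(2) acts_coeffs(4) rel_bb[OF J(3)]])
         (intro fser_1 fser_mult fser_gens)+
    have "Td (cst q) (cst (inverse q)) XU XV b i * ?w5 i c a d j e b f + To (cst q) (cst (inverse q)) XU XV b i * ?w5 b c a d j e i f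
      = Td (cst q) (cst (inverse q)) XU XV f c * PS \<Psi> (tv j e * (tu i c * bv b f) * bu a d)
        + To (cst q) (cst (inverse q)) XU XV c f * PS \<Psi> (tv j e * (tu i f * bv b c) * bu a d)"
      by (rule PS_relation[OF _ _ acts_coeffs(5) acts_coeffs(6) acts_coeffs(5) acts_coeffs(6) rel_bt2[OF J(4)]])
         (intro fser_gens)+
    then show "Td (cst q) (cst (inverse q)) XU XV b i * ?w5 i c a d j e b f + To (cst q) (cst (inverse q)) XU XV b i * ?w5 b c a d j e i f
      = Td (cst q) (cst (inverse q)) XU XV f c * ?w4 i c a d j e b f + To (cst q) (cst (inverse q)) XU XV c f * ?w4 i f a d j e b c"
      by (simp only: mult.assoc mult_1_left mult_1_right)
  next
    show "{i, j, a, b} \<subseteq> ?I" by (rule I)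
  next
    fix i a j b
    have "ser2 (\<lambda>r p. \<Psi> (fmul (s_lift n q i a r) (s_lift n q j b p)))
        = PS \<Psi> (1 * emU (\<lambda>r. Falg (s_lift n q i a r)) * emV (\<lambda>r. Falg (s_lift n q j b r)))"
      by (simp add: fps_eq_iff em_nth)
    also have "\<dots> = (\<Sum>c\<in>?I. \<Sum>d\<in>?I. cst (Gm q c d) * PS \<Psi> (tu i c * bu a d * emV (\<lambda>r. Falg (s_lift n q j b r)) * 1))"
      unfolding s_series(1) PS_Gm_sum by (simp only: mult_1_left mult_1_right)
    also have "\<dots> = (\<Sum>c\<in>?I. \<Sum>d\<in>?I. cst (Gm q c d) * (\<Sum>e\<in>?I. \<Sum>f\<in>?I. cst (Gm q e f) * PS \<Psi> (tu i c * bu a d * (tv j e * bv b f) * 1)))"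
      unfolding s_series(2) PS_Gm_sum ..
    also have "\<dots> = sum4 ?I (\<lambda>c d e f. Gm (cst q) c d * Gm (cst q) e f * ?w1 i c a d j e b f)"
      unfolding sum4_def Gm_cst sum_distrib_left by (simp only: mult.assoc mult_1_right)
    finally show "ser2 (\<lambda>r p. \<Psi> (fmul (s_lift n q i a r) (s_lift n q j b p)))
        = sum4 ?I (\<lambda>c d e f. Gm (cst q) c d * Gm (cst q) e f * ?w1 i c a d j e b f)" .
    have "ser2 (\<lambda>r p. \<Psi> (fmul (s_lift n q j b p) (s_lift n q i a r)))
        = PS \<Psi> (emV (\<lambda>r. Falg (s_lift n q j b r)) * emU (\<lambda>r. Falg (s_lift n q i a r)) * 1)"
      by (simp add: fps_eq_iff em_nth)
    also have "\<dots> = (\<Sum>c\<in>?I. \<Sum>d\<in>?I. cst (Gm q c d) * PS \<Psi> (1 * emV (\<lambda>r. Falg (s_lift n q j b r)) * (tu i c * bu a d)))"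
      unfolding s_series(1) PS_Gm_sum by (simp only: mult_1_left mult_1_right)
    also have "\<dots> = (\<Sum>c\<in>?I. \<Sum>d\<in>?I. cst (Gm q c d) * (\<Sum>e\<in>?I. \<Sum>f\<in>?I. cst (Gm q e f) * PS \<Psi> (1 * (tv j e * bv b f) * (tu i c * bu a d))))"
      unfolding s_series(2) PS_Gm_sum ..
    also have "\<dots> = sum4 ?I (\<lambda>c d e f. Gm (cst q) c d * Gm (cst q) e f * ?w5 i c a d j e b f)"
      unfolding sum4_def Gm_cst sum_distrib_left by (simp only: mult.assoc mult_1_left)
    finally show "ser2 (\<lambda>r p. \<Psi> (fmul (s_lift n q j b p) (s_lift n q i a r)))
        = sum4 ?I (\<lambda>c d e f. Gm (cst q) c d * Gm (cst q) e f * ?w5 i c a d j e b f)" .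
  qed
qed

end

section \<open>Expressing the barred series through the unbarred one\<close>

text \<open>The form passes through R(1/u,v) up to a scalar and a transposition. This is what makes
  the barred series linearly dependent on the unbarred one.\<close>

lemma Gm_T:
  fixes q p x y :: "'a::comm_ring_1"
  assumes "q * p = 1"
  shows "Gm q d e * Td q p x y d e + Gm q e d * To q p x y d e = (p - q * (x * y)) * Gm q e d"
proof -
  have qp: "p * (q * z) = z" for z using assms by (simp add: mult.assoc[symmetric] mult.commute)
  consider "odd d \<and> e = Suc d" | "odd e \<and> d = Suc e" | "\<not> (odd d \<and> e = Suc d)" "\<not> (odd e \<and> d = Suc e)"
    by blast
  then show ?thesis
  proof cases
    case 1
    then show ?thesis by (auto simp: Gm_def Td_def To_def algebra_simps)
  next
    case 2
    then show ?thesis using assms by (auto simp: Gm_def Td_def To_def algebra_simps qp)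
  next
    case 3
    then have "Gm q d e = 0" "Gm q e d = 0" unfolding Gm_def by (simp_all only: if_False)
    then show ?thesis by simp
  qed
qed

text \<open>Substitution of v = u. Products of a barred series at 1/u and an unbarred one at v, kept
  apart while the RTT relation is applied, collapse to the coefficients of \<open>sbar_lift\<close>
  and \<open>s_lift\<close>.\<close>

definition dg :: "complex fps fps \<Rightarrow> complex fps" where
  "dg F = Abs_fps (\<lambda>r. \<Sum>k\<le>r. F $ (r - k) $ k)"

lemma dg_simps:
  "dg (F + G) = dg F + dg G" "dg (F - G) = dg F - dg G" "dg (cst c * F) = fps_const c * dg F"
  "dg (XU * F) = fps_X * dg F" "dg (XV * F) = fps_X * dg F"
proof -
  show "dg (F + G) = dg F + dg G" "dg (F - G) = dg F - dg G" "dg (cst c * F) = fps_const c * dg F"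
    by (simp_all add: dg_def fps_eq_iff sum.distrib sum_subtractf sum_distrib_left)
  show "dg (XU * F) = fps_X * dg F"
  proof (rule fps_ext)
    fix r show "dg (XU * F) $ r = (fps_X * dg F) $ r"
      by (cases r) (simp_all add: dg_def sum.atMost_Suc_shift del: sum.atMost_Suc)
  qed
  show "dg (XV * F) = fps_X * dg F"
  proof (rule fps_ext)
    fix r show "dg (XV * F) $ r = (fps_X * dg F) $ r"
      by (cases r) (auto simp: dg_def Suc_diff_le intro!: sum.cong)
  qed
qed

lemma dg_sum: "dg (\<Sum>i\<in>A. F i) = (\<Sum>i\<in>A. dg (F i))"
  by (induction A rule: infinite_finite_induct) (simp_all add: dg_simps, simp_all add: dg_def fps_eq_iff)

context ideal_functional
begin

lemma bar_relation:
  assumes q0: "q \<noteq> 0" and aj: "{a, j} \<subseteq> {1..2*n}"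
  defines "SB \<equiv> \<lambda>a j. \<Sum>d\<in>{1..2*n}. \<Sum>e\<in>{1..2*n}. cst (Gm q d e) * PS \<Psi> (bu a d * tv j e)"
    and "SS \<equiv> \<lambda>j a. \<Sum>e\<in>{1..2*n}. \<Sum>d\<in>{1..2*n}. cst (Gm q e d) * PS \<Psi> (tv j e * bu a d)"
  shows "Td (cst q) (cst (inverse q)) XU XV a j * SB a j + To (cst q) (cst (inverse q)) XU XV a j * SB j a
    = (cst (inverse q) - cst q * (XU * XV)) * SS j a"
proof -
  let ?I = "{1..2*n}" and ?q = "cst q" and ?p = "cst (inverse q)"
  have qp: "?q * ?p = 1" using q0 by simp
  let ?V = "\<lambda>e d. PS \<Psi> (tv j e * bu a d)"
  have r: "Td ?q ?p XU XV a j * PS \<Psi> (bu a d * tv j e) + To ?q ?p XU XV a j * PS \<Psi> (bu j d * tv a e)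
      = Td ?q ?p XU XV d e * ?V e d + To ?q ?p XU XV e d * ?V d e" if "d \<in> ?I" "e \<in> ?I" for d e
  proof -
    have J: "{a, d, j, e} \<subseteq> ?I" using aj that by auto
    show ?thesis
      using PS_relation[OF fser_1 fser_1 acts_coeffs(5) acts_coeffs(6) acts_coeffs(5) acts_coeffs(6) rel_bt[OF J]]
      by (simp only: mult_1_left mult_1_right)
  qed
  have "Td ?q ?p XU XV a j * SB a j + To ?q ?p XU XV a j * SB j a
      = (\<Sum>d\<in>?I. \<Sum>e\<in>?I. Gm ?q d e * (Td ?q ?p XU XV a j * PS \<Psi> (bu a d * tv j e) + To ?q ?p XU XV a j * PS \<Psi> (bu j d * tv a e)))"
    unfolding SB_def Gm_cst[symmetric] sum_distrib_left distrib_left sum.distrib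
    by (simp only: mult.left_commute)
  also have "\<dots> = (\<Sum>d\<in>?I. \<Sum>e\<in>?I. Gm ?q d e * (Td ?q ?p XU XV d e * ?V e d + To ?q ?p XU XV e d * ?V d e))"
    by (intro sum.cong refl) (simp only: r)
  also have "\<dots> = (\<Sum>d\<in>?I. \<Sum>e\<in>?I. Gm ?q d e * (Td ?q ?p XU XV d e * ?V e d))
      + (\<Sum>d\<in>?I. \<Sum>e\<in>?I. Gm ?q d e * (To ?q ?p XU XV e d * ?V d e))"
    by (simp only: distrib_left sum.distrib)
  also have "(\<Sum>d\<in>?I. \<Sum>e\<in>?I. Gm ?q d e * (To ?q ?p XU XV e d * ?V d e))
      = (\<Sum>d\<in>?I. \<Sum>e\<in>?I. Gm ?q e d * (To ?q ?p XU XV d e * ?V e d))"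
    by (rule sum.swap)
  also have "(\<Sum>d\<in>?I. \<Sum>e\<in>?I. Gm ?q d e * (Td ?q ?p XU XV d e * ?V e d)) + \<dots>
      = (\<Sum>d\<in>?I. \<Sum>e\<in>?I. (Gm ?q d e * Td ?q ?p XU XV d e + Gm ?q e d * To ?q ?p XU XV d e) * ?V e d)"
    by (simp only: distrib_right sum.distrib mult.assoc)
  also have "\<dots> = (\<Sum>d\<in>?I. \<Sum>e\<in>?I. (?p - ?q * (XU * XV)) * (Gm ?q e d * ?V e d))"
    by (simp only: Gm_T[OF qp] mult.assoc)
  also have "\<dots> = (?p - ?q * (XU * XV)) * SS j a"
    unfolding SS_def Gm_cst[symmetric] sum_distrib_left by (rule sum.swap)
  finally show ?thesis .
qed

lemma sum_image: "\<Psi> (\<Sum>i\<in>A. F i) = (\<Sum>i\<in>A. \<Psi> (F i))"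
  by (rule L.sum)

lemma dg_bar:
  "dg (\<Sum>d\<in>{1..2*n}. \<Sum>e\<in>{1..2*n}. cst (Gm q d e) * PS \<Psi> (bu a d * tv j e)) = Abs_fps (\<lambda>r. \<Psi> (sbar_lift n q a j r))"
  "dg (\<Sum>e\<in>{1..2*n}. \<Sum>d\<in>{1..2*n}. cst (Gm q e d) * PS \<Psi> (tv j e * bu a d)) = Abs_fps (\<lambda>r. \<Psi> (s_lift n q j a r))"
proof -
  have 1: "dg (PS \<Psi> (bu a d * tv j e)) $ r = (\<Sum>k\<le>r. \<Psi> (fmul (gen (TB a d k)) (gen (T j e (r - k)))))" for d e r
    by (simp add: dg_def bu_def tv_def em_nth)
  have "dg (PS \<Psi> (tv j e * bu a d)) $ r = (\<Sum>k\<le>r. \<Psi> (fmul (gen (T j e (r - k))) (gen (TB a d k))))" for d e r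
    by (simp add: dg_def bu_def tv_def em_nth)
  also have "(\<Sum>k\<le>r. \<Psi> (fmul (gen (T j e (r - k))) (gen (TB a d k))))
      = (\<Sum>k\<le>r. \<Psi> (fmul (gen (T j e k)) (gen (TB a d (r - k)))))" for d e r
    by (rule sum.reindex_bij_witness[of _ "\<lambda>k. r - k" "\<lambda>k. r - k"]) auto
  finally have 2: "dg (PS \<Psi> (tv j e * bu a d)) $ r = (\<Sum>k\<le>r. \<Psi> (fmul (gen (T j e k)) (gen (TB a d (r - k)))))" for d e r .
  show "dg (\<Sum>d\<in>{1..2*n}. \<Sum>e\<in>{1..2*n}. cst (Gm q d e) * PS \<Psi> (bu a d * tv j e)) = Abs_fps (\<lambda>r. \<Psi> (sbar_lift n q a j r))"
    unfolding fps_eq_iff dg_sum dg_simps fps_sum_nth fps_mult_left_const_nth fps_nth_Abs_fps s_lift_Gm sum_image L.scale 1 by blast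
  show "dg (\<Sum>e\<in>{1..2*n}. \<Sum>d\<in>{1..2*n}. cst (Gm q e d) * PS \<Psi> (tv j e * bu a d)) = Abs_fps (\<lambda>r. \<Psi> (s_lift n q j a r))"
    unfolding fps_eq_iff dg_sum dg_simps fps_sum_nth fps_mult_left_const_nth fps_nth_Abs_fps s_lift_Gm sum_image L.scale 2 by blast
qed

lemma bar_series:
  assumes q0: "q \<noteq> 0" and m: "m \<in> {1..n}"
  defines "B1 \<equiv> Abs_fps (\<lambda>r. \<Psi> (sbar_lift n q (2*m) (2*m - 1) r))"
    and "B2 \<equiv> Abs_fps (\<lambda>r. \<Psi> (sbar_lift n q (2*m - 1) (2*m) r))"
    and "S1 \<equiv> Abs_fps (\<lambda>r. \<Psi> (s_lift n q (2*m - 1) (2*m) r))"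
    and "S2 \<equiv> Abs_fps (\<lambda>r. \<Psi> (s_lift n q (2*m) (2*m - 1) r))"
  shows "fps_X * (fps_X * B1) - B1 + (fps_const (inverse q) * (fps_X * (fps_X * B2)) - fps_const q * (fps_X * (fps_X * B2)))
      = fps_const (inverse q) * S1 - fps_const q * (fps_X * (fps_X * S1))"
    and "fps_X * (fps_X * B2) - B2 + (fps_const (inverse q) * B1 - fps_const q * B1)
      = fps_const (inverse q) * S2 - fps_const q * (fps_X * (fps_X * S2))"
proof -
  have T: "Td (cst q) (cst (inverse q)) XU XV (2*m) (2*m - 1) = XU * XV - 1"
    "Td (cst q) (cst (inverse q)) XU XV (2*m - 1) (2*m) = XU * XV - 1"
    "To (cst q) (cst (inverse q)) XU XV (2*m) (2*m - 1) = (cst (inverse q) - cst q) * (XU * XV)"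
    "To (cst q) (cst (inverse q)) XU XV (2*m - 1) (2*m) = cst (inverse q) - cst q"
    unfolding Td_def To_def using m by (auto simp del: fps_const_sub)
  have I: "{2*m, 2*m - 1} \<subseteq> {1..2*n}" "{2*m - 1, 2*m} \<subseteq> {1..2*n}" using m by auto
  note E = left_diff_distrib mult.assoc mult_1_left dg_simps dg_bar
  show "fps_X * (fps_X * B1) - B1 + (fps_const (inverse q) * (fps_X * (fps_X * B2)) - fps_const q * (fps_X * (fps_X * B2)))
      = fps_const (inverse q) * S1 - fps_const q * (fps_X * (fps_X * S1))"
    unfolding B1_def B2_def S1_def
    using bar_relation[OF q0 I(1), THEN arg_cong[of _ _ dg]] unfolding T E .
  show "fps_X * (fps_X * B2) - B2 + (fps_const (inverse q) * B1 - fps_const q * B1)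
      = fps_const (inverse q) * S2 - fps_const q * (fps_X * (fps_X * S2))"
    unfolding B1_def B2_def S2_def
    using bar_relation[OF q0 I(2), THEN arg_cong[of _ _ dg]] unfolding T E .
qed

text \<open>The two barred series solve a linear system whose right sides come from the unbarred
  ones and whose determinant has constant term 1. A functional blind to the unbarred coefficients is
  thus blind to the barred ones.\<close>

lemma bar_vanish:
  assumes q0: "q \<noteq> 0" and m: "m \<in> {1..n}"
    and "\<And>r. \<Psi> (s_lift n q (2*m - 1) (2*m) r) = 0" "\<And>r. \<Psi> (s_lift n q (2*m) (2*m - 1) r) = 0"
  shows "\<Psi> (sbar_lift n q (2*m) (2*m - 1) r) = 0"
proof -
  define B1 where "B1 = Abs_fps (\<lambda>r. \<Psi> (sbar_lift n q (2*m) (2*m - 1) r))"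
  define B2 where "B2 = Abs_fps (\<lambda>r. \<Psi> (sbar_lift n q (2*m - 1) (2*m) r))"
  have z: "Abs_fps (\<lambda>r. 0 :: complex) = 0" by (simp add: fps_eq_iff)
  define X :: "complex fps" where "X = fps_X"
  define h where "h = fps_const (inverse q) - fps_const q"
  have 1: "(X * X - 1) * B1 + h * (X * X) * B2 = 0"
    using bar_series(1)[OF q0 m, unfolded assms(3) z, folded B1_def B2_def]
    by (simp add: X_def h_def algebra_simps del: fps_const_sub)
  have 2: "(X * X - 1) * B2 + h * B1 = 0"
    using bar_series(2)[OF q0 m, unfolded assms(4) z, folded B1_def B2_def]
    by (simp add: X_def h_def algebra_simps del: fps_const_sub)
  have "((X * X - 1) * (X * X - 1) - h * h * (X * X)) * B1 = 0" using 1 2 by algebra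
  moreover have "((X * X - 1) * (X * X - 1) - h * h * (X * X)) $ 0 = 1" by (simp add: X_def)
  then have "(X * X - 1) * (X * X - 1) - h * h * (X * X) \<noteq> 0" by (metis fps_zero_nth zero_neq_one)
  ultimately have "B1 = 0" by simp
  then show ?thesis by (simp add: B1_def fps_eq_iff)
qed

text \<open>The constant term of the first equation of \<open>bar_series\<close>: every other term
  carries the square of the variable.\<close>

lemma bar_zeroth:
  assumes q0: "q \<noteq> 0" and m: "m \<in> {1..n}"
  shows "\<Psi> (sbar_lift n q (2*m) (2*m - 1) 0) = - inverse q * \<Psi> (s_lift n q (2*m - 1) (2*m) 0)"
  using bar_series(1)[OF q0 m, THEN arg_cong[of _ _ "\<lambda>F. F $ 0"]] by simp algebra

end

section \<open>Representations\<close>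

lemma Rels_T: "1 \<le> i \<Longrightarrow> i < j \<Longrightarrow> j \<le> 2*n \<Longrightarrow> gen (T i j 0) \<in> Rels n q"
  and Rels_TB: "1 \<le> i \<Longrightarrow> i < j \<Longrightarrow> j \<le> 2*n \<Longrightarrow> gen (TB j i 0) \<in> Rels n q"
  and Rels_TI: "i \<in> {1..2*n} \<Longrightarrow> fmul (gen (TI i)) (gen (T i i 0)) - fone \<in> Rels n q"
  and Rels_TBI: "i \<in> {1..2*n} \<Longrightarrow> fmul (gen (TBI i)) (gen (TB i i 0)) - fone \<in> Rels n q"
proof -
  assume *: "1 \<le> i" "i < j" "j \<le> 2*n"
  have "gen (T i j 0) \<in> {gen (T i j 0) | i j. 1 \<le> i \<and> i < j \<and> j \<le> 2*n}" using * by blast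
  then show "gen (T i j 0) \<in> Rels n q" unfolding Rels_def Un_iff by (simp only: simp_thms)
next
  assume *: "1 \<le> i" "i < j" "j \<le> 2*n"
  have "gen (TB j i 0) \<in> {gen (TB j i 0) | i j. 1 \<le> i \<and> i < j \<and> j \<le> 2*n}" using * by blast
  then show "gen (TB j i 0) \<in> Rels n q" unfolding Rels_def Un_iff by (simp only: simp_thms)
next
  assume *: "i \<in> {1..2*n}"
  have "fmul (gen (TI i)) (gen (T i i 0)) - fone \<in> {fmul (gen (TI i)) (gen (T i i 0)) - fone | i. i \<in> {1..2*n}}"
    using * by blast
  then show "fmul (gen (TI i)) (gen (T i i 0)) - fone \<in> Rels n q" unfolding Rels_def Un_iff by (simp only: simp_thms)
next
  assume *: "i \<in> {1..2*n}"
  have "fmul (gen (TBI i)) (gen (TB i i 0)) - fone \<in> {fmul (gen (TBI i)) (gen (TB i i 0)) - fone | i. i \<in> {1..2*n}}"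
    using * by blast
  then show "fmul (gen (TBI i)) (gen (TB i i 0)) - fone \<in> Rels n q" unfolding Rels_def Un_iff by (simp only: simp_thms)
qed

lemma T_TB_Ideal:
  assumes "{i, c, j, d} \<subseteq> {1..2*n}" "i < c \<or> d < j"
  shows "fmul (gen (T i c 0)) (gen (TB j d 0)) \<in> Ideal n q"
  using assms(2)
proof
  assume "i < c"
  then have "gen (T i c 0) \<in> Ideal n q" using assms(1) by (intro Ideal_rel Rels_T) auto
  then show ?thesis unfolding gen_def[of "TB j d 0"] by (rule Ideal_mono_right)
next
  assume "d < j"
  then have "gen (TB j d 0) \<in> Ideal n q" using assms(1) by (intro Ideal_rel Rels_TB) auto
  then show ?thesis unfolding gen_def[of "T i c 0"] by (rule Ideal_mono_left)
qed

lemma s_lift_low: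
  assumes m: "1 \<le> m" "m \<le> n" and j: "1 \<le> j" "j < 2*m - 1"
  shows "s_lift n q j (2*m) 0 \<in> Ideal n q"
proof -
  have "fmul (gen (T j (2*a - 1) 0)) (gen (TB (2*m) (2*a) 0)) \<in> Ideal n q"
    "fmul (gen (T j (2*a) 0)) (gen (TB (2*m) (2*a - 1) 0)) \<in> Ideal n q" if "a \<in> {1..n}" for a
    using that m j by (auto intro!: T_TB_Ideal)
  then show ?thesis
    unfolding s_lift_def by (auto intro!: Ideal_sum Ideal_diff Ideal.scale)
qed

text \<open>At zeroth order \<open>T\<close> with row \<open>2*m - 1\<close> needs a column at most
  \<open>2*m - 1\<close>, and \<open>TB\<close> with row \<open>2*m\<close> a column at least
  \<open>2*m\<close>. Among the pairs of columns 2a-1, 2a, in either order, only one satisfies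
  both.\<close>

lemma s_lift_diag:
  assumes m: "1 \<le> m" "m \<le> n"
  shows "s_lift n q (2*m - 1) (2*m) 0 - fscale q (fmul (gen (T (2*m - 1) (2*m - 1) 0)) (gen (TB (2*m) (2*m) 0))) \<in> Ideal n q"
proof -
  let ?X = "\<lambda>a. fmul (gen (T (2*m - 1) (2*a - 1) 0)) (gen (TB (2*m) (2*a) 0))"
  let ?Y = "\<lambda>a. fmul (gen (T (2*m - 1) (2*a) 0)) (gen (TB (2*m) (2*a - 1) 0))"
  have mi: "m \<in> {1..n}" using m by simp
  have X: "?X a \<in> Ideal n q" if "a \<in> {1..n} - {m}" for a
    using that m by (intro T_TB_Ideal) auto
  have Y: "?Y a \<in> Ideal n q" if "a \<in> {1..n}" for a
    using that m by (intro T_TB_Ideal) auto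
  have "s_lift n q (2*m - 1) (2*m) 0 = fscale q (\<Sum>a\<in>{1..n}. ?X a) - (\<Sum>a\<in>{1..n}. ?Y a)"
    unfolding s_lift_def by (simp only: atMost_0 sum.insert finite.emptyI empty_iff simp_thms sum.empty add_0_right diff_zero)
  also have "(\<Sum>a\<in>{1..n}. ?X a) = ?X m + (\<Sum>a\<in>{1..n} - {m}. ?X a)"
    by (rule sum.remove[OF _ mi]) simp
  finally have "s_lift n q (2*m - 1) (2*m) 0 - fscale q (?X m) = fscale q (\<Sum>a\<in>{1..n} - {m}. ?X a) - (\<Sum>a\<in>{1..n}. ?Y a)"
    by (simp only: fscale_simps(1) algebra_simps)
  moreover have "fscale q (\<Sum>a\<in>{1..n} - {m}. ?X a) - (\<Sum>a\<in>{1..n}. ?Y a) \<in> Ideal n q"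
    by (intro Ideal_diff Ideal.scale Ideal_sum X Y)
  ultimately show ?thesis by (simp only:)
qed

lemma sinv_inverse:
  assumes q0: "q \<noteq> 0" and m: "1 \<le> m" "m \<le> n"
  shows "fmul (sinv q (2*m - 1)) (s_lift n q (2*m - 1) (2*m) 0) - fone \<in> Ideal n q"
proof -
  let ?P = "2*m - 1" and ?M = "2*m"
  have M: "2*m - 1 + 1 = 2*m" using m by simp
  have 1: "fmul (sinv q ?P) (s_lift n q ?P ?M 0 - fscale q (fmul (gen (T ?P ?P 0)) (gen (TB ?M ?M 0)))) \<in> Ideal n q"
    unfolding sinv_def fmul_scale_left by (intro Ideal.scale Ideal_mono_left s_lift_diag m)
  \<comment> \<open>The inner pair \<open>TI\<close>, \<open>T\<close> is cancelled first, inside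
    the word; the outer pair \<open>TBI\<close>, \<open>TB\<close> then becomes adjacent.\<close>
  have "fmul (fmul (mono [TBI ?M]) (fmul (gen (TI ?P)) (gen (T ?P ?P 0)) - fone)) (mono [TB ?M ?M 0]) \<in> Ideal n q"
    using m by (intro Ideal.rel Rels_TI) auto
  moreover have "fmul (gen (TBI ?M)) (gen (TB ?M ?M 0)) - fone \<in> Ideal n q"
    using m by (intro Ideal_rel Rels_TBI) auto
  ultimately have 2: "fmul (fmul (mono [TBI ?M]) (fmul (gen (TI ?P)) (gen (T ?P ?P 0)) - fone)) (mono [TB ?M ?M 0])
      + (fmul (gen (TBI ?M)) (gen (TB ?M ?M 0)) - fone) \<in> Ideal n q"
    by (rule Ideal.add)
  have dl: "fmul (f - g) k = fmul f k - fmul g k" "fmul k (f - g) = fmul k f - fmul k g" for f g k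
    by (simp_all add: fmul_def fun_eq_iff algebra_simps sum_subtractf)
  have A: "fmul (fmul (mono [TBI ?M]) (fmul (gen (TI ?P)) (gen (T ?P ?P 0)) - fone)) (mono [TB ?M ?M 0])
      + (fmul (gen (TBI ?M)) (gen (TB ?M ?M 0)) - fone) = mono [TBI ?M, TI ?P, T ?P ?P 0, TB ?M ?M 0] - fone"
    unfolding dl gen_def fmul_mono fmul_one_right by simp
  have B: "fmul (sinv q ?P) (fscale q (fmul (gen (T ?P ?P 0)) (gen (TB ?M ?M 0)))) = mono [TBI ?M, TI ?P, T ?P ?P 0, TB ?M ?M 0]"
    unfolding sinv_def M fmul_scale_left fmul_scale_right gen_def fmul_mono fscale_simps(8) using q0 by (simp add: fscale_simps(7))
  have "fmul (sinv q ?P) (s_lift n q ?P ?M 0) - fone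
      = fmul (sinv q ?P) (s_lift n q ?P ?M 0 - fscale q (fmul (gen (T ?P ?P 0)) (gen (TB ?M ?M 0))))
       + (fmul (fmul (mono [TBI ?M]) (fmul (gen (TI ?P)) (gen (T ?P ?P 0)) - fone)) (mono [TB ?M ?M 0])
      + (fmul (gen (TBI ?M)) (gen (TB ?M ?M 0)) - fone))"
    unfolding A unfolding dl(2) B by simp
  then show ?thesis using Ideal.add[OF 1 2] by (simp only:)
qed

lemma subspace_Ideal: "module.subspace fscale (Ideal n q)"
proof -
  interpret vector_space fscale by (rule vector_space_fscale)
  show ?thesis by (rule subspaceI) (auto intro: Ideal.intros)
qed

lemma Ysub_zero: "0 \<in> Ysub n q"
  using Ysub.scale[OF Ysub.one, of 0 n q] by (simp only: fscale_simps(6))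

lemma subspace_Ysub: "module.subspace fscale (Ysub n q)"
proof -
  interpret vector_space fscale by (rule vector_space_fscale)
  show ?thesis by (rule subspaceI) (auto intro: Ysub.intros Ysub_zero)
qed

text \<open>Exchange of the two variables, which turns the reflection equation in u, v into the one
  in v, u required by \<open>refl_ops\<close>.\<close>

definition swp :: "complex fps fps \<Rightarrow> complex fps fps" where
  "swp F = Abs_fps (\<lambda>p. Abs_fps (\<lambda>r. F $ r $ p))"

lemma swp_simps:
  "swp (F + G) = swp F + swp G" "swp (F - G) = swp F - swp G" "swp (F * G) = swp F * swp G"
  "swp XU = XV" "swp XV = XU" "swp (cst c) = cst c" "swp 0 = 0" "swp 1 = 1"
proof -
  show "swp (F + G) = swp F + swp G" "swp (F - G) = swp F - swp G" "swp 0 = 0" by (simp_all add: swp_def fps_eq_iff)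
  show "swp XU = XV" "swp XV = XU" "swp (cst c) = cst c" "swp 1 = 1" by (auto simp: swp_def fps_eq_iff fps_X_def)
  show "swp (F * G) = swp F * swp G"
    by (simp add: swp_def fps_eq_iff fps_mult_nth fps_sum_nth) (intro allI sum.swap)
qed

lemma swp_ser2: "swp (ser2 h) = ser2 (\<lambda>r p. h p r)"
  by (simp add: swp_def fps_eq_iff)

lemma refl_eq_swp:
  assumes "refl_eq (cst q) (cst p) XU XV f g i j a b"
  shows "refl_eq (cst q) (cst p) XV XU (\<lambda>i a j b. swp (f i a j b)) (\<lambda>i a j b. swp (g i a j b)) i j a b"
proof -
  have "swp (Rd (cst q) (cst p) XU XV i j) = Rd (cst q) (cst p) XV XU i j"
    "swp (Ro (cst q) (cst p) XU XV i j) = Ro (cst q) (cst p) XV XU i j"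
    "swp (Td (cst q) (cst p) XU XV i j) = Td (cst q) (cst p) XV XU i j"
    "swp (To (cst q) (cst p) XU XV i j) = To (cst q) (cst p) XV XU i j" for i j
    by (simp_all only: Rd_def Ro_def Td_def To_def if_distrib[of swp] swp_simps)
  then show ?thesis
    using assms[unfolded refl_eq_def, THEN arg_cong[of _ _ swp]] by (simp only: refl_eq_def swp_simps)
qed

lemma refl_eq_cong:
  assumes "refl_eq q p x y f g i j a b" and I: "{i, j, a, b} \<subseteq> I"
    and "\<And>i a j b. {i, a, j, b} \<subseteq> I \<Longrightarrow> f i a j b = f' i a j b" "\<And>i a j b. {i, a, j, b} \<subseteq> I \<Longrightarrow> g i a j b = g' i a j b"
  shows "refl_eq q p x y f' g' i j a b"
  using assms(1) I unfolding refl_eq_def by (simp add: assms(3,4))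

section \<open>Highest vectors of a representation\<close>

locale Y_rep =
  fixes n :: nat and q :: complex and \<rho> :: "fa \<Rightarrow> complex ^ 'd ^ 'd"
  assumes q0: "q \<noteq> 0" and not_root: "\<And>k::nat. k > 0 \<Longrightarrow> q ^ k \<noteq> 1" and rep: "is_rep n q \<rho>"
begin

lemma rho_one: "\<rho> fone = mat 1"
  and rho_add: "x \<in> Ysub n q \<Longrightarrow> y \<in> Ysub n q \<Longrightarrow> \<rho> (x + y) = \<rho> x + \<rho> y"
  and rho_scale: "x \<in> Ysub n q \<Longrightarrow> \<rho> (fscale c x) = mat c ** \<rho> x"
  and rho_mul: "x \<in> Ysub n q \<Longrightarrow> y \<in> Ysub n q \<Longrightarrow> \<rho> (fmul x y) = \<rho> x ** \<rho> y"
  and rho_Ideal: "x \<in> Ysub n q \<Longrightarrow> x \<in> Ideal n q \<Longrightarrow> \<rho> x = 0"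
  using rep unfolding is_rep_def by blast+

lemma mat_mult_vec: "(mat c ** A) *v w = c *s (A *v w)" for A :: "complex ^ 'd ^ 'd"
proof -
  have "mat c *v u = c *s u" for u :: "complex ^ 'd"
    by (simp add: vec_eq_iff matrix_vector_mult_def mat_def if_distrib[of "\<lambda>x. x * _"] sum.delta cong: if_cong)
  then show ?thesis by (simp add: matrix_vector_mul_assoc[symmetric])
qed

lemma rho_cong:
  assumes "x \<in> Ysub n q" "y \<in> Ysub n q" "x - y \<in> Ideal n q"
  shows "\<rho> x *v w = \<rho> y *v w"
proof -
  have e: "x - y = x + fscale (-1) y" by (simp add: fscale_def fun_eq_iff)
  have y': "fscale (-1) y \<in> Ysub n q" using assms Ysub.scale by blast
  have "\<rho> (x + fscale (-1) y) = 0"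
    using assms y' Ysub.add rho_Ideal unfolding e by blast
  then have "\<rho> x + mat (-1) ** \<rho> y = 0" using rho_add[OF assms(1) y'] rho_scale[OF assms(2)] by simp
  then have "(\<rho> x + mat (-1) ** \<rho> y) *v w = 0" by simp
  then show ?thesis by (simp add: matrix_vector_mult_add_rdistrib mat_mult_vec)
qed

lemma functional:
  assumes lin: "Vector_Spaces.linear (*s) (*) \<psi>"
  obtains \<Psi> where "ideal_functional n q \<Psi>" "\<And>y. y \<in> Ysub n q \<Longrightarrow> \<Psi> y = \<psi> (\<rho> y *v w)"
proof -
  interpret L: Vector_Spaces.linear "(*s)" "(*)" \<psi> by (rule lin)
  obtain \<Psi> where "Vector_Spaces.linear fscale (*) \<Psi>" "\<And>x. x \<in> Ideal n q \<Longrightarrow> \<Psi> x = 0"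
    "\<And>y. y \<in> Ysub n q \<Longrightarrow> \<Psi> y = \<psi> (\<rho> y *v w)"
  proof (rule linear_functional_extension[OF vector_space_fscale subspace_Ideal subspace_Ysub])
    fix x y assume "x \<in> Ysub n q" "y \<in> Ysub n q"
    then show "\<psi> (\<rho> (x + y) *v w) = \<psi> (\<rho> x *v w) + \<psi> (\<rho> y *v w)"
      by (simp only: rho_add matrix_vector_mult_add_rdistrib L.add)
  next
    fix c x assume "x \<in> Ysub n q"
    then show "\<psi> (\<rho> (fscale c x) *v w) = c * \<psi> (\<rho> x *v w)"
      by (simp only: rho_scale mat_mult_vec L.scale)
  next
    fix x assume "x \<in> Ideal n q" "x \<in> Ysub n q"
    then show "\<psi> (\<rho> x *v w) = 0" by (simp add: rho_Ideal L.zero)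
  qed blast
  then show ?thesis by (intro that[of \<Psi>] ideal_functional.intro)
qed

definition sop :: "nat \<Rightarrow> nat \<Rightarrow> nat \<Rightarrow> complex ^ 'd ^ 'd" where "sop i j r = \<rho> (s_lift n q i j r)"

lemma refl_sop:
  assumes lin: "Vector_Spaces.linear (*s) (*) \<psi>" and I: "{i, j, a, b} \<subseteq> {1..2*n}"
  shows "refl_eq (cst q) (cst (inverse q)) XU XV
        (\<lambda>i a j b. ser2 (\<lambda>r p. \<psi> (sop i a r *v (sop j b p *v w))))
        (\<lambda>i a j b. ser2 (\<lambda>r p. \<psi> (sop i a p *v (sop j b r *v w)))) i j a b"
proof -
  obtain \<Psi> where f: "ideal_functional n q \<Psi>" and \<Psi>: "\<And>y. y \<in> Ysub n q \<Longrightarrow> \<Psi> y = \<psi> (\<rho> y *v w)"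
    using functional[OF lin] by metis
  have P: "\<Psi> (fmul (s_lift n q i a r) (s_lift n q j b p)) = \<psi> (sop i a r *v (sop j b p *v w))"
    if "{i, a, j, b} \<subseteq> {1..2*n}" for i a j b r p
  proof -
    have "s_lift n q i a r \<in> Ysub n q" "s_lift n q j b p \<in> Ysub n q" using that by (auto intro: Ysub.s)
    then show ?thesis by (simp add: \<Psi> Ysub.mul rho_mul sop_def matrix_vector_mul_assoc)
  qed
  show ?thesis
    by (rule refl_eq_cong[OF ideal_functional.refl_eq_lifts[OF f q0 I] I]) (simp_all add: P)
qed

lemma sinv_sop:
  assumes m: "1 \<le> m" "m \<le> n"
  shows "\<rho> (sinv q (2*m - 1)) ** sop (2*m - 1) (2*m) 0 = mat 1"
proof -
  have Y: "sinv q (2*m - 1) \<in> Ysub n q" "s_lift n q (2*m - 1) (2*m) 0 \<in> Ysub n q"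
    using m by (auto intro!: Ysub.inv Ysub.s)
  have "(\<rho> (sinv q (2*m - 1)) ** sop (2*m - 1) (2*m) 0) *v w = mat 1 *v w" for w
    using rho_cong[OF Ysub.mul[OF Y] Ysub.one sinv_inverse[OF q0 m], of w]
    by (simp only: rho_mul[OF Y] rho_one sop_def)
  then show ?thesis by (metis matrix_eq)
qed

sublocale refl_ops q n sop
proof
  fix \<psi> :: "complex ^ 'd \<Rightarrow> complex" and w i j a b
  assume *: "Vector_Spaces.linear (*s) (*) \<psi>" "{i, j, a, b} \<subseteq> {1..2*n}"
  show "refl_eq (cst q) (cst (inverse q)) XU XV
        (\<lambda>i a j b. ser2 (\<lambda>r p. \<psi> (sop i a r *v (sop j b p *v w))))
        (\<lambda>i a j b. ser2 (\<lambda>r p. \<psi> (sop i a p *v (sop j b r *v w)))) i j a b"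
    by (rule refl_sop[OF *])
  from refl_eq_swp[OF this] show "refl_eq (cst q) (cst (inverse q)) XV XU
        (\<lambda>i a j b. ser2 (\<lambda>r p. \<psi> (sop i a p *v (sop j b r *v w))))
        (\<lambda>i a j b. ser2 (\<lambda>r p. \<psi> (sop i a r *v (sop j b p *v w)))) i j a b"
    by (simp only: swp_ser2)
next
  fix j m assume *: "1 \<le> m" "m \<le> n" "1 \<le> j" "j < 2*m - 1"
  then have "s_lift n q j (2*m) 0 \<in> Ysub n q" by (intro Ysub.s) auto
  then show "sop j (2*m) 0 = 0" unfolding sop_def using s_lift_low[OF *] by (intro rho_Ideal)
next
  fix m assume "1 \<le> m" "m \<le> n"
  then show "\<exists>l. l ** sop (2*m - 1) (2*m) 0 = mat 1" using sinv_sop by blast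
qed (use q0 not_root in auto)

lemma Ysub_invariant:
  assumes W: "vec.subspace W" "inv_level n W" and x: "x \<in> Ysub n q"
  shows "w \<in> W \<Longrightarrow> \<rho> x *v w \<in> W"
  using x
proof (induction arbitrary: w rule: Ysub.induct)
  case one
  then show ?case by (simp add: rho_one)
next
  case (s i j r)
  then show ?case using W(2) unfolding inv_level_def sop_def by blast
next
  case (inv i)
  then obtain k where "i = 2 * k + 1" by (auto elim: oddE)
  then have i: "i = 2 * Suc k - 1" and m: "1 \<le> Suc k" "Suc k \<le> n" using inv by auto
  have ind: "2 * Suc k - 1 \<in> {1..2*n}" "2 * Suc k \<in> {1..2*n}" using m by auto
  show ?case unfolding i
    by (rule invertible_preserves_subspace[OF W(1) _ sinv_sop[OF m] inv.prems])
       (use W(2) ind in \<open>auto simp: inv_level_def\<close>)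
next
  case (add x y)
  then show ?case using W(1) by (simp only: rho_add matrix_vector_mult_add_rdistrib vec.subspace_add)
next
  case (mul x y)
  then show ?case by (simp add: rho_mul matrix_vector_mul_assoc[symmetric])
next
  case (scale x c)
  then show ?case using W(1) by (simp only: rho_scale mat_mult_vec vec.subspace_scale)
qed

text \<open>A functional that vanishes on the line of \<open>\<xi>\<close> kills the images of
  \<open>\<xi>\<close> under all coefficients of the two unbarred series; by
  \<open>bar_vanish\<close> it also kills the image under any lift of the barred coefficient, which
  therefore lies on the line.\<close>

lemma bar_eigen:
  assumes m: "m \<in> {1..n}"
    and ev: "\<And>r. \<exists>c. sop (2*m - 1) (2*m) r *v \<xi> = c *s \<xi>" "\<And>r. \<exists>c. sop (2*m) (2*m - 1) r *v \<xi> = c *s \<xi>"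
    and y: "y \<in> Ysub n q" "y - sbar_lift n q (2*m) (2*m - 1) r \<in> Ideal n q"
  shows "\<exists>c. \<rho> y *v \<xi> = c *s \<xi>"
proof -
  have "\<rho> y *v \<xi> \<in> vec.span {\<xi>}"
  proof (rule mem_subspace_if_functionals)
    show "vec.subspace (vec.span {\<xi>})" by (rule vec.subspace_span)
    fix \<psi> :: "complex ^ 'd \<Rightarrow> complex"
    assume lin: "Vector_Spaces.linear (*s) (*) \<psi>" and van: "\<And>w. w \<in> vec.span {\<xi>} \<Longrightarrow> \<psi> w = 0"
    interpret L: Vector_Spaces.linear "(*s)" "(*)" \<psi> by (rule lin)
    obtain \<Psi> where f: "ideal_functional n q \<Psi>" and \<Psi>: "\<And>y. y \<in> Ysub n q \<Longrightarrow> \<Psi> y = \<psi> (\<rho> y *v \<xi>)"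
      using functional[OF lin] by metis
    interpret F: ideal_functional n q \<Psi> by (rule f)
    have xi: "\<psi> (c *s \<xi>) = 0" for c by (rule van) (simp add: vec.span_base vec.span_scale)
    have ix: "2*m - 1 \<in> {1..2*n}" "2*m \<in> {1..2*n}" using m by auto
    have "\<Psi> (s_lift n q (2*m - 1) (2*m) r) = 0" for r
      using ev(1)[of r] xi Ysub.s[OF ix] by (auto simp: \<Psi> sop_def)
    moreover have "\<Psi> (s_lift n q (2*m) (2*m - 1) r) = 0" for r
      using ev(2)[of r] xi Ysub.s[OF ix(2,1)] by (auto simp: \<Psi> sop_def)
    ultimately have "\<Psi> (sbar_lift n q (2*m) (2*m - 1) r) = 0" by (rule F.bar_vanish[OF q0 m])
    moreover have "\<Psi> (y - sbar_lift n q (2*m) (2*m - 1) r) = 0" by (rule F.van[OF y(2)])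
    ultimately have "\<Psi> y = 0" by (simp add: F.L.diff)
    then show "\<psi> (\<rho> y *v \<xi>) = 0" using \<Psi>[OF y(1)] by simp
  qed
  then show ?thesis by (auto simp: vec.span_singleton)
qed

text \<open>Provides an explicit element of \<open>Ysub\<close> that represents the zeroth barred
  coefficient. Membership in the ideal is tested by functionals, for which it is
  \<open>bar_zeroth\<close>.\<close>

lemma bar_zeroth_mem:
  assumes m: "m \<in> {1..n}"
  shows "fscale (- inverse q) (s_lift n q (2*m - 1) (2*m) 0) - sbar_lift n q (2*m) (2*m - 1) 0 \<in> Ideal n q"
proof (rule mem_subspace_if_all_functionals[OF vector_space_fscale subspace_Ideal])
  fix \<Psi> :: "fa \<Rightarrow> complex" assume "Vector_Spaces.linear fscale (*) \<Psi>" "\<And>w. w \<in> Ideal n q \<Longrightarrow> \<Psi> w = 0"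
  then interpret F: ideal_functional n q \<Psi> by (rule ideal_functional.intro)
  show "\<Psi> (fscale (- inverse q) (s_lift n q (2*m - 1) (2*m) 0) - sbar_lift n q (2*m) (2*m - 1) 0) = 0"
    by (simp only: F.L.diff F.L.scale F.bar_zeroth[OF q0 m] diff_self)
qed

text \<open>The eigenvalue condition for the barred series, applied to the lift from
  \<open>bar_zeroth_mem\<close>, is an eigenvalue condition for the zeroth
  \<open>sop (2*m - 1) (2*m)\<close>.\<close>

lemma highest_singular:
  assumes "is_highest_vector n q \<rho> \<xi>"
  shows "singular \<xi>"
  unfolding singular_def
proof (intro conjI ballI impI allI)
  show "\<xi> \<noteq> 0" using assms by (simp add: is_highest_vector_def)
  fix k l r assume "k \<in> {1..2*n}" "l \<in> {1..2*n}" "0 < vsig k + vsig l"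
  then show "sop k l r *v \<xi> = 0" using assms unfolding is_highest_vector_def sop_def by blast
next
  fix m assume m: "m \<in> {1..n}"
  then obtain \<mu> :: "nat \<Rightarrow> complex" where \<mu>: "\<And>r y. y \<in> Ysub n q \<Longrightarrow> y - sbar_lift n q (2*m) (2*m - 1) r \<in> Ideal n q \<Longrightarrow> \<rho> y *v \<xi> = \<mu> r *s \<xi>"
    using assms unfolding is_highest_vector_def by metis
  have Y: "s_lift n q (2*m - 1) (2*m) 0 \<in> Ysub n q" using m by (intro Ysub.s) auto
  have "\<rho> (fscale (- inverse q) (s_lift n q (2*m - 1) (2*m) 0)) *v \<xi> = \<mu> 0 *s \<xi>"
    by (rule \<mu>[OF Ysub.scale[OF Y] bar_zeroth_mem[OF m]])
  then have "(- inverse q) *s (sop (2*m - 1) (2*m) 0 *v \<xi>) = \<mu> 0 *s \<xi>"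
    by (simp only: rho_scale[OF Y] mat_mult_vec sop_def)
  then have "(- q) *s ((- inverse q) *s (sop (2*m - 1) (2*m) 0 *v \<xi>)) = (- q) *s (\<mu> 0 *s \<xi>)" by (simp only:)
  then have "sop (2*m - 1) (2*m) 0 *v \<xi> = (- q * \<mu> 0) *s \<xi>" using q0 by simp
  then show "\<exists>c. sop (2*m - 1) (2*m) 0 *v \<xi> = c *s \<xi>" by blast
qed

lemma irreducible_level:
  assumes "is_irreducible n q \<rho>"
  shows "irr_level n UNIV"
proof -
  have "(UNIV :: (complex ^ 'd) set) \<noteq> {0}"
  proof
    assume "(UNIV :: (complex ^ 'd) set) = {0}"
    \<comment> \<open>An index type is inhabited, so there is a coordinate vector, and the
      representation space is nonzero.\<close>
    then have "axis undefined 1 = (0 :: complex ^ 'd)" by blast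
    then show False by (simp add: axis_eq_0_iff)
  qed
  moreover have "W = {0} \<or> W = UNIV" if W: "vec.subspace W" "inv_level n W" for W
    using assms Ysub_invariant[OF W] W(1) unfolding is_irreducible_def csubspace_iff by blast
  ultimately show ?thesis unfolding irr_level_def by (auto simp: inv_level_def)
qed

lemma cyclic:
  assumes irr: "is_irreducible n q \<rho>" and xi: "\<xi> \<noteq> 0"
  shows "{\<rho> x *v \<xi> | x. x \<in> Ysub n q} = UNIV"
proof -
  let ?W = "{\<rho> x *v \<xi> | x. x \<in> Ysub n q}"
  have one: "\<xi> \<in> ?W" using Ysub.one rho_one by (auto intro!: exI[of _ fone])
  have "csubspace ?W"
    unfolding csubspace_def
  proof (intro conjI ballI allI)
    have "\<rho> 0 = 0" by (rule rho_Ideal[OF Ysub_zero Ideal.zero])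
    then show "0 \<in> ?W" using Ysub_zero[of n q] by (metis (mono_tags, lifting) matrix_vector_mult_0 mem_Collect_eq)
    fix u v assume "u \<in> ?W" "v \<in> ?W"
    then obtain x y where "u = \<rho> x *v \<xi>" "v = \<rho> y *v \<xi>" "x \<in> Ysub n q" "y \<in> Ysub n q" by blast
    moreover from this have "u + v = \<rho> (x + y) *v \<xi>" by (simp only: rho_add matrix_vector_mult_add_rdistrib)
    ultimately show "u + v \<in> ?W" using Ysub.add by blast
  next
    fix c u assume "u \<in> ?W"
    then obtain x where "u = \<rho> x *v \<xi>" "x \<in> Ysub n q" by blast
    moreover from this have "c *s u = \<rho> (fscale c x) *v \<xi>" by (simp only: rho_scale mat_mult_vec)
    ultimately show "c *s u \<in> ?W" using Ysub.scale by blast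
  qed
  moreover have "\<rho> x *v v \<in> ?W" if x: "x \<in> Ysub n q" and v: "v \<in> ?W" for x v
  proof -
    obtain y where "v = \<rho> y *v \<xi>" "y \<in> Ysub n q" using v by blast
    moreover from this have "\<rho> x *v v = \<rho> (fmul x y) *v \<xi>"
      using x by (simp only: rho_mul matrix_vector_mul_assoc)
    ultimately show ?thesis using x Ysub.mul by blast
  qed
  ultimately have "?W = {0} \<or> ?W = UNIV" using irr unfolding is_irreducible_def by blast
  then show ?thesis using one xi by blast
qed

theorem exists_unique_highest:
  assumes irr: "is_irreducible n q \<rho>"
  obtains \<xi> where "is_highest_vector n q \<rho> \<xi>" "\<And>\<xi>'. is_highest_vector n q \<rho> \<xi>' \<Longrightarrow> \<exists>c. \<xi>' = c *s \<xi>"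
proof -
  obtain \<xi> where xi: "\<xi> \<noteq> 0"
    "\<And>k l r. k \<in> {1..2*n} \<Longrightarrow> l \<in> {1..2*n} \<Longrightarrow> 0 < vsig k + vsig l \<Longrightarrow> sop k l r *v \<xi> = 0"
    and ev: "\<And>i r. i \<in> {1..n} \<Longrightarrow> \<exists>c. sop (2*i - 1) (2*i) r *v \<xi> = c *s \<xi>"
    "\<And>i r. i \<in> {1..n} \<Longrightarrow> \<exists>c. sop (2*i) (2*i - 1) r *v \<xi> = c *s \<xi>"
    and uniq: "\<And>v. singular v \<Longrightarrow> \<exists>c. v = c *s \<xi>"
    using highest_line[OF irreducible_level[OF irr]] by metis
  have "is_highest_vector n q \<rho> \<xi>"
    unfolding is_highest_vector_def
  proof (intro conjI ballI impI allI)
    show "\<xi> \<noteq> 0" by fact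
    show "{\<rho> x *v \<xi> | x. x \<in> Ysub n q} = UNIV" by (rule cyclic[OF irr xi(1)])
  next
    fix k l r assume "k \<in> {1..2*n}" "l \<in> {1..2*n}" "vsig k + vsig l > 0"
    then show "\<rho> (s_lift n q k l r) *v \<xi> = 0" using xi(2) by (simp add: sop_def)
  next
    fix i assume "i \<in> {1..n}"
    then show "\<exists>\<mu>. \<forall>r. \<rho> (s_lift n q (2*i) (2*i - 1) r) *v \<xi> = \<mu> r *s \<xi>"
      using ev(2)[of i] unfolding sop_def by metis
  next
    fix i assume i: "i \<in> {1..n}"
    have "\<exists>c. \<forall>y\<in>Ysub n q. y - sbar_lift n q (2*i) (2*i - 1) r \<in> Ideal n q \<longrightarrow> \<rho> y *v \<xi> = c *s \<xi>" for r
    \<comment> \<open>Two lifts of the same barred coefficient differ by an element of the ideal, so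
      the eigenvalue found for one of them serves for all.\<close>
    proof (cases "\<exists>y\<in>Ysub n q. y - sbar_lift n q (2*i) (2*i - 1) r \<in> Ideal n q")
      case True
      then obtain y where y: "y \<in> Ysub n q" "y - sbar_lift n q (2*i) (2*i - 1) r \<in> Ideal n q" by blast
      obtain c where c: "\<rho> y *v \<xi> = c *s \<xi>" using bar_eigen[OF i ev[OF i] y] by blast
      have "\<rho> z *v \<xi> = c *s \<xi>" if z: "z \<in> Ysub n q" "z - sbar_lift n q (2*i) (2*i - 1) r \<in> Ideal n q" for z
      proof -
        have "z - y = (z - sbar_lift n q (2*i) (2*i - 1) r) - (y - sbar_lift n q (2*i) (2*i - 1) r)" by simp
        then have "z - y \<in> Ideal n q" using Ideal_diff[OF z(2) y(2)] by (simp only:)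
        then show ?thesis using rho_cong[OF z(1) y(1)] c by simp
      qed
      then show ?thesis by blast
    qed blast
    then show "\<exists>\<mu>. \<forall>r. \<forall>y\<in>Ysub n q. y - sbar_lift n q (2*i) (2*i - 1) r \<in> Ideal n q \<longrightarrow> \<rho> y *v \<xi> = \<mu> r *s \<xi>"
      by metis
  qed
  then show ?thesis using that uniq highest_singular by blast
qed

end

theorem theorem4p2:
  fixes n :: nat and q :: complex and \<rho> :: "fa \<Rightarrow> complex ^ 'd ^ 'd"
  assumes "q \<noteq> 0" and "\<forall>k::nat. k > 0 \<longrightarrow> q ^ k \<noteq> 1" and "n \<ge> 1"
    and "is_rep n q \<rho>" and "is_irreducible n q \<rho>"
  shows "is_highest_weight_rep n q \<rho>
       \<and> (\<exists>\<xi>. is_highest_vector n q \<rho> \<xi> \<and>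
            (\<forall>\<xi>'. is_highest_vector n q \<rho> \<xi>' \<longrightarrow> (\<exists>c. \<xi>' = c *s \<xi>)))"
proof -
  interpret Y_rep n q \<rho> using assms by unfold_locales auto
  show ?thesis
    using exists_unique_highest[OF assms(5)] unfolding is_highest_weight_rep_def by metis
qed

end
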